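(* Let $k$ be an algebraically closed field of characteristic $p>2$ and let $j\in\mathbb{Z}_{\ge0}$. The additive polynomial functors on $\mathrm{sVec}$ of degree $p^j$ are (up to isomorphism) exactly the direct sums of copies of $\mathrm{Fr}_+^{j}$ and $\mathrm{Fr}_-^{j}$.
   Context: $\mathrm{sVec}$ is the symmetric tensor category of finite-dimensional $\mathbb{Z}/2$-graded $k$-vector spaces with sign-twisted braiding. For $d>0$ and $X\in\mathrm{sVec}$, $S_d$ acts on $X^{\otimes d}$ via the braiding. $\mathbf{B}^d[\mathrm{sVec}]\subset\mathrm{Rep}_kS_d$ is the full subcategory of finite direct sums of direct summands of the underlying $S_d$-representations of $X^{\otimes d}$, $X\in\mathrm{sVec}$ (its indecomposables are the signed Young modules). A polynomial functor of degree $d$ on $\mathrm{sVec}$ is a $k$-linear functor $F:\mathbf{B}^d[\mathrm{sVec}]\to\mathrm{Vec}$ to finite-dimensional vector spaces. It induces an endofunctor $\mathfrak{F}$ of $\mathrm{sVec}$, $\mathfrak{F}(X)=F(X^{\otimes d})$ (with the $\mathbb{Z}/2$-grading of $X^{\otimes d}$ carried over by functoriality), $\mathfrak F(f)=F(f^{\otimes d})$; $F$ is additive if $\mathfrak{F}$ is additive. For indecomposable $M\in\mathbf{B}^d[\mathrm{sVec}]$, $D_M$ denotes the simple object of $\mathrm{Fun}_k(\mathbf{B}^d[\mathrm{sVec}],\mathrm{Vec})$ with projective cover $\mathrm{Hom}_{S_d}(M,-)$. $\mathrm{Fr}_+^{j}$ is $D_M$ for $M$ the trivial representation of $S_{p^j}$;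 it evaluates as $X\mapsto\mathrm{im}(\Gamma^{p^j}X\hookrightarrow X^{\otimes p^j}\twoheadrightarrow S^{p^j}X)$. $\mathrm{Fr}_-^{j}$ is $D_M$ for $M$ the sign representation of $S_{p^j}$. *)

theory Defs
  imports
    "Jordan_Normal_Form.VS_Connect"
    "HOL-Combinatorics.Permutations"
    "HOL-Computational_Algebra.Computational_Algebra"
begin

text \<open>
  All finite-dimensional vector spaces are taken in coordinates: the object of dimension \<open>n\<close>
  is \<open>k^n = carrier_vec n\<close> and a linear map \<open>k^m \<rightarrow> k^n\<close> is a matrix in
  \<open>carrier_mat n m\<close>.
\<close>


section \<open>Representations of the symmetric group\<close>

text \<open>
  A representation of the symmetric group on the set of positions \<open>{..<d}\<close>. Only the values of
  \<open>ract\<close> at permutations of \<open>{..<d}\<close> are meaningful.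
\<close>

record 'k rep =
  rdim :: nat
  ract :: "(nat \<Rightarrow> nat) \<Rightarrow> 'k mat"

definition is_rep :: "nat \<Rightarrow> 'k::field rep \<Rightarrow> bool" where
  "is_rep d M \<longleftrightarrow>
     (\<forall>\<sigma>. \<sigma> permutes {..<d} \<longrightarrow> ract M \<sigma> \<in> carrier_mat (rdim M) (rdim M)) \<and>
     ract M id = 1\<^sub>m (rdim M) \<and>
     (\<forall>\<sigma> \<tau>. \<sigma> permutes {..<d} \<longrightarrow> \<tau> permutes {..<d} \<longrightarrow>
        ract M (\<sigma> \<circ> \<tau>) = ract M \<sigma> * ract M \<tau>)"

definition rep_hom :: "nat \<Rightarrow> 'k::field rep \<Rightarrow> 'k rep \<Rightarrow> 'k mat set" where
  "rep_hom d M N = {f \<in> carrier_mat (rdim N) (rdim M).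
     \<forall>\<sigma>. \<sigma> permutes {..<d} \<longrightarrow> f * ract M \<sigma> = ract N \<sigma> * f}"

definition rep_iso :: "nat \<Rightarrow> 'k::field rep \<Rightarrow> 'k rep \<Rightarrow> bool" where
  "rep_iso d M N \<longleftrightarrow> (\<exists>f \<in> rep_hom d M N. invertible_mat f)"

definition rep_sum :: "'k::field rep list \<Rightarrow> 'k rep" where
  "rep_sum Ms = \<lparr>rdim = (\<Sum>M\<leftarrow>Ms. rdim M),
                 ract = (\<lambda>\<sigma>. diag_block_mat (map (\<lambda>M. ract M \<sigma>) Ms))\<rparr>"

definition rep_summand :: "nat \<Rightarrow> 'k::field rep \<Rightarrow> 'k rep \<Rightarrow> bool" where
  "rep_summand d S T \<longleftrightarrow> is_rep d S \<and> (\<exists>S'. is_rep d S' \<and> rep_iso d (rep_sum [S, S']) T)"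

definition triv_rep :: "'k::field rep" where
  "triv_rep = \<lparr>rdim = 1, ract = (\<lambda>\<sigma>. 1\<^sub>m 1)\<rparr>"

definition sign_rep :: "'k::field rep" where
  "sign_rep = \<lparr>rdim = 1, ract = (\<lambda>\<sigma>. of_int (sign \<sigma>) \<cdot>\<^sub>m 1\<^sub>m 1)\<rparr>"


section \<open>Super vector spaces and their tensor powers\<close>

text \<open>
  The object \<open>(m, n)\<close> of \<open>sVec\<close> is \<open>k^{m|n}\<close>: the first \<open>m\<close> standard basis vectors are even,
  the last \<open>n\<close> are odd. Every finite-dimensional super vector space has a homogeneous basis.
\<close>

type_synonym svec = "nat \<times> nat"

definition sdim :: "svec \<Rightarrow> nat" where
  "sdim X = fst X + snd X"

definition odd_index :: "svec \<Rightarrow> nat \<Rightarrow> bool" where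
  "odd_index X i \<longleftrightarrow> fst X \<le> i"

definition svec_hom :: "svec \<Rightarrow> svec \<Rightarrow> 'k::field mat set" where
  "svec_hom X Y = {f \<in> carrier_mat (sdim Y) (sdim X).
     \<forall>i < sdim Y. \<forall>j < sdim X. odd_index Y i \<noteq> odd_index X j \<longrightarrow> f $$ (i, j) = 0}"

text \<open>
  The basis of the \<open>d\<close>-th tensor power of a space of dimension \<open>q\<close> consists of the words of
  length \<open>d\<close> over \<open>{..<q}\<close>; the word \<open>w\<close> is encoded as the number
  \<open>w 0 + w 1 * q + \<dots> + w (d - 1) * q ^ (d - 1) < q ^ d\<close>.
\<close>

definition letter :: "nat \<Rightarrow> nat \<Rightarrow> nat \<Rightarrow> nat" where
  "letter q i t = (i div q ^ t) mod q"

text \<open>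
  The braiding \<open>x \<otimes> y \<mapsto> (-1)^(|x||y|) y \<otimes> x\<close> makes \<open>\<sigma>\<close> move the factor at position \<open>t\<close>
  to position \<open>\<sigma> t\<close>, with one sign for each pair of odd factors whose order is reversed.
\<close>

definition koszul_sign :: "nat \<Rightarrow> (nat \<Rightarrow> nat) \<Rightarrow> (nat \<Rightarrow> bool) \<Rightarrow> 'k::field" where
  "koszul_sign d \<sigma> odd_at =
     (-1) ^ card {(s, t). s < t \<and> t < d \<and> \<sigma> t < \<sigma> s \<and> odd_at s \<and> odd_at t}"

definition tensor_rep :: "nat \<Rightarrow> svec \<Rightarrow> 'k::field rep" where
  "tensor_rep d X = (let q = sdim X in
     \<lparr>rdim = q ^ d,
      ract = (\<lambda>\<sigma>. mat (q ^ d) (q ^ d) (\<lambda>(i, j).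
        if \<forall>t<d. letter q i (\<sigma> t) = letter q j t
        then koszul_sign d \<sigma> (\<lambda>t. odd_index X (letter q j t))
        else 0))\<rparr>)"

definition tensor_map :: "nat \<Rightarrow> 'k::field mat \<Rightarrow> 'k mat" where
  "tensor_map d f = mat (dim_row f ^ d) (dim_col f ^ d)
     (\<lambda>(i, j). \<Prod>t<d. f $$ (letter (dim_row f) i t, letter (dim_col f) j t))"


section \<open>The category of polynomial functors of degree \<open>d\<close>\<close>

text \<open>The objects of \<open>\<^bold>B\<^sup>d[sVec]\<close>; the morphisms are given by \<^term>\<open>rep_hom d\<close>.\<close>

definition Bobj :: "nat \<Rightarrow> 'k::field rep set" where
  "Bobj d = {M. is_rep d M \<and>
     (\<exists>Ss. (\<forall>S \<in> set Ss. \<exists>X. rep_summand d S (tensor_rep d X)) \<and> rep_iso d M (rep_sum Ss))}"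

text \<open>
  \<open>fmor F M N f\<close> is the value of \<open>F\<close> at \<open>f : M \<rightarrow> N\<close>; source and target are arguments because
  they cannot be read off from the matrix \<open>f\<close>.
\<close>

record 'k rep_functor =
  fobj :: "'k rep \<Rightarrow> nat"
  fmor :: "'k rep \<Rightarrow> 'k rep \<Rightarrow> 'k mat \<Rightarrow> 'k mat"

definition polynomial_functor :: "nat \<Rightarrow> 'k::field rep_functor \<Rightarrow> bool" where
  "polynomial_functor d F \<longleftrightarrow>
     (\<forall>M \<in> Bobj d. \<forall>N \<in> Bobj d. \<forall>f \<in> rep_hom d M N.
        fmor F M N f \<in> carrier_mat (fobj F N) (fobj F M)) \<and>
     (\<forall>M \<in> Bobj d. fmor F M M (1\<^sub>m (rdim M)) = 1\<^sub>m (fobj F M)) \<and>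
     (\<forall>L \<in> Bobj d. \<forall>M \<in> Bobj d. \<forall>N \<in> Bobj d. \<forall>f \<in> rep_hom d L M. \<forall>g \<in> rep_hom d M N.
        fmor F L N (g * f) = fmor F M N g * fmor F L M f) \<and>
     (\<forall>M \<in> Bobj d. \<forall>N \<in> Bobj d. \<forall>f \<in> rep_hom d M N. \<forall>g \<in> rep_hom d M N.
        fmor F M N (f + g) = fmor F M N f + fmor F M N g) \<and>
     (\<forall>M \<in> Bobj d. \<forall>N \<in> Bobj d. \<forall>f \<in> rep_hom d M N. \<forall>c.
        fmor F M N (c \<cdot>\<^sub>m f) = c \<cdot>\<^sub>m fmor F M N f)"

definition nat_trans ::
  "nat \<Rightarrow> 'k::field rep_functor \<Rightarrow> 'k rep_functor \<Rightarrow> ('k rep \<Rightarrow> 'k mat) \<Rightarrow> bool" where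
  "nat_trans d F G \<eta> \<longleftrightarrow>
     (\<forall>M \<in> Bobj d. \<eta> M \<in> carrier_mat (fobj G M) (fobj F M)) \<and>
     (\<forall>M \<in> Bobj d. \<forall>N \<in> Bobj d. \<forall>f \<in> rep_hom d M N.
        fmor G M N f * \<eta> M = \<eta> N * fmor F M N f)"

definition functor_iso :: "nat \<Rightarrow> 'k::field rep_functor \<Rightarrow> 'k rep_functor \<Rightarrow> bool" where
  "functor_iso d F G \<longleftrightarrow> (\<exists>\<eta>. nat_trans d F G \<eta> \<and> (\<forall>M \<in> Bobj d. invertible_mat (\<eta> M)))"

definition functor_sum :: "'k::field rep_functor list \<Rightarrow> 'k rep_functor" where
  "functor_sum Fs = \<lparr>fobj = (\<lambda>M. \<Sum>F\<leftarrow>Fs. fobj F M),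
     fmor = (\<lambda>M N f. diag_block_mat (map (\<lambda>F. fmor F M N f) Fs))\<rparr>"


section \<open>Additive polynomial functors\<close>

text \<open>
  The action on morphisms of the endofunctor of \<open>sVec\<close> induced by \<open>F\<close>. Its value at \<open>X\<close> is
  \<open>k^n\<close> with \<open>n = fobj F (tensor_rep d X)\<close>, graded by the images under \<open>F\<close> of the projections of
  \<open>tensor_rep d X\<close> onto its even and odd parts. As sums of morphisms in \<open>sVec\<close> are sums of the
  underlying linear maps, that grading does not enter the definition of additivity.
\<close>

definition induced_mor ::
  "nat \<Rightarrow> 'k::field rep_functor \<Rightarrow> svec \<Rightarrow> svec \<Rightarrow> 'k mat \<Rightarrow> 'k mat" where
  "induced_mor d F X Y f = fmor F (tensor_rep d X) (tensor_rep d Y) (tensor_map d f)"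

definition additive_polynomial_functor :: "nat \<Rightarrow> 'k::field rep_functor \<Rightarrow> bool" where
  "additive_polynomial_functor d F \<longleftrightarrow> polynomial_functor d F \<and>
     (\<forall>X Y. \<forall>f \<in> svec_hom X Y. \<forall>g \<in> svec_hom X Y.
        induced_mor d F X Y (f + g) = induced_mor d F X Y f + induced_mor d F X Y g)"


section \<open>Simple functors and their projective covers\<close>

text \<open>Kernels, images and subobjects in the functor category are computed objectwise.\<close>

definition subfunctor :: "nat \<Rightarrow> 'k::field rep_functor \<Rightarrow> ('k rep \<Rightarrow> 'k vec set) \<Rightarrow> bool" where
  "subfunctor d F U \<longleftrightarrow>
     (\<forall>M \<in> Bobj d. VectorSpace.subspace class_ring (U M) (module_vec TYPE('k) (fobj F M))) \<and>
     (\<forall>M \<in> Bobj d. \<forall>N \<in> Bobj d. \<forall>f \<in> rep_hom d M N. \<forall>v \<in> U M. fmor F M N f *\<^sub>v v \<in> U N)"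

definition simple_functor :: "nat \<Rightarrow> 'k::field rep_functor \<Rightarrow> bool" where
  "simple_functor d F \<longleftrightarrow> polynomial_functor d F \<and>
     (\<exists>M \<in> Bobj d. fobj F M \<noteq> 0) \<and>
     (\<forall>U. subfunctor d F U \<longrightarrow>
        (\<forall>M \<in> Bobj d. U M = {0\<^sub>v (fobj F M)}) \<or> (\<forall>M \<in> Bobj d. U M = carrier_vec (fobj F M)))"

definition functor_epi ::
  "nat \<Rightarrow> 'k::field rep_functor \<Rightarrow> 'k rep_functor \<Rightarrow> ('k rep \<Rightarrow> 'k mat) \<Rightarrow> bool" where
  "functor_epi d F G \<pi> \<longleftrightarrow> nat_trans d F G \<pi> \<and>
     (\<forall>M \<in> Bobj d. (\<lambda>v. \<pi> M *\<^sub>v v) ` carrier_vec (fobj F M) = carrier_vec (fobj G M))"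

definition projective_functor :: "nat \<Rightarrow> 'k::field rep_functor \<Rightarrow> bool" where
  "projective_functor d P \<longleftrightarrow> polynomial_functor d P \<and>
     (\<forall>F G \<pi> \<theta>. polynomial_functor d F \<longrightarrow> polynomial_functor d G \<longrightarrow>
        functor_epi d F G \<pi> \<longrightarrow> nat_trans d P G \<theta> \<longrightarrow>
        (\<exists>\<theta>'. nat_trans d P F \<theta>' \<and> (\<forall>M \<in> Bobj d. \<pi> M * \<theta>' M = \<theta> M)))"

text \<open>A projective cover is an essential (superfluous-kernel) epimorphism from a projective.\<close>

definition projective_cover ::
  "nat \<Rightarrow> 'k::field rep_functor \<Rightarrow> 'k rep_functor \<Rightarrow> ('k rep \<Rightarrow> 'k mat) \<Rightarrow> bool" where
  "projective_cover d P F \<pi> \<longleftrightarrow> projective_functor d P \<and> functor_epi d P F \<pi> \<and>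
     (\<forall>U. subfunctor d P U \<longrightarrow>
        (\<forall>M \<in> Bobj d. (\<lambda>v. \<pi> M *\<^sub>v v) ` U M = carrier_vec (fobj F M)) \<longrightarrow>
        (\<forall>M \<in> Bobj d. U M = carrier_vec (fobj P M)))"

text \<open>
  \<open>H\<close> is the functor \<open>Hom(M, -)\<close> in coordinates: \<open>\<phi> N\<close> identifies the vector space
  \<open>rep_hom d M N\<close> with \<open>k^n\<close>, \<open>n = fobj H N\<close>, and postcomposition with the action of \<open>H\<close>.
\<close>

definition is_hom_functor :: "nat \<Rightarrow> 'k::field rep \<Rightarrow> 'k rep_functor \<Rightarrow> bool" where
  "is_hom_functor d M H \<longleftrightarrow> polynomial_functor d H \<and>
     (\<exists>\<phi>. (\<forall>N \<in> Bobj d.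
             bij_betw (\<phi> N) (rep_hom d M N) (carrier_vec (fobj H N)) \<and>
             (\<forall>f \<in> rep_hom d M N. \<forall>g \<in> rep_hom d M N. \<phi> N (f + g) = \<phi> N f + \<phi> N g) \<and>
             (\<forall>f \<in> rep_hom d M N. \<forall>c. \<phi> N (c \<cdot>\<^sub>m f) = c \<cdot>\<^sub>v \<phi> N f)) \<and>
          (\<forall>N \<in> Bobj d. \<forall>N' \<in> Bobj d. \<forall>f \<in> rep_hom d M N. \<forall>g \<in> rep_hom d N N'.
             \<phi> N' (g * f) = fmor H N N' g *\<^sub>v \<phi> N f))"

text \<open>The functor \<open>D\<^sub>M\<close>; being defined up to isomorphism only, it is picked by choice.\<close>

definition simple_top :: "nat \<Rightarrow> 'k::field rep \<Rightarrow> 'k rep_functor" where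
  "simple_top d M = (SOME D. simple_functor d D \<and>
     (\<exists>H \<pi>. is_hom_functor d M H \<and> projective_cover d H D \<pi>))"

definition Fr_plus :: "nat \<Rightarrow> nat \<Rightarrow> 'k::field rep_functor" where
  "Fr_plus p j = simple_top (p ^ j) triv_rep"

definition Fr_minus :: "nat \<Rightarrow> nat \<Rightarrow> 'k::field rep_functor" where
  "Fr_minus p j = simple_top (p ^ j) sign_rep"

end

theory Submission
  imports Defs
begin

text \<open>
  Let \<open>L\<close> be the trivial or the sign representation of \<open>S\<^sub>d\<close>, \<open>d = p\<^sup>j\<close>. For \<open>a : L \<rightarrow> X\<^sup>\<otimes>\<^sup>d\<close> and
  \<open>b : Y\<^sup>\<otimes>\<^sup>d \<rightarrow> L\<close> the scalar \<open>b (f + g)\<^sup>\<otimes>\<^sup>d a\<close> is additive in \<open>f, g\<close>, because the mixed terms occur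
  with coefficients divisible by \<open>p\<close>. In the simple top of \<open>Hom(L, -)\<close> every vector comes from \<open>L\<close>, and
  is zero as soon as all maps to \<open>L\<close> kill it; hence this functor is additive.

  Conversely, an additive functor sends the identity of \<open>X\<^sup>\<otimes>\<^sup>d\<close> to the sum over the basis of \<open>X\<close> of the
  images of the \<open>d\<close>-th tensor powers of the coordinate projections, and those factor through the trivial
  or the sign representation. So it is determined, up to isomorphism, by the dimensions of its values on
  these two, which have no nonzero maps between them if \<open>d > 1\<close>.
\<close>

text \<open>\<open>simple_top\<close> is a choice, so its values cannot be computed from its
  definition: an admissible functor has to be constructed to see that the choice meets its
  specification, and afterwards only that specification may be used. Both functors in it, Hom(L, -)
  and its simple quotient, come from one construction. It divides Hom(L, N) by the vectors that a
  given space of functionals kills; all functionals give Hom(L, -) itself, the maps from N to L give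
  the simple quotient. In the converse the projections sum to the identity only after an additive
  functor is applied, not among representations. An isomorphism of functors therefore cannot be
  assembled from a decomposition of objects. It is characterised instead by compatibility with all
  maps to lines, a condition that at most one matrix satisfies. The splitting has to be carried from
  tensor powers to their summands and to finite sums of these. The restriction \<open>p > 2\<close>
  makes 1 and -1 differ, which separates the two lines in degrees above 1.\<close>

no_notation fps_nth (infixl \<open>$\<close> 75)

section \<open>Words\<close>

lemma letter_less: "0 < q \<Longrightarrow> letter q i t < q"
  by (simp add: letter_def)

lemma letter_0: "letter q i 0 = i mod q"
  by (simp add: letter_def)

lemma letter_Suc: "letter q i (Suc t) = letter q (i div q) t"
  by (simp add: letter_def div_mult2_eq)

lemma word_eqI:
  assumes "i < q ^ d" "j < q ^ d" "\<And>t. t < d \<Longrightarrow> letter q i t = letter q j t"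
  shows "i = j"
  using assms
proof (induction d arbitrary: i j)
  case (Suc d)
  have "i div q = j div q"
  proof (rule Suc.IH)
    show "i div q < q ^ d" "j div q < q ^ d"
      using Suc.prems(1,2) by (simp_all add: less_mult_imp_div_less mult.commute)
    show "letter q (i div q) t = letter q (j div q) t" if "t < d" for t
      using Suc.prems(3)[of "Suc t"] that by (simp add: letter_Suc)
  qed
  moreover have "i mod q = j mod q"
    using Suc.prems(3)[of 0] by (simp add: letter_0)
  ultimately show ?case
    by (metis div_mult_mod_eq)
qed auto

lemma word_exists:
  assumes "\<And>t. t < d \<Longrightarrow> w t < q"
  shows "\<exists>i < q ^ d. \<forall>t < d. letter q i t = w t"
  using assms
proof (induction d arbitrary: w)
  case (Suc d)
  obtain i where i: "i < q ^ d" "\<And>t. t < d \<Longrightarrow> letter q i t = w (Suc t)"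
    using Suc.IH[of "\<lambda>t. w (Suc t)"] Suc.prems by auto
  have w0: "w 0 < q"
    using Suc.prems by simp
  have "w 0 + q * i < q * (i + 1)"
    using w0 by simp
  also have "\<dots> \<le> q * q ^ d"
    using i(1) by (intro mult_le_mono) auto
  finally have "w 0 + q * i < q ^ Suc d"
    by simp
  moreover have "letter q (w 0 + q * i) t = w t" if "t < Suc d" for t
    using that w0 i(2) by (cases t) (auto simp: letter_0 letter_Suc)
  ultimately show ?case
    by blast
qed simp

text \<open>The permutation of words under which the letter at position \<open>t\<close> moves to
  position \<open>\<sigma> t\<close>. A code below \<open>q ^ d\<close> is determined by its
  letters, so for \<open>\<sigma>\<close> permuting the positions and \<open>j < q ^ d\<close> the
  choice has exactly one candidate.\<close>

definition word_perm :: "nat \<Rightarrow> nat \<Rightarrow> (nat \<Rightarrow> nat) \<Rightarrow> nat \<Rightarrow> nat" where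
  "word_perm q d \<sigma> j = (SOME i. i < q ^ d \<and> (\<forall>t < d. letter q i (\<sigma> t) = letter q j t))"

lemma permutes_lessThan: "\<sigma> permutes {..<d} \<Longrightarrow> t < d \<Longrightarrow> \<sigma> t < d" for t d :: nat
  using permutes_in_image[of \<sigma> "{..<d}" t] by simp

lemma word_perm:
  assumes "\<sigma> permutes {..<d}" "j < q ^ d"
  shows word_perm_less: "word_perm q d \<sigma> j < q ^ d"
    and letter_word_perm: "t < d \<Longrightarrow> letter q (word_perm q d \<sigma> j) (\<sigma> t) = letter q j t"
proof -
  have "\<exists>i < q ^ d. \<forall>t < d. letter q i t = letter q j (Hilbert_Choice.inv \<sigma> t)"
  proof (rule word_exists)
    fix t assume "t < d"
    with assms(2) have "0 < q"
      by (cases "q = 0") (auto simp: power_0_left)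
    then show "letter q j (Hilbert_Choice.inv \<sigma> t) < q"
      by (rule letter_less)
  qed
  then have "\<exists>i. i < q ^ d \<and> (\<forall>t < d. letter q i (\<sigma> t) = letter q j t)"
    using permutes_lessThan[OF assms(1)] permutes_inverses(2)[OF assms(1)] by auto
  then have "word_perm q d \<sigma> j < q ^ d \<and>
      (\<forall>t < d. letter q (word_perm q d \<sigma> j) (\<sigma> t) = letter q j t)"
    unfolding word_perm_def by (rule someI_ex)
  then show "word_perm q d \<sigma> j < q ^ d"
    "t < d \<Longrightarrow> letter q (word_perm q d \<sigma> j) (\<sigma> t) = letter q j t"
    by auto
qed

text \<open>Letters prescribed at the positions \<open>\<sigma> t\<close> are prescribed everywhere,
  since \<open>\<sigma>\<close> is onto.\<close>

lemma word_perm_eqI: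
  assumes "\<sigma> permutes {..<d}" "j < q ^ d" "i < q ^ d"
    and "\<And>t. t < d \<Longrightarrow> letter q i (\<sigma> t) = letter q j t"
  shows "word_perm q d \<sigma> j = i"
proof (rule word_eqI)
  fix t assume t: "t < d"
  have "letter q (word_perm q d \<sigma> j) (\<sigma> (Hilbert_Choice.inv \<sigma> t)) = letter q i (\<sigma> (Hilbert_Choice.inv \<sigma> t))"
    using assms(4) letter_word_perm[OF assms(1,2)]
      permutes_lessThan[OF permutes_inv[OF assms(1)] t] by simp
  then show "letter q (word_perm q d \<sigma> j) t = letter q i t"
    by (simp add: permutes_inverses[OF assms(1)])
qed (use assms word_perm_less in auto)

lemma word_perm_id: "j < q ^ d \<Longrightarrow> word_perm q d id j = j"
  by (rule word_perm_eqI) (auto simp: permutes_id)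

lemma word_perm_comp:
  assumes "\<sigma> permutes {..<d}" "\<tau> permutes {..<d}" "j < q ^ d"
  shows "word_perm q d (\<sigma> \<circ> \<tau>) j = word_perm q d \<sigma> (word_perm q d \<tau> j)"
  using assms
  by (intro word_perm_eqI)
    (auto simp: permutes_compose word_perm_less letter_word_perm permutes_lessThan)

lemma word_perm_inv:
  assumes "\<sigma> permutes {..<d}" "j < q ^ d"
  shows "word_perm q d \<sigma> (word_perm q d (Hilbert_Choice.inv \<sigma>) j) = j"
  using word_perm_comp[OF assms(1) permutes_inv[OF assms(1)] assms(2)]
  by (simp add: permutes_inv_o[OF assms(1)] word_perm_id assms(2))

lemma word_perm_inv':
  assumes "\<sigma> permutes {..<d}" "j < q ^ d"
  shows "word_perm q d (Hilbert_Choice.inv \<sigma>) (word_perm q d \<sigma> j) = j"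
  using word_perm_comp[OF permutes_inv[OF assms(1)] assms(1) assms(2)]
  by (simp add: permutes_inv_o[OF assms(1)] word_perm_id assms(2))

section \<open>The Koszul sign\<close>

text \<open>The contribution of one pair of positions to the sign. Comparing the two orders by an
  equivalence, instead of asking for an inversion, makes the value independent of which of two
  distinct positions is named first when \<open>\<sigma>\<close> is injective.\<close>

definition order_sign :: "(nat \<Rightarrow> nat) \<Rightarrow> nat \<times> nat \<Rightarrow> 'k::field" where
  "order_sign \<sigma> = (\<lambda>(s, t). if s < t \<longleftrightarrow> \<sigma> s < \<sigma> t then 1 else - 1)"

definition odd_pairs :: "nat \<Rightarrow> (nat \<Rightarrow> bool) \<Rightarrow> (nat \<times> nat) set" where
  "odd_pairs d P = {(s, t). s < t \<and> t < d \<and> P s \<and> P t}"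

lemma finite_odd_pairs: "finite (odd_pairs d P)"
  by (rule finite_subset[of _ "{..<d} \<times> {..<d}"]) (auto simp: odd_pairs_def)

text \<open>Replaces the count of inversions by a product over all pairs of odd positions, where
  multiplicativity in \<open>\<sigma>\<close> can be checked factor by factor; pairs whose order is
  kept contribute 1.\<close>

lemma koszul_sign_eq_prod:
  assumes "\<sigma> permutes {..<d}"
  shows "koszul_sign d \<sigma> P = (\<Prod>x \<in> odd_pairs d P. order_sign \<sigma> x :: 'k::field)"
proof -
  let ?I = "{(s, t). s < t \<and> t < d \<and> \<sigma> t < \<sigma> s \<and> P s \<and> P t}"
  have I: "?I \<subseteq> odd_pairs d P"
    by (auto simp: odd_pairs_def)
  have "(\<Prod>x \<in> odd_pairs d P. order_sign \<sigma> x :: 'k)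
      = (\<Prod>x \<in> odd_pairs d P - ?I. order_sign \<sigma> x) * (\<Prod>x \<in> ?I. order_sign \<sigma> x)"
    by (rule prod.subset_diff[OF I finite_odd_pairs])
  also have "(\<Prod>x \<in> odd_pairs d P - ?I. order_sign \<sigma> x :: 'k) = 1"
  proof (rule prod.neutral, rule ballI)
    fix x assume x: "x \<in> odd_pairs d P - ?I"
    then obtain s t where st: "x = (s, t)" "s < t" "\<not> \<sigma> t < \<sigma> s"
      by (auto simp: odd_pairs_def)
    moreover have "\<sigma> s \<noteq> \<sigma> t"
      using st(2) permutes_inj[OF assms] by (auto dest: injD)
    ultimately show "order_sign \<sigma> x = (1 :: 'k)"
      by (auto simp: order_sign_def)
  qed
  also have "(\<Prod>x \<in> ?I. order_sign \<sigma> x :: 'k) = (\<Prod>x \<in> ?I. - 1)"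
    by (rule prod.cong) (auto simp: order_sign_def)
  finally show ?thesis
    by (simp add: koszul_sign_def)
qed

lemma koszul_sign_cong:
  assumes "\<And>t. t < d \<Longrightarrow> P t = Q t"
  shows "koszul_sign d \<sigma> P = (koszul_sign d \<sigma> Q :: 'k::field)"
proof -
  have "{(s, t). s < t \<and> t < d \<and> \<sigma> t < \<sigma> s \<and> P s \<and> P t}
      = {(s, t). s < t \<and> t < d \<and> \<sigma> t < \<sigma> s \<and> Q s \<and> Q t}"
    using assms by auto
  then show ?thesis
    by (simp add: koszul_sign_def)
qed

lemma koszul_sign_id: "koszul_sign d id P = (1 :: 'k::field)"
proof -
  have *: "{(s, t). s < t \<and> t < d \<and> id t < id s \<and> P s \<and> P t} = {}"
    by auto
  show ?thesis
    unfolding koszul_sign_def * by simp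
qed

text \<open>\<open>order_sign\<close> is symmetric and multiplicative, so both sides are products over unordered pairs.\<close>

lemma koszul_sign_comp:
  assumes \<sigma>: "\<sigma> permutes {..<d}" and \<tau>: "\<tau> permutes {..<d}"
    and Q: "\<And>t. t < d \<Longrightarrow> Q (\<tau> t) = P t"
  shows "koszul_sign d (\<sigma> \<circ> \<tau>) P = (koszul_sign d \<sigma> Q * koszul_sign d \<tau> P :: 'k::field)"
proof -
  let ?i = "Hilbert_Choice.inv \<tau>"
  \<comment> \<open>The action of \<open>\<tau>\<close> on unordered pairs, each written with its
    smaller member first; \<open>h'\<close> is the same for the inverse permutation.\<close>
  define h where "h = (\<lambda>(s, t). if \<tau> s < \<tau> t then (\<tau> s, \<tau> t) else (\<tau> t, \<tau> s))"
  define h' where "h' = (\<lambda>(s, t). if ?i s < ?i t then (?i s, ?i t) else (?i t, ?i s))"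
  note inv = permutes_inverses[OF \<tau>]
  have neq: "\<tau> s \<noteq> \<tau> t" "\<sigma> s \<noteq> \<sigma> t" "?i s \<noteq> ?i t" if "s \<noteq> t" for s t
    using that permutes_inj[OF \<tau>] permutes_inj[OF \<sigma>] permutes_inj[OF permutes_inv[OF \<tau>]]
    by (auto dest: injD)
  have less: "\<tau> t < d" "?i t < d" if "t < d" for t
    using that permutes_lessThan \<tau> permutes_inv[OF \<tau>] by blast+
  have Q': "P (?i t) = Q t" if "t < d" for t
    using Q[OF less(2)[OF that]] by (simp add: inv)
  have bij: "bij_betw h (odd_pairs d P) (odd_pairs d Q)"
  proof (rule bij_betw_byWitness[where f' = h'])
    show "\<forall>x \<in> odd_pairs d P. h' (h x) = x"
      by (auto simp: h_def h'_def odd_pairs_def inv)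
    show "\<forall>x \<in> odd_pairs d Q. h (h' x) = x"
      by (auto simp: h_def h'_def odd_pairs_def inv)
    show "h ` odd_pairs d P \<subseteq> odd_pairs d Q"
    proof (rule image_subsetI)
      fix x assume "x \<in> odd_pairs d P"
      then obtain s t where "x = (s, t)" "s < t" "t < d" "P s" "P t"
        by (auto simp: odd_pairs_def)
      then show "h x \<in> odd_pairs d Q"
        using neq(1)[of s t] less(1)[of s] less(1)[of t] Q[of s] Q[of t]
        by (auto simp: h_def odd_pairs_def)
    qed
    show "h' ` odd_pairs d Q \<subseteq> odd_pairs d P"
    proof (rule image_subsetI)
      fix x assume "x \<in> odd_pairs d Q"
      then obtain s t where "x = (s, t)" "s < t" "t < d" "Q s" "Q t"
        by (auto simp: odd_pairs_def)
      then show "h' x \<in> odd_pairs d P"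
        using neq(3)[of s t] less(2)[of s] less(2)[of t] Q'[of s] Q'[of t]
        by (auto simp: h'_def odd_pairs_def)
    qed
  qed
  have "order_sign (\<sigma> \<circ> \<tau>) x = (order_sign \<sigma> (h x) * order_sign \<tau> x :: 'k)"
    if x: "x \<in> odd_pairs d P" for x
  proof -
    obtain s t where "x = (s, t)" "s < t"
      using x by (auto simp: odd_pairs_def)
    then show ?thesis
      using neq[of s t] neq(2)[of "\<tau> s" "\<tau> t"] by (auto simp: order_sign_def h_def)
  qed
  then have "(\<Prod>x \<in> odd_pairs d P. order_sign (\<sigma> \<circ> \<tau>) x :: 'k)
      = (\<Prod>x \<in> odd_pairs d P. order_sign \<sigma> (h x)) * (\<Prod>x \<in> odd_pairs d P. order_sign \<tau> x)"
    by (simp add: prod.distrib)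
  also have "(\<Prod>x \<in> odd_pairs d P. order_sign \<sigma> (h x) :: 'k) = (\<Prod>x \<in> odd_pairs d Q. order_sign \<sigma> x)"
    by (rule prod.reindex_bij_betw[OF bij])
  finally show ?thesis
    unfolding koszul_sign_eq_prod[OF permutes_compose[OF \<tau> \<sigma>]]
      koszul_sign_eq_prod[OF \<sigma>] koszul_sign_eq_prod[OF \<tau>] .
qed

text \<open>For \<open>a < b\<close> the inversions pair \<open>a\<close> with the positions in
  \<open>{a<..b}\<close> and the positions in \<open>{a<..<b}\<close> with \<open>b\<close>. Their
  number \<open>2 * (b - a - 1) + 1\<close> is odd.\<close>

lemma koszul_sign_transpose:
  assumes "a < d" "b < d" "a \<noteq> b"
  shows "koszul_sign d (Transposition.transpose a b) (\<lambda>_. True) = (- 1 :: 'k::field)"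
proof -
  have *: "koszul_sign d (Transposition.transpose a b) (\<lambda>_. True) = (- 1 :: 'k)"
    if "a < b" "b < d" for a b
  proof -
    have "{(s, t). s < t \<and> t < d \<and> Transposition.transpose a b t < Transposition.transpose a b s}
        = (\<lambda>t. (a, t)) ` {a<..b} \<union> (\<lambda>s. (s, b)) ` {a<..<b}"
      using that by (auto simp: Transposition.transpose_def split: if_splits)
    moreover have "card ((\<lambda>t. (a, t)) ` {a<..b} \<union> (\<lambda>s. (s, b)) ` {a<..<b})
        = card {a<..b} + card {a<..<b}"
      by (subst card_Un_disjoint) (auto simp: card_image inj_on_def)
    moreover have "card {a<..b} + card {a<..<b} = Suc (2 * (b - Suc a))"
      using that by simp
    ultimately show ?thesis
      by (simp add: koszul_sign_def)
  qed
  show ?thesis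
    using *[of a b] *[of b a] assms by (metis linorder_neqE_nat transpose_commute)
qed

text \<open>Both sides are multiplicative and equal -1 on transpositions. This is what makes a
  tensor power of the odd line the sign representation.\<close>

lemma koszul_sign_eq_sign:
  assumes "\<sigma> permutes {..<d}"
  shows "koszul_sign d \<sigma> (\<lambda>_. True) = (of_int (sign \<sigma>) :: 'k::field)"
  using assms finite_lessThan
proof (induction \<sigma> rule: permutes_induct)
  case (swap a b p)
  have "koszul_sign d (Transposition.transpose a b \<circ> p) (\<lambda>_. True)
      = koszul_sign d (Transposition.transpose a b) (\<lambda>_. True) * (koszul_sign d p (\<lambda>_. True) :: 'k)"
    using swap by (intro koszul_sign_comp permutes_swap_id) auto
  also have "\<dots> = - of_int (sign p)"
    using swap by (simp add: koszul_sign_transpose)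
  also have "\<dots> = of_int (sign (Transposition.transpose a b \<circ> p))"
    using swap permutation_permutes[of p]
    by (auto simp: sign_compose permutation_swap_id sign_swap_id)
  finally show ?case .
qed (simp add: koszul_sign_id[unfolded id_def])

section \<open>Tensor powers as representations\<close>

lemma rdim_tensor_rep [simp]: "rdim (tensor_rep d X) = sdim X ^ d"
  by (simp add: tensor_rep_def Let_def)

text \<open>In this form the action is visibly a monomial matrix, with a single signed entry in each
  column, so that products with it can be computed entry by entry.\<close>

lemma ract_tensor_rep:
  assumes "\<sigma> permutes {..<d}"
  shows "ract (tensor_rep d X) \<sigma> = mat (sdim X ^ d) (sdim X ^ d) (\<lambda>(i, j).
    if i = word_perm (sdim X) d \<sigma> j
    then koszul_sign d \<sigma> (\<lambda>t. odd_index X (letter (sdim X) j t)) else 0 :: 'k::field)"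
proof -
  have "(\<forall>t<d. letter (sdim X) i (\<sigma> t) = letter (sdim X) j t) \<longleftrightarrow> i = word_perm (sdim X) d \<sigma> j"
    if "i < sdim X ^ d" "j < sdim X ^ d" for i j
    using that assms word_perm_eqI[OF assms that(2,1)] letter_word_perm[OF assms that(2)] by auto
  then show ?thesis
    unfolding tensor_rep_def Let_def by (auto intro!: eq_matI)
qed

text \<open>By injectivity, row \<open>\<pi> k\<close> of the monomial matrix can be nonzero only in
  column \<open>k\<close>.\<close>

lemma monomial_mat_mult_left:
  fixes c :: "nat \<Rightarrow> 'k::field"
  assumes "A \<in> carrier_mat N M" "k < N" "\<pi> k < N" "j < M" "inj_on \<pi> {..<N}"
  shows "(mat N N (\<lambda>(i, j). if i = \<pi> j then c j else 0) * A) $$ (\<pi> k, j) = c k * A $$ (k, j)"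
proof -
  have "(mat N N (\<lambda>(i, j). if i = \<pi> j then c j else 0) * A) $$ (\<pi> k, j)
      = (\<Sum>l \<in> {0..<N}. (if \<pi> k = \<pi> l then c l else 0) * A $$ (l, j))"
    using assms by (simp add: scalar_prod_def)
  also have "\<dots> = (\<Sum>l \<in> {0..<N}. if l = k then c k * A $$ (k, j) else 0)"
    using assms by (intro sum.cong) (auto simp: inj_on_def)
  finally show ?thesis
    using assms by simp
qed

lemma monomial_mat_mult_right:
  fixes c :: "nat \<Rightarrow> 'k::field"
  assumes "A \<in> carrier_mat M N" "j < N" "\<pi> j < N" "i < M"
  shows "(A * mat N N (\<lambda>(i, j). if i = \<pi> j then c j else 0)) $$ (i, j) = A $$ (i, \<pi> j) * c j"
proof -
  have "(A * mat N N (\<lambda>(i, j). if i = \<pi> j then c j else 0)) $$ (i, j)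
      = (\<Sum>l \<in> {0..<N}. A $$ (i, l) * (if l = \<pi> j then c j else 0))"
    using assms by (simp add: scalar_prod_def)
  also have "\<dots> = (\<Sum>l \<in> {0..<N}. if l = \<pi> j then A $$ (i, \<pi> j) * c j else 0)"
    by (intro sum.cong) auto
  finally show ?thesis
    using assms by simp
qed

lemma is_rep_tensor_rep: "is_rep d (tensor_rep d X :: 'k::field rep)"
  unfolding is_rep_def
proof (intro conjI allI impI)
  let ?T = "tensor_rep d X :: 'k rep"
  let ?q = "sdim X"
  let ?o = "\<lambda>j t. odd_index X (letter ?q j t)"
  show "ract ?T \<sigma> \<in> carrier_mat (rdim ?T) (rdim ?T)"
    if "\<sigma> permutes {..<d}" for \<sigma>
    by (simp add: ract_tensor_rep that)
  show "ract ?T id = 1\<^sub>m (rdim ?T)"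
    by (auto intro!: eq_matI simp: ract_tensor_rep permutes_id word_perm_id koszul_sign_id)
  fix \<sigma> \<tau> assume \<sigma>: "\<sigma> permutes {..<d}" and \<tau>: "\<tau> permutes {..<d}"
  show "ract ?T (\<sigma> \<circ> \<tau>) = ract ?T \<sigma> * ract ?T \<tau>"
  proof (rule eq_matI)
    fix i j
    assume "i < dim_row (ract ?T \<sigma> * ract ?T \<tau>)"
      "j < dim_col (ract ?T \<sigma> * ract ?T \<tau>)"
    then have i: "i < ?q ^ d" and j: "j < ?q ^ d"
      by (simp_all add: ract_tensor_rep \<sigma> \<tau>)
    have "(ract ?T \<sigma> * ract ?T \<tau>) $$ (i, j)
        = ract ?T \<sigma> $$ (i, word_perm ?q d \<tau> j) * koszul_sign d \<tau> (?o j)"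
      unfolding ract_tensor_rep[OF \<tau>]
      by (rule monomial_mat_mult_right) (use i j \<sigma> \<tau> in \<open>auto simp: ract_tensor_rep word_perm_less\<close>)
    also have "\<dots> = ract ?T (\<sigma> \<circ> \<tau>) $$ (i, j)"
      using i j \<sigma> \<tau> koszul_sign_comp[OF \<sigma> \<tau>, of "?o (word_perm ?q d \<tau> j)" "?o j", where 'k = 'k]
      by (simp add: ract_tensor_rep permutes_compose word_perm_less letter_word_perm word_perm_comp)
    finally show "ract ?T (\<sigma> \<circ> \<tau>) $$ (i, j)
        = (ract ?T \<sigma> * ract ?T \<tau>) $$ (i, j)" ..
  qed (simp_all add: ract_tensor_rep \<sigma> \<tau> permutes_compose)
qed

text \<open>Tensor product of maps that may differ from factor to factor; such products are the
  terms in the expansion of a tensor power of \<open>f + g\<close>.\<close>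

definition tensor_maps :: "nat \<Rightarrow> nat \<Rightarrow> nat \<Rightarrow> (nat \<Rightarrow> 'k::field mat) \<Rightarrow> 'k mat" where
  "tensor_maps d m n f = mat (m ^ d) (n ^ d) (\<lambda>(i, j). \<Prod>t<d. f t $$ (letter m i t, letter n j t))"

lemma tensor_maps_carrier [simp]: "tensor_maps d m n f \<in> carrier_mat (m ^ d) (n ^ d)"
  by (simp add: tensor_maps_def)

lemma tensor_map_eq_tensor_maps:
  "f \<in> carrier_mat m n \<Longrightarrow> tensor_map d f = tensor_maps d m n (\<lambda>_. f)"
  by (simp add: tensor_map_def tensor_maps_def)

text \<open>Permuting the factors costs a Koszul sign on each side, one read off from the output
  word and one from the input word. The two agree wherever the entry is nonzero, because every
  \<open>f t\<close> preserves parity.\<close>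

lemma tensor_maps_equivariant:
  fixes f g :: "nat \<Rightarrow> 'k::field mat"
  assumes \<sigma>: "\<sigma> permutes {..<d}"
    and f: "\<And>t. t < d \<Longrightarrow> f t \<in> svec_hom X Y"
    and g: "\<And>t. t < d \<Longrightarrow> g (\<sigma> t) = f t"
  shows "ract (tensor_rep d Y) \<sigma> * tensor_maps d (sdim Y) (sdim X) f
    = tensor_maps d (sdim Y) (sdim X) g * ract (tensor_rep d X) \<sigma>"
proof (rule eq_matI)
  let ?m = "sdim Y" and ?n = "sdim X"
  let ?A = "tensor_maps d ?m ?n f" and ?B = "tensor_maps d ?m ?n g"
  fix i j
  assume "i < dim_row (?B * ract (tensor_rep d X) \<sigma>)" "j < dim_col (?B * ract (tensor_rep d X) \<sigma>)"
  then have i: "i < ?m ^ d" and j: "j < ?n ^ d"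
    by (simp_all add: ract_tensor_rep \<sigma> tensor_maps_def)
  \<comment> \<open>The word that \<open>\<sigma>\<close> carries to \<open>i\<close>: row
    \<open>i\<close> of the left product is, up to sign, row \<open>k\<close> of
    \<open>?A\<close>.\<close>
  define k where "k = word_perm ?m d (Hilbert_Choice.inv \<sigma>) i"
  have k: "k < ?m ^ d" "word_perm ?m d \<sigma> k = i"
    using i \<sigma> by (simp_all add: k_def word_perm_less permutes_inv word_perm_inv)
  have "inj_on (word_perm ?m d \<sigma>) {..<?m ^ d}"
    by (rule inj_on_inverseI[where g = "word_perm ?m d (Hilbert_Choice.inv \<sigma>)"]) (simp add: word_perm_inv' \<sigma>)
  then have left: "(ract (tensor_rep d Y) \<sigma> * ?A) $$ (i, j)
      = koszul_sign d \<sigma> (\<lambda>t. odd_index Y (letter ?m k t)) * ?A $$ (k, j)"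
    unfolding k(2)[symmetric] ract_tensor_rep[OF \<sigma>]
    by (intro monomial_mat_mult_left[where \<pi> = "word_perm ?m d \<sigma>"]) (use i j k in auto)
  have right: "(?B * ract (tensor_rep d X) \<sigma>) $$ (i, j)
      = ?B $$ (i, word_perm ?n d \<sigma> j) * koszul_sign d \<sigma> (\<lambda>t. odd_index X (letter ?n j t))"
    unfolding ract_tensor_rep[OF \<sigma>]
    by (intro monomial_mat_mult_right) (use i j \<sigma> in \<open>auto simp: word_perm_less\<close>)
  have "?B $$ (i, word_perm ?n d \<sigma> j)
      = (\<Prod>t<d. g (\<sigma> t) $$ (letter ?m i (\<sigma> t), letter ?n (word_perm ?n d \<sigma> j) (\<sigma> t)))"
    using i word_perm_less[OF \<sigma> j]
    by (simp add: tensor_maps_def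
        prod.reindex_bij_betw[OF permutes_imp_bij[OF \<sigma>],
          where g = "\<lambda>t. g t $$ (letter ?m i t, letter ?n (word_perm ?n d \<sigma> j) t)"])
  also have "\<dots> = ?A $$ (k, j)"
    using k j letter_word_perm[OF \<sigma> k(1)] letter_word_perm[OF \<sigma> j] g
    by (auto simp: tensor_maps_def intro!: prod.cong)
  finally have B: "?B $$ (i, word_perm ?n d \<sigma> j) = ?A $$ (k, j)" .
  show "(ract (tensor_rep d Y) \<sigma> * ?A) $$ (i, j) = (?B * ract (tensor_rep d X) \<sigma>) $$ (i, j)"
  proof (cases "?A $$ (k, j) = 0")
    case False
    have "odd_index Y (letter ?m k t) = odd_index X (letter ?n j t)" if t: "t < d" for t
    proof -
      have "f t $$ (letter ?m k t, letter ?n j t) \<noteq> 0"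
        using False k(1) j t by (auto simp: tensor_maps_def)
      moreover have "letter ?m k t < ?m" "letter ?n j t < ?n"
        using k(1) j t by (auto intro!: letter_less intro: gr0I simp: power_0_left)
      ultimately show ?thesis
        using f[OF t] by (auto simp: svec_hom_def)
    qed
    then have "koszul_sign d \<sigma> (\<lambda>t. odd_index Y (letter ?m k t))
        = (koszul_sign d \<sigma> (\<lambda>t. odd_index X (letter ?n j t)) :: 'k)"
      by (rule koszul_sign_cong)
    then show ?thesis
      by (simp add: left right B)
  qed (simp add: left right B)
qed (simp_all add: ract_tensor_rep \<sigma> tensor_maps_def)

lemma svec_hom_carrier: "f \<in> svec_hom X Y \<Longrightarrow> f \<in> carrier_mat (sdim Y) (sdim X)"
  by (simp add: svec_hom_def)

lemma svec_hom_add: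
  "f \<in> svec_hom X Y \<Longrightarrow> g \<in> svec_hom X Y \<Longrightarrow> f + g \<in> svec_hom X Y"
  by (auto simp: svec_hom_def)

lemma tensor_map_rep_hom:
  assumes "f \<in> svec_hom X Y"
  shows "tensor_map d f \<in> rep_hom d (tensor_rep d X) (tensor_rep d Y)"
  using tensor_maps_equivariant[of _ d "\<lambda>_. f" X Y "\<lambda>_. f"] assms
  by (simp add: rep_hom_def tensor_map_eq_tensor_maps[OF svec_hom_carrier])

section \<open>Freshman's dream for maps between lines\<close>

text \<open>If \<open>p\<close> did not divide the binomial coefficient, the coefficient would be
  coprime to \<open>p ^ j\<close>. As \<open>i\<close> times it is a multiple of
  \<open>p ^ j\<close>, this would make \<open>p ^ j\<close> divide \<open>i\<close>.\<close>

lemma of_nat_choose_prime_power_eq_0: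
  assumes p: "prime p" "CHAR('k::field) = p" and i: "0 < i" "i < p ^ j"
  shows "of_nat (p ^ j choose i) = (0 :: 'k)"
proof (rule ccontr)
  assume "of_nat (p ^ j choose i) \<noteq> (0 :: 'k)"
  then have "\<not> p dvd (p ^ j choose i)"
    using p(2) by (simp add: of_nat_eq_0_iff_char_dvd)
  then have "coprime (p ^ j) (p ^ j choose i)"
    using p(1) by (simp add: prime_imp_coprime)
  moreover have "i * (p ^ j choose i) = p ^ j * ((p ^ j - 1) choose (i - 1))"
    using i by (intro times_binomial_minus1_eq)
  then have "p ^ j dvd i * (p ^ j choose i)"
    by simp
  ultimately have "p ^ j dvd i"
    by (simp add: coprime_dvd_mult_left_iff)
  then show False
    using i by (auto dest: dvd_imp_le)
qed

text \<open>Transitivity of the symmetric group on subsets of a given size: bijections from an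
  initial segment to \<open>S\<close> and between the complements are glued together.\<close>

lemma exists_permutes_image_initial:
  assumes "S \<subseteq> {..<d}"
  shows "\<exists>\<sigma>. \<sigma> permutes {..<d} \<and> \<sigma> ` {..<card S} = S"
proof -
  let ?k = "card S"
  have S: "finite S"
    using assms finite_subset by blast
  have k: "?k \<le> d"
    using card_mono[OF _ assms] by simp
  obtain h where h: "bij_betw h {..<?k} S"
    using S finite_same_card_bij[of "{..<?k}" S] by auto
  have "card {?k..<d} = card ({..<d} - S)"
    using assms S by (simp add: card_Diff_subset)
  then obtain h' where h': "bij_betw h' {?k..<d} ({..<d} - S)"
    using finite_same_card_bij[of "{?k..<d}" "{..<d} - S"] by auto
  define \<sigma> where "\<sigma> = (\<lambda>x. if x < ?k then h x else if x < d then h' x else x)"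
  have 1: "bij_betw \<sigma> {..<?k} S"
    using h by (rule bij_betw_cong[THEN iffD1, rotated]) (simp add: \<sigma>_def)
  have 2: "bij_betw \<sigma> {?k..<d} ({..<d} - S)"
    using h' by (rule bij_betw_cong[THEN iffD1, rotated]) (simp add: \<sigma>_def)
  have "bij_betw \<sigma> ({..<?k} \<union> {?k..<d}) (S \<union> ({..<d} - S))"
    by (rule bij_betw_combine[OF 1 2]) auto
  moreover have "{..<?k} \<union> {?k..<d} = {..<d}" "S \<union> ({..<d} - S) = {..<d}"
    using k assms by auto
  ultimately have "\<sigma> permutes {..<d}"
    using k by (intro bij_imp_permutes) (auto simp: \<sigma>_def)
  then show ?thesis
    using 1 by (auto simp: bij_betw_def)
qed

text \<open>There are \<open>d choose i\<close> subsets of size \<open>i\<close>; this is where the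
  binomial coefficients come from.\<close>

lemma sum_Pow_card:
  fixes c :: "nat set \<Rightarrow> 'k::field"
  assumes "\<And>S. S \<subseteq> {..<d} \<Longrightarrow> c S = c {..<card S}"
  shows "(\<Sum>S \<in> Pow {..<d}. c S) = (\<Sum>i \<le> d. of_nat (d choose i) * c {..<i})"
proof -
  have "(\<Sum>S \<in> Pow {..<d}. c S) = (\<Sum>i \<le> d. \<Sum>S \<in> {S \<in> Pow {..<d}. card S = i}. c S)"
    by (rule sum.group[symmetric]) (auto dest: card_mono[rotated])
  also have "\<dots> = (\<Sum>i \<le> d. of_nat (d choose i) * c {..<i})"
  proof (rule sum.cong)
    fix i
    have "(\<Sum>S \<in> {S \<in> Pow {..<d}. card S = i}. c S) = (\<Sum>S \<in> {S \<in> Pow {..<d}. card S = i}. c {..<i})"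
      by (rule sum.cong) (use assms in auto)
    then show "(\<Sum>S \<in> {S \<in> Pow {..<d}. card S = i}. c S) = of_nat (d choose i) * c {..<i}"
      using n_subsets[of "{..<d}" i] by simp
  qed simp
  finally show ?thesis .
qed

section \<open>Scalars as products of rows, matrices and columns\<close>

lemma index_mult_1_1:
  fixes A B :: "'k::field mat"
  assumes "A \<in> carrier_mat 1 1" "B \<in> carrier_mat 1 1"
  shows "(A * B) $$ (0, 0) = A $$ (0, 0) * B $$ (0, 0)"
  using assms by (simp add: scalar_prod_def)

lemma index_row_mat_col:
  fixes M :: "'k::field mat"
  assumes "b \<in> carrier_mat 1 m" "M \<in> carrier_mat m n" "a \<in> carrier_mat n 1"
  shows "(b * M * a) $$ (0, 0) = (\<Sum>k<n. \<Sum>i<m. b $$ (0, i) * M $$ (i, k) * a $$ (k, 0))"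
  using assms
  by (subst sum.swap)
    (simp add: scalar_prod_def sum_distrib_left sum_distrib_right atLeast0LessThan mult.assoc)

lemma assoc_mult_mat_middle:
  fixes A :: "'k::semiring_0 mat"
  assumes A: "A \<in> carrier_mat n1 n2" and B: "B \<in> carrier_mat n2 n3"
    and C: "C \<in> carrier_mat n3 n4" and D: "D \<in> carrier_mat n4 n5"
  shows "A * B * (C * D) = A * (B * C) * D"
proof -
  have "A * B * (C * D) = A * (B * (C * D))"
    by (rule assoc_mult_mat[OF A B mult_carrier_mat[OF C D]])
  also have "B * (C * D) = B * C * D"
    by (rule assoc_mult_mat[OF B C D, symmetric])
  also have "A * (B * C * D) = A * (B * C) * D"
    by (rule assoc_mult_mat[OF A mult_carrier_mat[OF B C] D, symmetric])
  finally show ?thesis .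
qed

lemma mat_1_1_eqI:
  assumes "A \<in> carrier_mat 1 1" "B \<in> carrier_mat 1 1" "A $$ (0, 0) = B $$ (0, 0)"
  shows "A = B"
  using assms by (intro eq_matI) auto

lemma ract_carrier: "is_rep d M \<Longrightarrow> \<sigma> permutes {..<d} \<Longrightarrow> ract M \<sigma> \<in> carrier_mat (rdim M) (rdim M)"
  by (simp add: is_rep_def)

text \<open>The scalar of \<open>\<sigma>\<close> times that of its inverse is 1. It can therefore
  be cancelled when two terms are compared up to the action on \<open>L\<close>.\<close>

lemma ract_line_nonzero:
  assumes "is_rep d L" "rdim L = 1" "\<sigma> permutes {..<d}"
  shows "ract L \<sigma> $$ (0, 0) \<noteq> 0"
proof -
  let ?\<tau> = "Hilbert_Choice.inv \<sigma>"
  have \<tau>: "?\<tau> permutes {..<d}"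
    by (rule permutes_inv[OF assms(3)])
  have "ract L \<sigma> * ract L ?\<tau> = ract L (\<sigma> \<circ> ?\<tau>)"
    using assms \<tau> unfolding is_rep_def by metis
  also have "\<dots> = 1\<^sub>m 1"
    unfolding permutes_inv_o(1)[OF assms(3)] using assms unfolding is_rep_def by metis
  finally have "(ract L \<sigma> * ract L ?\<tau>) $$ (0, 0) = 1"
    by simp
  then show ?thesis
    using index_mult_1_1[of "ract L \<sigma>" "ract L ?\<tau>"]
      ract_carrier[OF assms(1,3)] ract_carrier[OF assms(1) \<tau>] assms(2) by auto
qed

text \<open>
  Expanding \<open>(f + g)\<^sup>\<otimes>\<^sup>d\<close> over subsets, the terms for subsets of the same size are conjugate under the
  symmetric group, hence agree between lines; so binomial coefficients \<open>p\<^sup>j choose i\<close> appear.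
\<close>

lemma tensor_map_add_between_lines:
  fixes f g :: "'k::field mat"
  assumes p: "prime p" "CHAR('k) = p" and d: "d = p ^ j"
    and L: "is_rep d L" "rdim L = 1"
    and a: "a \<in> rep_hom d L (tensor_rep d X)" and b: "b \<in> rep_hom d (tensor_rep d Y) L"
    and f: "f \<in> svec_hom X Y" and g: "g \<in> svec_hom X Y"
  shows "b * tensor_map d (f + g) * a = b * tensor_map d f * a + b * tensor_map d g * a"
proof -
  let ?m = "sdim Y" and ?n = "sdim X"
  \<comment> \<open>The term of the expansion that has \<open>f\<close> at the positions in
    \<open>S\<close> and \<open>g\<close> at the others.\<close>
  define T where "T S = tensor_maps d ?m ?n (\<lambda>t. if t \<in> S then f else g)" for S :: "nat set"
  define c where "c S = (b * T S * a) $$ (0, 0)" for S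
  have T: "T S \<in> carrier_mat (?m ^ d) (?n ^ d)" for S
    by (simp add: T_def)
  have a': "a \<in> carrier_mat (?n ^ d) 1" and b': "b \<in> carrier_mat 1 (?m ^ d)"
    using a b L(2) by (simp_all add: rep_hom_def)
  have f': "f \<in> carrier_mat ?m ?n" and g': "g \<in> carrier_mat ?m ?n"
    using f g by (simp_all add: svec_hom_carrier)
  have conj: "c (\<sigma> ` S) = c S" if \<sigma>: "\<sigma> permutes {..<d}" for \<sigma> S
  proof -
    let ?RX = "ract (tensor_rep d X) \<sigma>" and ?RY = "ract (tensor_rep d Y) \<sigma>" and ?RL = "ract L \<sigma>"
    have RX: "?RX \<in> carrier_mat (?n ^ d) (?n ^ d)" and RY: "?RY \<in> carrier_mat (?m ^ d) (?m ^ d)"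
      and RL: "?RL \<in> carrier_mat 1 1"
      using ract_carrier[OF is_rep_tensor_rep \<sigma>, of X] ract_carrier[OF is_rep_tensor_rep \<sigma>, of Y]
        ract_carrier[OF L(1) \<sigma>] L(2) by simp_all
    have "?RY * T S = T (\<sigma> ` S) * ?RX"
      unfolding T_def using f g permutes_inj[OF \<sigma>]
      by (intro tensor_maps_equivariant[OF \<sigma>]) (auto simp: inj_image_mem_iff)
    have "b * T (\<sigma> ` S) * a * ?RL = b * T (\<sigma> ` S) * (a * ?RL)"
      by (rule assoc_mult_mat[OF _ a' RL]) (rule mult_carrier_mat[OF b' T])
    also have "a * ?RL = ?RX * a"
      using a \<sigma> by (simp add: rep_hom_def)
    also have "b * T (\<sigma> ` S) * (?RX * a) = b * (T (\<sigma> ` S) * ?RX) * a"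
      by (rule assoc_mult_mat_middle[OF b' T RX a'])
    also have "T (\<sigma> ` S) * ?RX = ?RY * T S"
      by (rule \<open>?RY * T S = T (\<sigma> ` S) * ?RX\<close>[symmetric])
    also have "b * (?RY * T S) * a = b * ?RY * (T S * a)"
      by (rule assoc_mult_mat_middle[OF b' RY T a', symmetric])
    also have "b * ?RY = ?RL * b"
      using b \<sigma> by (simp add: rep_hom_def)
    also have "?RL * b * (T S * a) = ?RL * (b * T S) * a"
      by (rule assoc_mult_mat_middle[OF RL b' T a'])
    also have "\<dots> = ?RL * (b * T S * a)"
      by (rule assoc_mult_mat[OF RL mult_carrier_mat[OF b' T] a'])
    finally have "(b * T (\<sigma> ` S) * a * ?RL) $$ (0, 0) = (?RL * (b * T S * a)) $$ (0, 0)"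
      by simp
    then have "c (\<sigma> ` S) * ?RL $$ (0, 0) = ?RL $$ (0, 0) * c S"
      unfolding c_def using a' b' T RL
      by (subst (asm) (1 2) index_mult_1_1) (auto intro!: mult_carrier_mat)
    then show ?thesis
      using ract_line_nonzero[OF L \<sigma>] by simp
  qed
  have card: "c S = c {..<card S}" if "S \<subseteq> {..<d}" for S
    using exists_permutes_image_initial[OF that] conj by metis
  have entry: "tensor_map d (f + g) $$ (i, k) = (\<Sum>S \<in> Pow {..<d}. T S $$ (i, k))"
    if i: "i < ?m ^ d" and k: "k < ?n ^ d" for i k
  proof -
    have lt: "letter ?m i t < ?m" "letter ?n k t < ?n" if "t < d" for t
      using i k that by (auto intro!: letter_less intro: gr0I simp: power_0_left)
    have "tensor_map d (f + g) $$ (i, k)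
        = (\<Prod>t<d. f $$ (letter ?m i t, letter ?n k t) + g $$ (letter ?m i t, letter ?n k t))"
      using i k f' g' lt by (auto simp: tensor_map_def intro!: prod.cong)
    also have "\<dots> = (\<Sum>S \<in> Pow {..<d}. (\<Prod>t \<in> S. f $$ (letter ?m i t, letter ?n k t))
        * (\<Prod>t \<in> {..<d} - S. g $$ (letter ?m i t, letter ?n k t)))"
      by (rule prod_add) simp
    also have "\<dots> = (\<Sum>S \<in> Pow {..<d}. T S $$ (i, k))"
    proof (rule sum.cong)
      fix S assume "S \<in> Pow {..<d}"
      then have "{..<d} \<inter> S = S"
        by auto
      then show "(\<Prod>t \<in> S. f $$ (letter ?m i t, letter ?n k t))
        * (\<Prod>t \<in> {..<d} - S. g $$ (letter ?m i t, letter ?n k t)) = T S $$ (i, k)"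
        using i k by (simp add: T_def tensor_maps_def prod.If_cases Diff_eq if_distrib[of "\<lambda>x. x $$ _"])
    qed simp
    finally show ?thesis .
  qed
  have "tensor_map d (f + g) \<in> carrier_mat (?m ^ d) (?n ^ d)"
    using f' g' by (simp add: tensor_map_def)
  then have "(b * tensor_map d (f + g) * a) $$ (0, 0)
      = (\<Sum>k<?n ^ d. \<Sum>i<?m ^ d. b $$ (0, i) * tensor_map d (f + g) $$ (i, k) * a $$ (k, 0))"
    by (rule index_row_mat_col[OF b' _ a'])
  also have "\<dots> = (\<Sum>k<?n ^ d. \<Sum>i<?m ^ d. \<Sum>S \<in> Pow {..<d}. b $$ (0, i) * T S $$ (i, k) * a $$ (k, 0))"
    by (simp add: entry sum_distrib_left sum_distrib_right)
  also have "\<dots> = (\<Sum>S \<in> Pow {..<d}. \<Sum>k<?n ^ d. \<Sum>i<?m ^ d. b $$ (0, i) * T S $$ (i, k) * a $$ (k, 0))"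
    by (simp add: sum.swap[of _ "{..<?m ^ d}" "Pow {..<d}"] sum.swap[of _ "{..<?n ^ d}" "Pow {..<d}"])
  also have "\<dots> = (\<Sum>S \<in> Pow {..<d}. c S)"
    unfolding c_def index_row_mat_col[OF b' T a'] ..
  also have "\<dots> = (\<Sum>i \<le> d. of_nat (d choose i) * c {..<i})"
    by (rule sum_Pow_card) (rule card)
  \<comment> \<open>Only the empty and the full subset survive; the other binomial coefficients
    vanish in characteristic \<open>p\<close>.\<close>
  also have "\<dots> = (\<Sum>i \<in> {0, d}. of_nat (d choose i) * c {..<i})"
    using of_nat_choose_prime_power_eq_0[OF p, of _ j] d
    by (intro sum.mono_neutral_right) auto
  \<comment> \<open>The two indices are distinct because \<open>d\<close> is positive.\<close>
  also have "\<dots> = c {} + c {..<d}"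
    using d prime_gt_0_nat[OF p(1)] by simp
  also have "T {..<d} = tensor_map d f"
    unfolding T_def tensor_map_eq_tensor_maps[OF f'] tensor_maps_def by (intro cong_mat) auto
  then have "c {..<d} = (b * tensor_map d f * a) $$ (0, 0)"
    by (simp add: c_def)
  also have "T {} = tensor_map d g"
    unfolding T_def tensor_map_eq_tensor_maps[OF g'] by simp
  then have "c {} = (b * tensor_map d g * a) $$ (0, 0)"
    by (simp add: c_def)
  finally show ?thesis
    using a' b' f' g' by (intro mat_1_1_eqI) (auto simp: tensor_map_def)
qed

section \<open>Linear algebra in coordinates\<close>

text \<open>A morphism from a one-dimensional representation is a matrix with one column. This
  passes from a vector to that matrix, so that vectors and morphisms from a line can be
  exchanged.\<close>

definition col_mat :: "'k vec \<Rightarrow> 'k mat" where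
  "col_mat v = mat (dim_vec v) 1 (\<lambda>(i, j). v $ i)"

lemma col_mat_dims [simp]: "dim_row (col_mat v) = dim_vec v" "dim_col (col_mat v) = 1"
  by (simp_all add: col_mat_def)

lemma col_mat_carrier [simp]: "v \<in> carrier_vec n \<Longrightarrow> col_mat v \<in> carrier_mat n 1"
  by (intro carrier_matI) simp_all

lemma col_mat_carrierD: "col_mat v \<in> carrier_mat n 1 \<Longrightarrow> v \<in> carrier_vec n"
  by (metis carrier_matD(1) carrier_vecI col_mat_dims(1))

lemma col_col_mat [simp]: "col (col_mat v) 0 = v"
  by (intro eq_vecI) (simp_all add: col_mat_def)

lemma col_mat_col: "A \<in> carrier_mat n 1 \<Longrightarrow> col_mat (col A 0) = A"
  by (intro eq_matI) (auto simp: col_mat_def)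

lemma mult_col_mat:
  fixes A :: "'k::field mat"
  shows "A * col_mat v = col_mat (A *\<^sub>v v)"
  by (intro eq_matI) (auto simp: col_mat_def mult_mat_vec_def scalar_prod_def)

lemma col_mat_add:
  "u \<in> carrier_vec n \<Longrightarrow> v \<in> carrier_vec n \<Longrightarrow> col_mat u + col_mat v = col_mat (u + v)"
  by (intro eq_matI) (auto simp: col_mat_def)

lemma col_mat_smult: "c \<cdot>\<^sub>m col_mat u = col_mat (c \<cdot>\<^sub>v u)"
  by (intro eq_matI) (auto simp: col_mat_def)

lemma col_mat_mult_vec:
  fixes u :: "'k::field vec"
  assumes "z \<in> carrier_vec 1"
  shows "col_mat u *\<^sub>v z = z $ 0 \<cdot>\<^sub>v u"
  using assms by (intro eq_vecI) (auto simp: col_mat_def mult_mat_vec_def scalar_prod_def)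

lemma vec_1_eq_smult:
  fixes z :: "'k::field vec"
  shows "z \<in> carrier_vec 1 \<Longrightarrow> z = z $ 0 \<cdot>\<^sub>v unit_vec 1 0"
  by (intro eq_vecI) auto

lemma col_mat_unit: "col_mat (unit_vec 1 0) = (1\<^sub>m 1 :: 'k::field mat)"
  unfolding col_mat_def one_mat_def by (intro cong_mat) (simp_all add: unit_vec_def)

lemma mat_eq_by_vecs:
  fixes A B :: "'k::field mat"
  assumes "A \<in> carrier_mat m n" "B \<in> carrier_mat m n"
    and "\<And>x. x \<in> carrier_vec n \<Longrightarrow> A *\<^sub>v x = B *\<^sub>v x"
  shows "A = B"
proof (rule eq_matI)
  fix i j assume ij: "i < dim_row B" "j < dim_col B"
  then have "(A *\<^sub>v unit_vec n j) $ i = (B *\<^sub>v unit_vec n j) $ i"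
    using assms by simp
  then show "A $$ (i, j) = B $$ (i, j)"
    using ij assms(1,2)
    by (simp add: mult_mat_vec_def scalar_prod_def if_distrib[of "\<lambda>x. _ * x"] cong: if_cong)
qed (use assms in auto)

lemma vec_eq_by_rows:
  fixes u v :: "'k::field vec"
  assumes "u \<in> carrier_vec n" "v \<in> carrier_vec n"
    and "\<And>y. y \<in> carrier_mat 1 n \<Longrightarrow> y *\<^sub>v u = y *\<^sub>v v"
  shows "u = v"
proof (rule eq_vecI)
  fix i assume i: "i < dim_vec v"
  let ?y = "mat 1 n (\<lambda>(_, k). if k = i then 1 else 0) :: 'k mat"
  have "(?y *\<^sub>v u) $ 0 = (?y *\<^sub>v v) $ 0"
    using assms(3)[of ?y] by simp
  then show "u $ i = v $ i"
    using i assms(1,2) by (simp add: mult_mat_vec_def scalar_prod_def if_distrib[of "\<lambda>x. x * _"] cong: if_cong)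
qed (use assms in auto)

lemma linear_map_mat:
  fixes h :: "'k::field vec \<Rightarrow> 'k vec"
  assumes carrier: "\<And>x. x \<in> carrier_vec n \<Longrightarrow> h x \<in> carrier_vec m"
    and add: "\<And>x y. x \<in> carrier_vec n \<Longrightarrow> y \<in> carrier_vec n \<Longrightarrow> h (x + y) = h x + h y"
    and smult: "\<And>x c. x \<in> carrier_vec n \<Longrightarrow> h (c \<cdot>\<^sub>v x) = c \<cdot>\<^sub>v h x"
    and x: "x \<in> carrier_vec n"
  shows "mat m n (\<lambda>(i, k). h (unit_vec n k) $ i) *\<^sub>v x = h x"
proof -
  let ?A = "mat m n (\<lambda>(i, k). h (unit_vec n k) $ i)"
  have unit: "?A *\<^sub>v unit_vec n k = h (unit_vec n k)" if "k < n" for k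
  proof (rule eq_vecI)
    show "dim_vec (?A *\<^sub>v unit_vec n k) = dim_vec (h (unit_vec n k))"
      using carrier[of "unit_vec n k"] by simp
    show "(?A *\<^sub>v unit_vec n k) $ i = h (unit_vec n k) $ i" if "i < dim_vec (h (unit_vec n k))" for i
      using that \<open>k < n\<close> carrier[of "unit_vec n k"]
      by (simp add: mult_mat_vec_def scalar_prod_def if_distrib[of "\<lambda>x. _ * x"] cong: if_cong)
  qed
  \<comment> \<open>Induction on a bound \<open>k\<close> for the support of the vector: each step
    splits off its coordinate at \<open>k\<close>.\<close>
  have "?A *\<^sub>v x = h x" if "k \<le> n" "x \<in> carrier_vec n" "\<And>i. i < n \<Longrightarrow> k \<le> i \<Longrightarrow> x $ i = 0" for k x
    using that
  proof (induction k arbitrary: x)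
    case 0
    then have x: "x = 0 \<cdot>\<^sub>v 0\<^sub>v n"
      by (intro eq_vecI) auto
    have h0: "h (0 \<cdot>\<^sub>v 0\<^sub>v n) = 0\<^sub>v m"
      using smult[of "0\<^sub>v n" 0] carrier[of "0\<^sub>v n"] by (intro eq_vecI) auto
    show ?case
      unfolding x h0 by (intro eq_vecI) (auto simp: mult_mat_vec_def scalar_prod_def)
  next
    case (Suc k)
    define x' where "x' = vec n (\<lambda>i. if i = k then 0 else x $ i)"
    have x': "x' \<in> carrier_vec n"
      by (simp add: x'_def)
    have IH: "?A *\<^sub>v x' = h x'"
      using Suc.prems by (intro Suc.IH) (auto simp: x'_def)
    have k: "k < n"
      using Suc.prems(1) by simp
    have x: "x = x' + x $ k \<cdot>\<^sub>v unit_vec n k"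
      using Suc.prems by (intro eq_vecI) (auto simp: x'_def)
    have "?A *\<^sub>v x = ?A *\<^sub>v (x' + x $ k \<cdot>\<^sub>v unit_vec n k)"
      by (rule arg_cong[OF x])
    also have "\<dots> = ?A *\<^sub>v x' + x $ k \<cdot>\<^sub>v (?A *\<^sub>v unit_vec n k)"
      using mult_add_distrib_mat_vec[OF _ x', of ?A m "x $ k \<cdot>\<^sub>v unit_vec n k"]
        mult_mat_vec[of ?A m n "unit_vec n k" "x $ k"] by simp
    also have "\<dots> = h x' + h (x $ k \<cdot>\<^sub>v unit_vec n k)"
      unfolding IH unit[OF k] by (subst smult) simp_all
    also have "\<dots> = h (x' + x $ k \<cdot>\<^sub>v unit_vec n k)"
      by (rule add[symmetric]) (simp_all add: x')
    also have "\<dots> = h x"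
      by (rule arg_cong[OF x[symmetric]])
    finally show ?case .
  qed
  from this[of n x] show ?thesis
    using x by simp
qed

text \<open>If \<open>n < e\<close>, padding with zeros makes \<open>P\<close> and \<open>Q\<close>
  square without changing their product. A one-sided inverse of a square matrix is two-sided, but
  the padded \<open>Q'\<close> has a zero row at index \<open>n\<close>, which contradicts
  \<open>Q' * P' = 1\<close>.\<close>

lemma mult_eq_one_imp_dim_le:
  fixes P Q :: "'k::field mat"
  assumes "P \<in> carrier_mat e n" "Q \<in> carrier_mat n e" "P * Q = 1\<^sub>m e"
  shows "e \<le> n"
proof (rule ccontr)
  assume "\<not> e \<le> n"
  then have n: "n < e"
    by simp
  define P' where "P' = mat e e (\<lambda>(i, j). if j < n then P $$ (i, j) else 0)"
  define Q' where "Q' = mat e e (\<lambda>(i, j). if i < n then Q $$ (i, j) else 0)"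
  have "P' * Q' = 1\<^sub>m e"
  proof (rule eq_matI)
    fix i j assume "i < dim_row (1\<^sub>m e :: 'k mat)" "j < dim_col (1\<^sub>m e :: 'k mat)"
    then have ij: "i < e" "j < e"
      by simp_all
    have "(P' * Q') $$ (i, j) = (\<Sum>k \<in> {0..<e}. if k < n then P $$ (i, k) * Q $$ (k, j) else 0)"
      using ij by (auto simp: P'_def Q'_def scalar_prod_def intro!: sum.cong)
    also have "\<dots> = (\<Sum>k \<in> {0..<n}. P $$ (i, k) * Q $$ (k, j))"
      using n by (intro sum.mono_neutral_cong_right) auto
    also have "\<dots> = (P * Q) $$ (i, j)"
      using ij assms(1,2) by (simp add: scalar_prod_def)
    finally show "(P' * Q') $$ (i, j) = 1\<^sub>m e $$ (i, j)"
      by (simp add: assms(3))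
  qed (simp_all add: P'_def Q'_def)
  then have "Q' * P' = 1\<^sub>m e"
    by (intro mat_mult_left_right_inverse[of P' e Q']) (simp_all add: P'_def Q'_def)
  moreover have "(Q' * P') $$ (n, n) = 0"
    using n by (simp add: P'_def Q'_def scalar_prod_def)
  ultimately show False
    using n by simp
qed

section \<open>Dual frames for a pairing between functionals and vectors\<close>

definition row_space :: "nat \<Rightarrow> 'k::field mat set \<Rightarrow> bool" where
  "row_space n B \<longleftrightarrow> B \<subseteq> carrier_mat 1 n \<and> 0\<^sub>m 1 n \<in> B \<and>
     (\<forall>b \<in> B. \<forall>b' \<in> B. b + b' \<in> B) \<and> (\<forall>b \<in> B. \<forall>c. c \<cdot>\<^sub>m b \<in> B)"

definition col_space :: "nat \<Rightarrow> 'k::field vec set \<Rightarrow> bool" where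
  "col_space n W \<longleftrightarrow> W \<subseteq> carrier_vec n \<and> 0\<^sub>v n \<in> W \<and>
     (\<forall>w \<in> W. \<forall>w' \<in> W. w + w' \<in> W) \<and> (\<forall>w \<in> W. \<forall>c. c \<cdot>\<^sub>v w \<in> W)"

text \<open>The rows of \<open>P\<close> are \<open>e\<close> functionals in \<open>B\<close>, the
  columns of \<open>Q\<close> are \<open>e\<close> vectors in \<open>W\<close>, and the two families
  are dual to each other. Membership is asked for all linear combinations, which is the form in
  which it is applied.\<close>

definition dual_frame ::
  "nat \<Rightarrow> 'k::field mat set \<Rightarrow> 'k vec set \<Rightarrow> nat \<Rightarrow> 'k mat \<Rightarrow> 'k mat \<Rightarrow> bool" where
  "dual_frame n B W e P Q \<longleftrightarrow> P \<in> carrier_mat e n \<and> Q \<in> carrier_mat n e \<and> P * Q = 1\<^sub>m e \<and>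
     (\<forall>y \<in> carrier_mat 1 e. y * P \<in> B) \<and> (\<forall>x \<in> carrier_vec e. Q *\<^sub>v x \<in> W)"

text \<open>Gram-Schmidt for a pairing. Subtracting from \<open>b\<close> and \<open>w\<close> their
  components along the frame leaves a functional that kills the old vectors and a vector that the
  old functionals kill. These still pair to a nonzero scalar, and after rescaling the functional
  they enlarge the frame by one.\<close>

lemma dual_frame_extend:
  fixes P Q :: "'k::field mat"
  assumes F: "dual_frame n B W e P Q" and B: "row_space n B" and W: "col_space n W"
    and b: "b \<in> B" and w: "w \<in> W" and neq: "b *\<^sub>v (Q *\<^sub>v (P *\<^sub>v w)) \<noteq> b *\<^sub>v w"
  shows "\<exists>P' Q'. dual_frame n B W (Suc e) P' Q'"
proof -
  have P: "P \<in> carrier_mat e n" and Q: "Q \<in> carrier_mat n e" and PQ: "P * Q = 1\<^sub>m e"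
    using F by (auto simp: dual_frame_def)
  have bc: "b \<in> carrier_mat 1 n" and wc: "w \<in> carrier_vec n"
    using b w B W by (auto simp: row_space_def col_space_def)
  have PQv: "P *\<^sub>v (Q *\<^sub>v x) = x" if "x \<in> carrier_vec e" for x
    using that P Q PQ by (simp add: assoc_mult_mat_vec[symmetric])
  define w' where "w' = w + (- 1) \<cdot>\<^sub>v (Q *\<^sub>v (P *\<^sub>v w))"
  define b1 where "b1 = b + (- 1) \<cdot>\<^sub>m (b * Q * P)"
  \<comment> \<open>This is the value of \<open>b1\<close> on \<open>w'\<close>: correcting
    \<open>w\<close> does not affect that value, because \<open>b1 * Q = 0\<close>.\<close>
  define s where "s = (b *\<^sub>v w - b *\<^sub>v (Q *\<^sub>v (P *\<^sub>v w))) $ 0"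
  define b' where "b' = inverse s \<cdot>\<^sub>m b1"
  have bQ: "b * Q \<in> carrier_mat 1 e" and bQP: "b * Q * P \<in> carrier_mat 1 n"
    and Pw: "P *\<^sub>v w \<in> carrier_vec e" and QPw: "Q *\<^sub>v (P *\<^sub>v w) \<in> carrier_vec n"
    using P Q bc wc by auto
  have w': "w' \<in> W" "w' \<in> carrier_vec n"
    using F W w Pw by (auto simp: w'_def dual_frame_def col_space_def)
  have b1: "b1 \<in> B" "b1 \<in> carrier_mat 1 n"
    using F B b bQ by (auto simp: b1_def dual_frame_def row_space_def)
  have b': "b' \<in> B" "b' \<in> carrier_mat 1 n"
    using b1 B by (auto simp: b'_def row_space_def)
  have s: "s \<noteq> 0"
  proof
    assume "s = 0"
    then have "(b *\<^sub>v w) $ 0 = (b *\<^sub>v (Q *\<^sub>v (P *\<^sub>v w))) $ 0"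
      using bc by (simp add: s_def)
    then have "b *\<^sub>v w = b *\<^sub>v (Q *\<^sub>v (P *\<^sub>v w))"
      using bc by (intro eq_vecI) auto
    then show False
      using neq by simp
  qed
  have Pw': "P *\<^sub>v w' = 0\<^sub>v e"
    unfolding w'_def using P wc QPw PQv[OF Pw] Pw
    by (subst mult_add_distrib_mat_vec) (auto simp: mult_mat_vec intro!: eq_vecI)
  have b1Q: "b1 * Q = 0\<^sub>m 1 e"
  proof -
    have "b * Q * P * Q = b * Q"
      using P Q PQ bQ by (simp add: assoc_mult_mat[of _ 1 e _ n _ e])
    then show ?thesis
      unfolding b1_def using bc Q bQP bQ
      by (subst add_mult_distrib_mat) (auto simp: mult_smult_assoc_mat[of _ 1 n _ e] intro!: eq_matI)
  qed
  have b'Q: "b' * Q = 0\<^sub>m 1 e"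
    using b1 Q b1Q by (simp add: b'_def mult_smult_assoc_mat[of _ 1 n _ e])
  have "b1 *\<^sub>v w' = b1 *\<^sub>v w + (- 1) \<cdot>\<^sub>v (b1 *\<^sub>v (Q *\<^sub>v (P *\<^sub>v w)))"
    unfolding w'_def using b1 wc QPw by (subst mult_add_distrib_mat_vec) (auto simp: mult_mat_vec)
  also have "b1 *\<^sub>v (Q *\<^sub>v (P *\<^sub>v w)) = (b1 * Q) *\<^sub>v (P *\<^sub>v w)"
    using b1 Q Pw by simp
  also have "\<dots> = 0\<^sub>v 1"
    unfolding b1Q using Pw by (intro eq_vecI) (auto simp: mult_mat_vec_def scalar_prod_def)
  also have "b1 *\<^sub>v w = b *\<^sub>v w + (- 1) \<cdot>\<^sub>v ((b * Q * P) *\<^sub>v w)"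
    unfolding b1_def using bc bQP wc
    by (subst add_mult_distrib_mat_vec) (auto intro!: eq_vecI simp: mult_mat_vec_def)
  also have "(b * Q * P) *\<^sub>v w = b *\<^sub>v (Q *\<^sub>v (P *\<^sub>v w))"
    using assoc_mult_mat_vec[OF bQ P wc] assoc_mult_mat_vec[OF bc Q Pw] by simp
  finally have "(b1 *\<^sub>v w') $ 0 = s"
    using bc by (simp add: s_def)
  then have b'w': "(b' *\<^sub>v w') $ 0 = 1"
    using s b1 w' by (simp add: b'_def smult_scalar_prod_distrib[of _ n])
  define P' where "P' = mat (Suc e) n (\<lambda>(i, k). if i < e then P $$ (i, k) else b' $$ (0, k))"
  define Q' where "Q' = mat n (Suc e) (\<lambda>(k, j). if j < e then Q $$ (k, j) else w' $ k)"
  have "P' * Q' = 1\<^sub>m (Suc e)"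
  proof (rule eq_matI)
    fix i j assume "i < dim_row (1\<^sub>m (Suc e) :: 'k mat)" "j < dim_col (1\<^sub>m (Suc e) :: 'k mat)"
    then have ij: "i < Suc e" "j < Suc e"
      by simp_all
    have entry: "(P' * Q') $$ (i, j) = (\<Sum>k \<in> {0..<n}. P' $$ (i, k) * Q' $$ (k, j))"
      using ij by (simp add: P'_def Q'_def scalar_prod_def)
    consider "i < e" "j < e" | "i < e" "j = e" | "i = e" "j < e" | "i = e" "j = e"
      using ij by linarith
    then show "(P' * Q') $$ (i, j) = 1\<^sub>m (Suc e) $$ (i, j)"
    proof cases
      case 1
      then have "(P' * Q') $$ (i, j) = (P * Q) $$ (i, j)"
        unfolding entry using P Q by (simp add: P'_def Q'_def scalar_prod_def)
      then show ?thesis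
        using 1 PQ by simp
    next
      case 2
      then have "(P' * Q') $$ (i, j) = (P *\<^sub>v w') $ i"
        unfolding entry using P w' by (simp add: P'_def Q'_def scalar_prod_def)
      then show ?thesis
        using 2 Pw' by simp
    next
      case 3
      then have "(P' * Q') $$ (i, j) = (b' * Q) $$ (0, j)"
        unfolding entry using Q b' by (simp add: P'_def Q'_def scalar_prod_def)
      then show ?thesis
        using 3 b'Q by simp
    next
      case 4
      then have "(P' * Q') $$ (i, j) = (b' *\<^sub>v w') $ 0"
        unfolding entry using b' w' by (simp add: P'_def Q'_def scalar_prod_def)
      then show ?thesis
        using 4 b'w' by simp
    qed
  qed (simp_all add: P'_def Q'_def)
  moreover have "y * P' \<in> B" if y: "y \<in> carrier_mat 1 (Suc e)" for y
  proof -
    define y' where "y' = mat 1 e (\<lambda>(i, k). y $$ (i, k))"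
    have "y * P' = y' * P + y $$ (0, e) \<cdot>\<^sub>m b'"
      using y P b' by (intro eq_matI) (auto simp: P'_def y'_def scalar_prod_def)
    moreover have "y' * P \<in> B"
      using F by (auto simp: y'_def dual_frame_def)
    ultimately show ?thesis
      using B b' by (auto simp: row_space_def)
  qed
  moreover have "Q' *\<^sub>v x \<in> W" if x: "x \<in> carrier_vec (Suc e)" for x
  proof -
    define x' where "x' = vec e (\<lambda>k. x $ k)"
    have "Q' *\<^sub>v x = Q *\<^sub>v x' + x $ e \<cdot>\<^sub>v w'"
      using x Q w' by (intro eq_vecI) (auto simp: Q'_def x'_def scalar_prod_def mult.commute)
    moreover have "Q *\<^sub>v x' \<in> W"
      using F by (auto simp: x'_def dual_frame_def)
    ultimately show ?thesis
      using W w' by (auto simp: col_space_def)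
  qed
  ultimately have "dual_frame n B W (Suc e) P' Q'"
    by (simp add: dual_frame_def P'_def Q'_def)
  then show ?thesis
    by blast
qed

text \<open>Since \<open>P * Q = 1\<close> bounds \<open>e\<close> by \<open>n\<close>, there is a
  largest frame, and a pair \<open>b\<close>, \<open>w\<close> violating the equation would enlarge
  it. The equation says that \<open>Q * P\<close> moves \<open>w\<close> only within the radical of
  the pairing. Thus \<open>e\<close> is the dimension of \<open>W\<close> modulo the radical, and
  \<open>P\<close>, \<open>Q\<close> are coordinates on that quotient.\<close>

lemma maximal_dual_frame_exists:
  assumes B: "row_space n B" and W: "col_space n W"
  shows "\<exists>e P Q. dual_frame n B W e P Q \<and> (\<forall>b \<in> B. \<forall>w \<in> W. b *\<^sub>v (Q *\<^sub>v (P *\<^sub>v w)) = b *\<^sub>v w)"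
proof -
  let ?ok = "\<lambda>e. \<exists>P Q. dual_frame n B W e P Q"
  have "?ok 0"
  proof (intro exI)
    have "y * 0\<^sub>m 0 n = 0\<^sub>m 1 n" if "y \<in> carrier_mat 1 0" for y :: "'a mat"
      using that by (intro eq_matI) (auto simp: scalar_prod_def)
    moreover have "0\<^sub>m n 0 *\<^sub>v x = 0\<^sub>v n" if "x \<in> carrier_vec 0" for x :: "'a vec"
      using that by (intro eq_vecI) (auto simp: scalar_prod_def)
    ultimately show "dual_frame n B W 0 (0\<^sub>m 0 n) (0\<^sub>m n 0)"
      using B W by (auto simp: dual_frame_def row_space_def col_space_def intro!: eq_matI)
  qed
  moreover have bound: "e \<le> n" if "?ok e" for e
    using that mult_eq_one_imp_dim_le unfolding dual_frame_def by blast
  ultimately have max: "?ok (Greatest ?ok)"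
    by (rule GreatestI_nat)
  have greatest: "e \<le> Greatest ?ok" if "?ok e" for e
    using that bound by (rule Greatest_le_nat)
  from max obtain P Q where PQ: "dual_frame n B W (Greatest ?ok) P Q"
    by blast
  have "b *\<^sub>v (Q *\<^sub>v (P *\<^sub>v w)) = b *\<^sub>v w" if "b \<in> B" "w \<in> W" for b w
  proof (rule ccontr)
    assume "b *\<^sub>v (Q *\<^sub>v (P *\<^sub>v w)) \<noteq> b *\<^sub>v w"
    then have "?ok (Suc (Greatest ?ok))"
      by (rule dual_frame_extend[OF PQ B W that])
    then show False
      using greatest[of "Suc (Greatest ?ok)"] Suc_n_not_le_n by metis
  qed
  then show ?thesis
    using PQ by blast
qed

section \<open>Polynomial functors\<close>

lemma rep_hom_carrier: "f \<in> rep_hom d M N \<Longrightarrow> f \<in> carrier_mat (rdim N) (rdim M)"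
  by (simp add: rep_hom_def)

lemma rep_hom_mult:
  assumes M: "is_rep d L" "is_rep d M" "is_rep d N"
    and f: "f \<in> rep_hom d L M" and g: "g \<in> rep_hom d M N"
  shows "g * f \<in> rep_hom d L N"
proof -
  note fc = rep_hom_carrier[OF f] and gc = rep_hom_carrier[OF g]
  have "g * f * ract L \<sigma> = ract N \<sigma> * (g * f)" if \<sigma>: "\<sigma> permutes {..<d}" for \<sigma>
  proof -
    note Lc = ract_carrier[OF M(1) \<sigma>] and Mc = ract_carrier[OF M(2) \<sigma>] and Nc = ract_carrier[OF M(3) \<sigma>]
    have "g * f * ract L \<sigma> = g * (f * ract L \<sigma>)"
      by (rule assoc_mult_mat[OF gc fc Lc])
    also have "f * ract L \<sigma> = ract M \<sigma> * f"
      using f \<sigma> by (simp add: rep_hom_def)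
    also have "g * (ract M \<sigma> * f) = g * ract M \<sigma> * f"
      by (rule assoc_mult_mat[OF gc Mc fc, symmetric])
    also have "g * ract M \<sigma> = ract N \<sigma> * g"
      using g \<sigma> by (simp add: rep_hom_def)
    also have "ract N \<sigma> * g * f = ract N \<sigma> * (g * f)"
      by (rule assoc_mult_mat[OF Nc gc fc])
    finally show ?thesis .
  qed
  then show ?thesis
    using fc gc by (simp add: rep_hom_def)
qed

lemma rep_hom_add:
  assumes M: "is_rep d M" "is_rep d N" and f: "f \<in> rep_hom d M N" and g: "g \<in> rep_hom d M N"
  shows "f + g \<in> rep_hom d M N"
proof -
  note fc = rep_hom_carrier[OF f] and gc = rep_hom_carrier[OF g]
  have "(f + g) * ract M \<sigma> = ract N \<sigma> * (f + g)" if \<sigma>: "\<sigma> permutes {..<d}" for \<sigma>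
  proof -
    note Mc = ract_carrier[OF M(1) \<sigma>] and Nc = ract_carrier[OF M(2) \<sigma>]
    have "f * ract M \<sigma> = ract N \<sigma> * f" "g * ract M \<sigma> = ract N \<sigma> * g"
      using f g \<sigma> by (simp_all add: rep_hom_def)
    then show ?thesis
      by (simp add: add_mult_distrib_mat[OF fc gc Mc] mult_add_distrib_mat[OF Nc fc gc])
  qed
  then show ?thesis
    using fc gc by (simp add: rep_hom_def)
qed

lemma rep_hom_smult:
  assumes M: "is_rep d M" "is_rep d N" and f: "f \<in> rep_hom d M N"
  shows "c \<cdot>\<^sub>m f \<in> rep_hom d M N"
proof -
  note fc = rep_hom_carrier[OF f]
  have "(c \<cdot>\<^sub>m f) * ract M \<sigma> = ract N \<sigma> * (c \<cdot>\<^sub>m f)" if \<sigma>: "\<sigma> permutes {..<d}" for \<sigma>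
  proof -
    note Mc = ract_carrier[OF M(1) \<sigma>] and Nc = ract_carrier[OF M(2) \<sigma>]
    have "f * ract M \<sigma> = ract N \<sigma> * f"
      using f \<sigma> by (simp add: rep_hom_def)
    then show ?thesis
      by (simp add: mult_smult_assoc_mat[OF fc Mc] mult_smult_distrib[OF Nc fc])
  qed
  then show ?thesis
    using fc by (simp add: rep_hom_def)
qed

lemma rep_hom_one: "is_rep d M \<Longrightarrow> 1\<^sub>m (rdim M) \<in> rep_hom d M M"
  using ract_carrier[of d M] by (fastforce simp: rep_hom_def)

lemma rep_hom_zero:
  assumes "is_rep d M" "is_rep d N"
  shows "0\<^sub>m (rdim N) (rdim M) \<in> rep_hom d M N"
  using ract_carrier[OF assms(1)] ract_carrier[OF assms(2)]
  by (auto simp: rep_hom_def left_mult_zero_mat[of _ "rdim M" "rdim M"]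
      right_mult_zero_mat[of _ "rdim N" "rdim N"])

lemma Bobj_is_rep: "M \<in> Bobj d \<Longrightarrow> is_rep d M"
  by (simp add: Bobj_def)

lemma Bobj_hom_mult:
  assumes "L \<in> Bobj d" "M \<in> Bobj d" "N \<in> Bobj d" "f \<in> rep_hom d L M" "g \<in> rep_hom d M N"
  shows "g * f \<in> rep_hom d L N"
  using assms by (intro rep_hom_mult[of d L M N]) (simp_all add: Bobj_is_rep)

lemma
  assumes "polynomial_functor d F" "M \<in> Bobj d" "N \<in> Bobj d"
  shows functor_carrier: "f \<in> rep_hom d M N \<Longrightarrow> fmor F M N f \<in> carrier_mat (fobj F N) (fobj F M)"
    and functor_one: "fmor F M M (1\<^sub>m (rdim M)) = 1\<^sub>m (fobj F M)"
    and functor_add: "f \<in> rep_hom d M N \<Longrightarrow> g \<in> rep_hom d M N \<Longrightarrow>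
      fmor F M N (f + g) = fmor F M N f + fmor F M N g"
    and functor_smult: "f \<in> rep_hom d M N \<Longrightarrow> fmor F M N (c \<cdot>\<^sub>m f) = c \<cdot>\<^sub>m fmor F M N f"
  using assms unfolding polynomial_functor_def by blast+

lemma functor_mult:
  assumes "polynomial_functor d F" "L \<in> Bobj d" "M \<in> Bobj d" "N \<in> Bobj d"
    and "f \<in> rep_hom d L M" "g \<in> rep_hom d M N"
  shows "fmor F L N (g * f) = fmor F M N g * fmor F L M f"
  using assms unfolding polynomial_functor_def by blast

lemma functor_zero:
  assumes "polynomial_functor d F" "M \<in> Bobj d" "N \<in> Bobj d"
  shows "fmor F M N (0\<^sub>m (rdim N) (rdim M)) = 0\<^sub>m (fobj F N) (fobj F M)"
proof -
  let ?z = "0\<^sub>m (rdim N) (rdim M)"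
  have z: "?z \<in> rep_hom d M N"
    using assms(2,3) by (intro rep_hom_zero Bobj_is_rep)
  have "fmor F M N ?z = fmor F M N (0 \<cdot>\<^sub>m ?z)"
    by simp
  also have "\<dots> = 0 \<cdot>\<^sub>m fmor F M N ?z"
    by (rule functor_smult[OF assms z])
  also have "\<dots> = 0\<^sub>m (fobj F N) (fobj F M)"
    using functor_carrier[OF assms z] by (intro eq_matI) auto
  finally show ?thesis .
qed

text \<open>Lets the subobjects in the definition of simplicity be handled as sets of vectors with
  explicit closure conditions.\<close>

lemma subspace_vec_iff:
  "VectorSpace.subspace class_ring U (module_vec TYPE('k::field) n) \<longleftrightarrow> col_space n (U :: 'k vec set)"
  unfolding VectorSpace.subspace_def LinearCombinations.submodule_def col_space_def
  using vec_vs[where 'a = 'k, of n] vec_module[where 'a = 'k, of n]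
  by (auto simp: module_vec_simps class_ring_simps)

section \<open>The simple top of a line\<close>

text \<open>Two choices of \<open>B\<close> matter. If \<open>B N\<close> consists of all
  functionals, \<open>e N\<close> is the dimension of Hom(L, N). If it consists of the maps from
  \<open>N\<close> to \<open>L\<close>, \<open>e N\<close> is the rank of the composition pairing of
  Hom(N, L) with Hom(L, N) into End(L). By \<open>B_mult\<close> the radicals of these pairings are
  stable under morphisms, so that the quotients form a functor.\<close>

locale line_frame =
  fixes d :: nat and L :: "'k::field rep" and B :: "'k rep \<Rightarrow> 'k mat set"
    and e :: "'k rep \<Rightarrow> nat" and P Q :: "'k rep \<Rightarrow> 'k mat"
  assumes L: "L \<in> Bobj d" "rdim L = 1"
    and B_row_space: "N \<in> Bobj d \<Longrightarrow> row_space (rdim N) (B N)"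
    and B_mult: "M \<in> Bobj d \<Longrightarrow> N \<in> Bobj d \<Longrightarrow> f \<in> rep_hom d M N \<Longrightarrow> b \<in> B N \<Longrightarrow> b * f \<in> B M"
    and frame: "N \<in> Bobj d \<Longrightarrow> dual_frame (rdim N) (B N) {w. col_mat w \<in> rep_hom d L N} (e N) (P N) (Q N)"
    and absorb: "N \<in> Bobj d \<Longrightarrow> b \<in> B N \<Longrightarrow> col_mat w \<in> rep_hom d L N \<Longrightarrow>
      b *\<^sub>v (Q N *\<^sub>v (P N *\<^sub>v w)) = b *\<^sub>v w"
begin

text \<open>The vectors on which permutations act by the scalars of \<open>L\<close>, in other words
  Hom(L, N).\<close>

definition invs :: "'k rep \<Rightarrow> 'k vec set" where
  "invs N = {w. col_mat w \<in> rep_hom d L N}"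

text \<open>Coordinates are lifted to a morphism from \<open>L\<close> by \<open>Q M\<close>,
  composed with \<open>f\<close>, and read off again by \<open>P N\<close>. The lifts are not
  natural; preservation of composition rests on \<open>P_absorb\<close>.\<close>

definition frame_functor :: "'k rep_functor" where
  "frame_functor = \<lparr>fobj = e, fmor = (\<lambda>M N f. P N * f * Q M)\<rparr>"

lemma fobj_frame [simp]: "fobj frame_functor = e"
  by (simp add: frame_functor_def)

lemma invsD: "w \<in> invs N \<Longrightarrow> w \<in> carrier_vec (rdim N)"
  unfolding invs_def using L(2) by (auto dest!: rep_hom_carrier intro: col_mat_carrierD)

lemma invs_hom: "w \<in> invs N \<Longrightarrow> col_mat w \<in> rep_hom d L N"
  by (simp add: invs_def)

lemma invs_mult:
  assumes "M \<in> Bobj d" "N \<in> Bobj d" "f \<in> rep_hom d M N" "w \<in> invs M"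
  shows "f *\<^sub>v w \<in> invs N"
  using Bobj_hom_mult[OF L(1) assms(1,2) invs_hom[OF assms(4)] assms(3)]
  by (simp add: invs_def mult_col_mat)

lemma invs_line: "z \<in> carrier_vec 1 \<Longrightarrow> z \<in> invs L"
  using rep_hom_smult[OF Bobj_is_rep[OF L(1)] Bobj_is_rep[OF L(1)] rep_hom_one[OF Bobj_is_rep[OF L(1)]], of "z $ 0"]
  by (simp only: invs_def mem_Collect_eq L(2) col_mat_unit[symmetric] col_mat_smult vec_1_eq_smult[symmetric])

context
  fixes N :: "'k rep" assumes N: "N \<in> Bobj d"
begin

lemma P_carrier: "P N \<in> carrier_mat (e N) (rdim N)"
  and Q_carrier: "Q N \<in> carrier_mat (rdim N) (e N)"
  and P_mult_Q: "P N * Q N = 1\<^sub>m (e N)"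
  and P_row: "y \<in> carrier_mat 1 (e N) \<Longrightarrow> y * P N \<in> B N"
  and Q_invs: "x \<in> carrier_vec (e N) \<Longrightarrow> Q N *\<^sub>v x \<in> invs N"
  using frame[OF N] by (simp_all add: dual_frame_def invs_def)

lemma P_Q_vec: "x \<in> carrier_vec (e N) \<Longrightarrow> P N *\<^sub>v (Q N *\<^sub>v x) = x"
  using assoc_mult_mat_vec[OF P_carrier Q_carrier, of x] by (simp add: P_mult_Q)

lemma B_carrier: "b \<in> B N \<Longrightarrow> b \<in> carrier_mat 1 (rdim N)"
  using B_row_space[OF N] by (auto simp: row_space_def)

lemma P_vec_carrier: "w \<in> carrier_vec (rdim N) \<Longrightarrow> P N *\<^sub>v w \<in> carrier_vec (e N)"
  by (rule mult_mat_vec_carrier[OF P_carrier])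

lemma Q_vec_carrier: "x \<in> carrier_vec (e N) \<Longrightarrow> Q N *\<^sub>v x \<in> carrier_vec (rdim N)"
  by (rule mult_mat_vec_carrier[OF Q_carrier])

end

text \<open>Passing to coordinates and back changes \<open>w\<close> by an element of the radical at
  \<open>M\<close>. A morphism carries the radical into the radical at \<open>N\<close>, and
  \<open>P N\<close> kills that, its rows being functionals in \<open>B N\<close>.\<close>

lemma P_absorb:
  assumes M: "M \<in> Bobj d" and N: "N \<in> Bobj d" and g: "g \<in> rep_hom d M N" and w: "w \<in> invs M"
  shows "P N *\<^sub>v (g *\<^sub>v (Q M *\<^sub>v (P M *\<^sub>v w))) = P N *\<^sub>v (g *\<^sub>v w)"
proof (rule vec_eq_by_rows)
  note gc = rep_hom_carrier[OF g] and wc = invsD[OF w]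
  have QPw: "Q M *\<^sub>v (P M *\<^sub>v w) \<in> carrier_vec (rdim M)"
    using Q_vec_carrier[OF M] P_vec_carrier[OF M] wc by blast
  show "P N *\<^sub>v (g *\<^sub>v (Q M *\<^sub>v (P M *\<^sub>v w))) \<in> carrier_vec (e N)" "P N *\<^sub>v (g *\<^sub>v w) \<in> carrier_vec (e N)"
    using QPw wc gc by (auto intro!: P_vec_carrier[OF N])
  fix y :: "'k mat" assume y: "y \<in> carrier_mat 1 (e N)"
  have yP: "y * P N \<in> B N"
    by (rule P_row[OF N y])
  have eq: "y *\<^sub>v (P N *\<^sub>v (g *\<^sub>v u)) = (y * P N * g) *\<^sub>v u" if u: "u \<in> carrier_vec (rdim M)" for u
    using assoc_mult_mat_vec[OF y P_carrier[OF N], of "g *\<^sub>v u"]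
      assoc_mult_mat_vec[OF B_carrier[OF N yP] gc u] gc u by simp
  show "y *\<^sub>v (P N *\<^sub>v (g *\<^sub>v (Q M *\<^sub>v (P M *\<^sub>v w)))) = y *\<^sub>v (P N *\<^sub>v (g *\<^sub>v w))"
    unfolding eq[OF QPw] eq[OF wc]
    by (rule absorb[OF M B_mult[OF M N g yP] invs_hom[OF w]])
qed

lemma fmor_frame_carrier:
  assumes "M \<in> Bobj d" "N \<in> Bobj d" "f \<in> rep_hom d M N"
  shows "fmor frame_functor M N f \<in> carrier_mat (e N) (e M)"
  using P_carrier[OF assms(2)] Q_carrier[OF assms(1)] rep_hom_carrier[OF assms(3)]
  by (auto simp: frame_functor_def intro!: mult_carrier_mat)

lemma fmor_frame_vec:
  assumes "M \<in> Bobj d" "N \<in> Bobj d" "f \<in> rep_hom d M N" "x \<in> carrier_vec (e M)"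
  shows "fmor frame_functor M N f *\<^sub>v x = P N *\<^sub>v (f *\<^sub>v (Q M *\<^sub>v x))"
proof -
  note fc = rep_hom_carrier[OF assms(3)] and Pc = P_carrier[OF assms(2)] and Qc = Q_carrier[OF assms(1)]
  have "fmor frame_functor M N f *\<^sub>v x = P N * f * Q M *\<^sub>v x"
    by (simp add: frame_functor_def)
  also have "\<dots> = P N * f *\<^sub>v (Q M *\<^sub>v x)"
    by (rule assoc_mult_mat_vec[OF mult_carrier_mat[OF Pc fc] Qc assms(4)])
  also have "\<dots> = P N *\<^sub>v (f *\<^sub>v (Q M *\<^sub>v x))"
    by (rule assoc_mult_mat_vec[OF Pc fc Q_vec_carrier[OF assms(1,4)]])
  finally show ?thesis .
qed

lemma polynomial_functor_frame: "polynomial_functor d frame_functor"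
  unfolding polynomial_functor_def fobj_frame
proof (intro conjI ballI allI)
  fix M N :: "'k rep" and f assume *: "M \<in> Bobj d" "N \<in> Bobj d" "f \<in> rep_hom d M N"
  note fc = rep_hom_carrier[OF *(3)] and Pc = P_carrier[OF *(2)] and Qc = Q_carrier[OF *(1)]
  show "fmor frame_functor M N f \<in> carrier_mat (e N) (e M)"
    by (rule fmor_frame_carrier[OF *])
  show "fmor frame_functor M N (c \<cdot>\<^sub>m f) = c \<cdot>\<^sub>m fmor frame_functor M N f" for c
    unfolding frame_functor_def
    by (simp add: mult_smult_distrib[OF Pc fc] mult_smult_assoc_mat[OF mult_carrier_mat[OF Pc fc] Qc])
  fix g assume g: "g \<in> rep_hom d M N"
  note gc = rep_hom_carrier[OF g]
  show "fmor frame_functor M N (f + g) = fmor frame_functor M N f + fmor frame_functor M N g"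
    unfolding frame_functor_def
    by (simp add: mult_add_distrib_mat[OF Pc fc gc]
        add_mult_distrib_mat[OF mult_carrier_mat[OF Pc fc] mult_carrier_mat[OF Pc gc] Qc])
next
  fix M :: "'k rep" assume M: "M \<in> Bobj d"
  show "fmor frame_functor M M (1\<^sub>m (rdim M)) = 1\<^sub>m (e M)"
    using P_carrier[OF M] by (simp add: frame_functor_def P_mult_Q[OF M])
next
  fix K M N :: "'k rep" and f g
  assume *: "K \<in> Bobj d" "M \<in> Bobj d" "N \<in> Bobj d" "f \<in> rep_hom d K M" "g \<in> rep_hom d M N"
  note gf = Bobj_hom_mult[OF *]
  show "fmor frame_functor K N (g * f) = fmor frame_functor M N g * fmor frame_functor K M f"
  proof (rule mat_eq_by_vecs)
    show "fmor frame_functor K N (g * f) \<in> carrier_mat (e N) (e K)"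
      by (rule fmor_frame_carrier[OF *(1,3) gf])
    show "fmor frame_functor M N g * fmor frame_functor K M f \<in> carrier_mat (e N) (e K)"
      by (rule mult_carrier_mat[OF fmor_frame_carrier[OF *(2,3,5)] fmor_frame_carrier[OF *(1,2,4)]])
    fix x :: "'k vec" assume x: "x \<in> carrier_vec (e K)"
    have fQx: "f *\<^sub>v (Q K *\<^sub>v x) \<in> invs M"
      by (rule invs_mult[OF *(1,2,4) Q_invs[OF *(1) x]])
    have "fmor frame_functor M N g * fmor frame_functor K M f *\<^sub>v x
        = fmor frame_functor M N g *\<^sub>v (P M *\<^sub>v (f *\<^sub>v (Q K *\<^sub>v x)))"
      using assoc_mult_mat_vec[OF fmor_frame_carrier[OF *(2,3,5)] fmor_frame_carrier[OF *(1,2,4)] x]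
        fmor_frame_vec[OF *(1,2,4) x] by simp
    also have "\<dots> = P N *\<^sub>v (g *\<^sub>v (Q M *\<^sub>v (P M *\<^sub>v (f *\<^sub>v (Q K *\<^sub>v x)))))"
      by (rule fmor_frame_vec[OF *(2,3,5) P_vec_carrier[OF *(2) invsD[OF fQx]]])
    also have "\<dots> = P N *\<^sub>v (g *\<^sub>v (f *\<^sub>v (Q K *\<^sub>v x)))"
      by (rule P_absorb[OF *(2,3,5) fQx])
    also have "g *\<^sub>v (f *\<^sub>v (Q K *\<^sub>v x)) = (g * f) *\<^sub>v (Q K *\<^sub>v x)"
      by (rule assoc_mult_mat_vec[OF rep_hom_carrier[OF *(5)] rep_hom_carrier[OF *(4)] Q_vec_carrier[OF *(1) x], symmetric])
    also have "P N *\<^sub>v ((g * f) *\<^sub>v (Q K *\<^sub>v x)) = fmor frame_functor K N (g * f) *\<^sub>v x"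
      by (rule fmor_frame_vec[OF *(1,3) gf x, symmetric])
    finally show "fmor frame_functor K N (g * f) *\<^sub>v x
        = fmor frame_functor M N g * fmor frame_functor K M f *\<^sub>v x" ..
  qed
qed

text \<open>Yoneda: \<open>P L *\<^sub>v z\<close> stands for the endomorphism \<open>z\<close> of
  \<open>L\<close>, and the morphism with column \<open>Q N *\<^sub>v v\<close> carries the identity
  of \<open>L\<close> to \<open>v\<close>.\<close>

lemma fmor_frame_generator:
  assumes N: "N \<in> Bobj d" and v: "v \<in> carrier_vec (e N)" and z: "z \<in> carrier_vec 1"
  shows "fmor frame_functor L N (col_mat (Q N *\<^sub>v v)) *\<^sub>v (P L *\<^sub>v z) = z $ 0 \<cdot>\<^sub>v v"
proof -
  have h: "col_mat (Q N *\<^sub>v v) \<in> rep_hom d L N"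
    by (rule invs_hom[OF Q_invs[OF N v]])
  have zL: "z \<in> carrier_vec (rdim L)"
    using z L(2) by simp
  have "fmor frame_functor L N (col_mat (Q N *\<^sub>v v)) *\<^sub>v (P L *\<^sub>v z)
      = P N *\<^sub>v (col_mat (Q N *\<^sub>v v) *\<^sub>v (Q L *\<^sub>v (P L *\<^sub>v z)))"
    by (rule fmor_frame_vec[OF L(1) N h P_vec_carrier[OF L(1) zL]])
  also have "\<dots> = P N *\<^sub>v (col_mat (Q N *\<^sub>v v) *\<^sub>v z)"
    by (rule P_absorb[OF L(1) N h invs_line[OF z]])
  also have "\<dots> = z $ 0 \<cdot>\<^sub>v (P N *\<^sub>v (Q N *\<^sub>v v))"
    by (simp add: col_mat_mult_vec[OF z] mult_mat_vec[OF P_carrier[OF N] Q_vec_carrier[OF N v]])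
  finally show ?thesis
    by (simp add: P_Q_vec[OF N v])
qed

end

text \<open>A subfunctor of the linear dual \<open>N \<mapsto> Hom(N, k)\<close>, on which morphisms
  act by composition from the right. This is what \<open>line_frame\<close> asks of its
  functionals.\<close>

definition functional_ideal :: "nat \<Rightarrow> ('k::field rep \<Rightarrow> 'k mat set) \<Rightarrow> bool" where
  "functional_ideal d B \<longleftrightarrow> (\<forall>N \<in> Bobj d. row_space (rdim N) (B N)) \<and>
     (\<forall>M \<in> Bobj d. \<forall>N \<in> Bobj d. \<forall>f \<in> rep_hom d M N. \<forall>b \<in> B N. b * f \<in> B M)"

text \<open>A maximal frame is chosen at each object separately; compatibility between objects comes
  from absorption together with the stability of \<open>B\<close>.\<close>

lemma line_frame_exists:
  assumes L: "L \<in> Bobj d" "rdim L = 1" and B: "functional_ideal d B"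
  shows "\<exists>e P Q. line_frame d L B e P Q"
proof -
  have "\<exists>e P Q. dual_frame (rdim N) (B N) {w. col_mat w \<in> rep_hom d L N} e P Q \<and>
      (\<forall>b \<in> B N. \<forall>w \<in> {w. col_mat w \<in> rep_hom d L N}. b *\<^sub>v (Q *\<^sub>v (P *\<^sub>v w)) = b *\<^sub>v w)"
    if N: "N \<in> Bobj d" for N
  proof (rule maximal_dual_frame_exists)
    show "row_space (rdim N) (B N)"
      using B N by (simp add: functional_ideal_def)
    note LN = Bobj_is_rep[OF L(1)] Bobj_is_rep[OF N]
    let ?W = "{w. col_mat w \<in> rep_hom d L N}"
    have W: "w \<in> carrier_vec (rdim N)" if "w \<in> ?W" for w
      using that L(2) by (auto dest!: rep_hom_carrier intro: col_mat_carrierD)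
    have "col_mat (0\<^sub>v (rdim N)) = (0\<^sub>m (rdim N) (rdim L) :: 'a mat)"
      unfolding col_mat_def zero_mat_def by (intro cong_mat) (auto simp: L(2))
    then have "0\<^sub>v (rdim N) \<in> ?W"
      using rep_hom_zero[OF LN] by simp
    moreover have "u + w \<in> ?W" if "u \<in> ?W" "w \<in> ?W" for u w
      using rep_hom_add[OF LN, of "col_mat u" "col_mat w"] that col_mat_add[OF W[OF that(1)] W[OF that(2)]] by simp
    moreover have "c \<cdot>\<^sub>v w \<in> ?W" if "w \<in> ?W" for c w
      using rep_hom_smult[OF LN, of "col_mat w" c] that by (simp add: col_mat_smult)
    ultimately show "col_space (rdim N) ?W"
      using W unfolding col_space_def by blast
  qed
  then obtain e P Q where "\<And>N. N \<in> Bobj d \<Longrightarrow> dual_frame (rdim N) (B N) {w. col_mat w \<in> rep_hom d L N} (e N) (P N) (Q N) \<and>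
      (\<forall>b \<in> B N. \<forall>w \<in> {w. col_mat w \<in> rep_hom d L N}. b *\<^sub>v (Q N *\<^sub>v (P N *\<^sub>v w)) = b *\<^sub>v w)"
    by metis
  then have "line_frame d L B e P Q"
    using L B unfolding functional_ideal_def by unfold_locales auto
  then show ?thesis
    by blast
qed

lemma functional_ideal_all: "functional_ideal d (\<lambda>N. carrier_mat 1 (rdim N))"
  by (auto simp: functional_ideal_def row_space_def dest: rep_hom_carrier)

lemma functional_ideal_hom:
  assumes L: "L \<in> Bobj d" "rdim L = 1"
  shows "functional_ideal d (\<lambda>N. rep_hom d N L)"
  unfolding functional_ideal_def
proof (intro conjI ballI)
  fix N :: "'a rep" assume N: "N \<in> Bobj d"
  note NL = Bobj_is_rep[OF N] Bobj_is_rep[OF L(1)]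
  show "row_space (rdim N) (rep_hom d N L)"
    using rep_hom_zero[OF NL] rep_hom_add[OF NL] rep_hom_smult[OF NL] L(2)
    by (auto simp: row_space_def dest: rep_hom_carrier)
next
  fix M N :: "'a rep" and f b
  assume "M \<in> Bobj d" "N \<in> Bobj d" "f \<in> rep_hom d M N" "b \<in> rep_hom d N L"
  then show "b * f \<in> rep_hom d M L"
    using L(1) by (intro Bobj_hom_mult[of M d N L])
qed

lemma smult_mat_mult_vec:
  fixes A :: "'k::field mat"
  assumes "A \<in> carrier_mat m n" "x \<in> carrier_vec n"
  shows "(c \<cdot>\<^sub>m A) *\<^sub>v x = c \<cdot>\<^sub>v (A *\<^sub>v x)"
  using assms by (intro eq_vecI) (simp_all add: smult_scalar_prod_distrib[of _ n])

lemma mult_vec_nonzero_row: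
  fixes x :: "'k::field vec"
  assumes "x \<in> carrier_vec n" "x \<noteq> 0\<^sub>v n"
  shows "\<exists>y \<in> carrier_mat 1 n. (y *\<^sub>v x) $ 0 \<noteq> 0"
proof (rule ccontr)
  assume "\<not> ?thesis"
  then have 0: "(y *\<^sub>v x) $ 0 = 0" if "y \<in> carrier_mat 1 n" for y
    using that by blast
  have "x = 0\<^sub>v n"
  proof (rule vec_eq_by_rows[OF assms(1)])
    fix y :: "'k mat" assume y: "y \<in> carrier_mat 1 n"
    then show "y *\<^sub>v x = y *\<^sub>v 0\<^sub>v n"
      using 0[OF y] by (intro eq_vecI) auto
  qed simp
  then show False
    using assms(2) by simp
qed

text \<open>A nonzero multiple of the identity of \<open>L\<close> generates: the morphism with
  column \<open>Q N *\<^sub>v v\<close> sends it to a nonzero multiple of \<open>v\<close>.\<close>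

lemma (in line_frame) subfunctor_full:
  assumes S: "subfunctor d frame_functor S" and z: "z \<in> carrier_vec 1" "z $ 0 \<noteq> 0" "P L *\<^sub>v z \<in> S L"
    and N: "N \<in> Bobj d"
  shows "S N = carrier_vec (e N)"
proof
  have space: "col_space (e N) (S N)"
    using S N by (simp add: subfunctor_def subspace_vec_iff)
  show "S N \<subseteq> carrier_vec (e N)"
    using space by (simp add: col_space_def)
  show "carrier_vec (e N) \<subseteq> S N"
  proof
    fix v :: "'k vec" assume v: "v \<in> carrier_vec (e N)"
    have "fmor frame_functor L N (col_mat (Q N *\<^sub>v v)) *\<^sub>v (P L *\<^sub>v z) \<in> S N"
      using S L(1) N invs_hom[OF Q_invs[OF N v]] z(3) by (simp add: subfunctor_def)
    then have "z $ 0 \<cdot>\<^sub>v v \<in> S N"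
      by (simp only: fmor_frame_generator[OF N v z(1)])
    then have "inverse (z $ 0) \<cdot>\<^sub>v (z $ 0 \<cdot>\<^sub>v v) \<in> S N"
      using space unfolding col_space_def by blast
    then show "v \<in> S N"
      using z(2) by (simp add: smult_smult_assoc)
  qed
qed

text \<open>Combinations of the rows of \<open>P M\<close> are maps from \<open>M\<close> to
  \<open>L\<close>. A nonzero vector of a subfunctor is detected by such a combination, hence is
  taken by a map to \<open>L\<close> to a nonzero multiple of the generator, and the subfunctor is
  everything.\<close>

lemma simple_frame_functor:
  assumes "line_frame d L (\<lambda>N. rep_hom d N L) e P Q"
  shows "simple_functor d (line_frame.frame_functor e P Q)"
proof -
  interpret line_frame d L "\<lambda>N. rep_hom d N L" e P Q
    by (rule assms)
  note Lrep = Bobj_is_rep[OF L(1)]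
  \<comment> \<open>Otherwise lifting the coordinates of the generator would give zero, whereas
    absorption against the identity of \<open>L\<close> says that the lift is the generator.\<close>
  have "e L \<noteq> 0"
  proof
    assume e: "e L = 0"
    let ?w = "unit_vec 1 0 :: 'a vec"
    have w: "?w \<in> invs L"
      by (rule invs_line) simp
    have "P L *\<^sub>v ?w = 0\<^sub>v 0"
      using P_carrier[OF L(1)] e by (intro eq_vecI) auto
    then have "Q L *\<^sub>v (P L *\<^sub>v ?w) = 0\<^sub>v 1"
      using Q_carrier[OF L(1)] e L(2) by (intro eq_vecI) (auto simp: scalar_prod_def)
    then have "1\<^sub>m 1 *\<^sub>v 0\<^sub>v 1 = 1\<^sub>m 1 *\<^sub>v ?w"
      using absorb[OF L(1) rep_hom_one[OF Lrep] invs_hom[OF w]] by (simp only: L(2))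
    then have "0\<^sub>v 1 = ?w"
      using one_mult_mat_vec[of "0\<^sub>v 1 :: 'a vec" 1] one_mult_mat_vec[of ?w 1] by simp
    moreover have "0\<^sub>v 1 \<noteq> ?w"
      by (rule unit_vec_nonzero[symmetric]) simp
    ultimately show False
      by blast
  qed
  moreover have "\<forall>M \<in> Bobj d. S M = carrier_vec (e M)"
    if S: "subfunctor d frame_functor S" and M: "M \<in> Bobj d" and neq: "S M \<noteq> {0\<^sub>v (e M)}" for S M
  proof
    have "col_space (e M) (S M)"
      using S M by (simp add: subfunctor_def subspace_vec_iff)
    then obtain x where x: "x \<in> S M" "x \<in> carrier_vec (e M)" "x \<noteq> 0\<^sub>v (e M)"
      using neq by (auto simp: col_space_def)
    obtain y where y: "y \<in> carrier_mat 1 (e M)" "(y *\<^sub>v x) $ 0 \<noteq> 0"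
      using mult_vec_nonzero_row[OF x(2,3)] by blast
    let ?b = "y * P M" and ?z = "y *\<^sub>v x"
    have b: "?b \<in> rep_hom d M L"
      by (rule P_row[OF M y(1)])
    have z: "?z \<in> carrier_vec 1"
      by (rule mult_mat_vec_carrier[OF y(1) x(2)])
    have "?b *\<^sub>v (Q M *\<^sub>v x) = ?z"
      using assoc_mult_mat_vec[OF y(1) P_carrier[OF M] Q_vec_carrier[OF M x(2)]] P_Q_vec[OF M x(2)] by simp
    moreover have "fmor frame_functor M L ?b *\<^sub>v x \<in> S L"
      using S M L(1) b x(1) by (simp add: subfunctor_def)
    ultimately have "P L *\<^sub>v ?z \<in> S L"
      by (simp add: fmor_frame_vec[OF M L(1) b x(2)])
    then show "S N = carrier_vec (e N)" if "N \<in> Bobj d" for N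
      by (rule subfunctor_full[OF S z y(2) _ that])
  qed
  ultimately show ?thesis
    using polynomial_functor_frame L(1) unfolding simple_functor_def fobj_frame by blast
qed

section \<open>The representable functor of a line and its simple quotient\<close>

context
  fixes d L e P and Q :: "'k::field rep \<Rightarrow> 'k mat"
  assumes H: "line_frame d L (\<lambda>N. carrier_mat 1 (rdim N)) e P Q"
begin

interpretation line_frame d L "\<lambda>N. carrier_mat 1 (rdim N)" e P Q
  by (rule H)

text \<open>All functionals together separate vectors, so absorption becomes an equation: the
  radical is zero and the functor is Hom(L, -) in coordinates.\<close>

lemma Q_P_vec:
  assumes N: "N \<in> Bobj d" and w: "w \<in> invs N"
  shows "Q N *\<^sub>v (P N *\<^sub>v w) = w"
proof (rule vec_eq_by_rows)
  show "w \<in> carrier_vec (rdim N)"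
    by (rule invsD[OF w])
  show "Q N *\<^sub>v (P N *\<^sub>v w) \<in> carrier_vec (rdim N)"
    by (rule Q_vec_carrier[OF N P_vec_carrier[OF N invsD[OF w]]])
  show "y *\<^sub>v (Q N *\<^sub>v (P N *\<^sub>v w)) = y *\<^sub>v w" if "y \<in> carrier_mat 1 (rdim N)" for y
    by (rule absorb[OF N that invs_hom[OF w]])
qed

lemma hom_functor_frame: "is_hom_functor d L frame_functor"
  unfolding is_hom_functor_def
proof (intro conjI exI ballI allI)
  \<comment> \<open>A morphism from \<open>L\<close> is its single column; the inverse of
    \<open>?\<phi> N\<close> takes \<open>v\<close> to the morphism with column
    \<open>Q N *\<^sub>v v\<close>.\<close>
  let ?\<phi> = "\<lambda>N f. P N *\<^sub>v col f 0"
  have hom: "col_mat (col f 0) = f" "col f 0 \<in> invs N" "col f 0 \<in> carrier_vec (rdim N)"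
    if f: "f \<in> rep_hom d L N" for f N
  proof -
    have fc: "f \<in> carrier_mat (rdim N) 1"
      using rep_hom_carrier[OF f] L(2) by simp
    show *: "col_mat (col f 0) = f"
      by (rule col_mat_col[OF fc])
    show "col f 0 \<in> invs N"
      using f * by (simp add: invs_def)
    then show "col f 0 \<in> carrier_vec (rdim N)"
      by (rule invsD)
  qed
  show "polynomial_functor d frame_functor"
    by (rule polynomial_functor_frame)
  fix N :: "'k rep" assume N: "N \<in> Bobj d"
  show "bij_betw (?\<phi> N) (rep_hom d L N) (carrier_vec (fobj frame_functor N))"
  proof (rule bij_betw_byWitness[where f' = "\<lambda>v. col_mat (Q N *\<^sub>v v)"])
    show "\<forall>f \<in> rep_hom d L N. col_mat (Q N *\<^sub>v (P N *\<^sub>v col f 0)) = f"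
      using hom by (simp add: Q_P_vec[OF N])
    show "\<forall>v \<in> carrier_vec (fobj frame_functor N). P N *\<^sub>v col (col_mat (Q N *\<^sub>v v)) 0 = v"
      by (simp add: P_Q_vec[OF N])
    show "?\<phi> N ` rep_hom d L N \<subseteq> carrier_vec (fobj frame_functor N)"
      using hom(3) P_vec_carrier[OF N] by auto
    show "(\<lambda>v. col_mat (Q N *\<^sub>v v)) ` carrier_vec (fobj frame_functor N) \<subseteq> rep_hom d L N"
      using invs_hom[OF Q_invs[OF N]] by auto
  qed
  fix f assume f: "f \<in> rep_hom d L N"
  have fc: "f \<in> carrier_mat (rdim N) 1"
    using rep_hom_carrier[OF f] L(2) by simp
  show "?\<phi> N (c \<cdot>\<^sub>m f) = c \<cdot>\<^sub>v ?\<phi> N f" for c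
    using fc mult_mat_vec[OF P_carrier[OF N] hom(3)[OF f]] by simp
  show "?\<phi> N (f + g) = ?\<phi> N f + ?\<phi> N g" if g: "g \<in> rep_hom d L N" for g
  proof -
    have gc: "g \<in> carrier_mat (rdim N) 1"
      using rep_hom_carrier[OF g] L(2) by simp
    have "col (f + g) 0 = col f 0 + col g 0"
      using fc gc by (intro eq_vecI) auto
    then show ?thesis
      using mult_add_distrib_mat_vec[OF P_carrier[OF N] hom(3)[OF f] hom(3)[OF g]] by simp
  qed
  fix N' g assume N': "N' \<in> Bobj d" and g: "g \<in> rep_hom d N N'"
  have "col (g * f) 0 = g *\<^sub>v col f 0"
    using hom(1)[OF f] by (metis col_col_mat mult_col_mat)
  then show "?\<phi> N' (g * f) = fmor frame_functor N N' g *\<^sub>v ?\<phi> N f"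
    using fmor_frame_vec[OF N N' g P_vec_carrier[OF N hom(3)[OF f]]] Q_P_vec[OF N hom(2)[OF f]] by simp
qed

text \<open>By Yoneda a transformation from Hom(L, -) is given by its value at the identity of
  \<open>L\<close>. Lifting that one vector along the surjection \<open>\<pi> L\<close> lifts the
  whole transformation.\<close>

lemma projective_frame: "projective_functor d frame_functor"
  unfolding projective_functor_def
proof (intro conjI allI impI)
  show "polynomial_functor d frame_functor"
    by (rule polynomial_functor_frame)
  fix F G :: "'k rep_functor" and \<pi> \<theta>
  assume F: "polynomial_functor d F" and G: "polynomial_functor d G"
    and epi: "functor_epi d F G \<pi>" and \<theta>: "nat_trans d frame_functor G \<theta>"
  define \<xi> where "\<xi> = P L *\<^sub>v unit_vec 1 0"
  have \<xi>: "\<xi> \<in> carrier_vec (e L)"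
    unfolding \<xi>_def using L(2) by (intro P_vec_carrier[OF L(1)]) simp
  have \<pi>c: "\<pi> N \<in> carrier_mat (fobj G N) (fobj F N)" and \<theta>c: "\<theta> N \<in> carrier_mat (fobj G N) (e N)"
    if "N \<in> Bobj d" for N
    using epi \<theta> that by (auto simp: functor_epi_def nat_trans_def)
  have "\<theta> L *\<^sub>v \<xi> \<in> carrier_vec (fobj G L)"
    using \<theta>c[OF L(1)] \<xi> by auto
  then obtain t where t: "t \<in> carrier_vec (fobj F L)" "\<pi> L *\<^sub>v t = \<theta> L *\<^sub>v \<xi>"
    using epi L(1) unfolding functor_epi_def by (metis (no_types, lifting) imageE)
  \<comment> \<open>The transformation that Yoneda attaches to \<open>t\<close>, as a linear map at
    each object; \<open>\<theta>'\<close> is its matrix.\<close>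
  define h where "h N x = fmor F L N (col_mat (Q N *\<^sub>v x)) *\<^sub>v t" for N x
  define \<theta>' where "\<theta>' N = mat (fobj F N) (e N) (\<lambda>(i, k). h N (unit_vec (e N) k) $ i)" for N
  have hom: "col_mat (Q N *\<^sub>v x) \<in> rep_hom d L N" if "N \<in> Bobj d" "x \<in> carrier_vec (e N)" for N x
    by (rule invs_hom[OF Q_invs[OF that]])
  have \<theta>'_vec: "\<theta>' N *\<^sub>v x = h N x" if N: "N \<in> Bobj d" and x: "x \<in> carrier_vec (e N)" for N x
    unfolding \<theta>'_def
  proof (rule linear_map_mat[OF _ _ _ x])
    note carr = functor_carrier[OF F L(1) N hom[OF N]]
    show "h N x \<in> carrier_vec (fobj F N)" if "x \<in> carrier_vec (e N)" for x
      unfolding h_def by (rule mult_mat_vec_carrier[OF carr[OF that] t(1)])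
    show "h N (x + y) = h N x + h N y" if x: "x \<in> carrier_vec (e N)" and y: "y \<in> carrier_vec (e N)" for x y
      using mult_add_distrib_mat_vec[OF Q_carrier[OF N] x y]
        col_mat_add[OF Q_vec_carrier[OF N x] Q_vec_carrier[OF N y], symmetric]
        functor_add[OF F L(1) N hom[OF N x] hom[OF N y]]
        add_mult_distrib_mat_vec[OF carr[OF x] carr[OF y] t(1)]
      by (simp add: h_def)
    show "h N (c \<cdot>\<^sub>v x) = c \<cdot>\<^sub>v h N x" if x: "x \<in> carrier_vec (e N)" for x c
      using mult_mat_vec[OF Q_carrier[OF N] x] functor_smult[OF F L(1) N hom[OF N x]]
        smult_mat_mult_vec[OF carr[OF x] t(1)]
      by (simp add: h_def col_mat_smult[symmetric])
  qed
  have \<theta>'c: "\<theta>' N \<in> carrier_mat (fobj F N) (e N)" for N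
    by (simp add: \<theta>'_def)
  show "\<exists>\<theta>'. nat_trans d frame_functor F \<theta>' \<and> (\<forall>M \<in> Bobj d. \<pi> M * \<theta>' M = \<theta> M)"
  proof (intro exI conjI ballI)
    show "nat_trans d frame_functor F \<theta>'"
      unfolding nat_trans_def fobj_frame
    proof (intro conjI ballI)
      show "\<theta>' N \<in> carrier_mat (fobj F N) (e N)" for N
        by (rule \<theta>'c)
      fix M N :: "'k rep" and f assume M: "M \<in> Bobj d" and N: "N \<in> Bobj d" and f: "f \<in> rep_hom d M N"
      note Ff = functor_carrier[OF F M N f] and Hf = fmor_frame_carrier[OF M N f]
      show "fmor F M N f * \<theta>' M = \<theta>' N * fmor frame_functor M N f"
      proof (rule mat_eq_by_vecs)
        show "fmor F M N f * \<theta>' M \<in> carrier_mat (fobj F N) (e M)"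
          by (rule mult_carrier_mat[OF Ff \<theta>'c])
        show "\<theta>' N * fmor frame_functor M N f \<in> carrier_mat (fobj F N) (e M)"
          by (rule mult_carrier_mat[OF \<theta>'c Hf])
        fix x :: "'k vec" assume x: "x \<in> carrier_vec (e M)"
        have fQx: "f *\<^sub>v (Q M *\<^sub>v x) \<in> invs N"
          by (rule invs_mult[OF M N f Q_invs[OF M x]])
        have "(fmor F M N f * \<theta>' M) *\<^sub>v x = fmor F M N f *\<^sub>v h M x"
          using assoc_mult_mat_vec[OF Ff \<theta>'c x] \<theta>'_vec[OF M x] by simp
        also have "\<dots> = fmor F L N (f * col_mat (Q M *\<^sub>v x)) *\<^sub>v t"
          using functor_mult[OF F L(1) M N hom[OF M x] f]
            assoc_mult_mat_vec[OF Ff functor_carrier[OF F L(1) M hom[OF M x]] t(1)]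
          by (simp add: h_def)
        also have "\<dots> = h N (P N *\<^sub>v (f *\<^sub>v (Q M *\<^sub>v x)))"
          by (simp add: h_def Q_P_vec[OF N fQx] mult_col_mat)
        also have "\<dots> = \<theta>' N *\<^sub>v (fmor frame_functor M N f *\<^sub>v x)"
          using \<theta>'_vec[OF N P_vec_carrier[OF N invsD[OF fQx]]] fmor_frame_vec[OF M N f x] by simp
        also have "\<dots> = (\<theta>' N * fmor frame_functor M N f) *\<^sub>v x"
          by (rule assoc_mult_mat_vec[OF \<theta>'c Hf x, symmetric])
        finally show "(fmor F M N f * \<theta>' M) *\<^sub>v x = (\<theta>' N * fmor frame_functor M N f) *\<^sub>v x" .
      qed
    qed
    fix N :: "'k rep" assume N: "N \<in> Bobj d"
    show "\<pi> N * \<theta>' N = \<theta> N"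
    proof (rule mat_eq_by_vecs)
      show "\<pi> N * \<theta>' N \<in> carrier_mat (fobj G N) (e N)"
        by (rule mult_carrier_mat[OF \<pi>c[OF N] \<theta>'c])
      show "\<theta> N \<in> carrier_mat (fobj G N) (e N)"
        by (rule \<theta>c[OF N])
      fix x :: "'k vec" assume x: "x \<in> carrier_vec (e N)"
      let ?f = "col_mat (Q N *\<^sub>v x)"
      note f = hom[OF N x]
      have "(\<pi> N * \<theta>' N) *\<^sub>v x = \<pi> N *\<^sub>v (fmor F L N ?f *\<^sub>v t)"
        using assoc_mult_mat_vec[OF \<pi>c[OF N] \<theta>'c x] \<theta>'_vec[OF N x] by (simp add: h_def)
      also have "\<dots> = (\<pi> N * fmor F L N ?f) *\<^sub>v t"
        by (rule assoc_mult_mat_vec[OF \<pi>c[OF N] functor_carrier[OF F L(1) N f] t(1), symmetric])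
      also have "\<pi> N * fmor F L N ?f = fmor G L N ?f * \<pi> L"
        using epi L(1) N f by (simp add: functor_epi_def nat_trans_def)
      also have "(fmor G L N ?f * \<pi> L) *\<^sub>v t = fmor G L N ?f *\<^sub>v (\<theta> L *\<^sub>v \<xi>)"
        using assoc_mult_mat_vec[OF functor_carrier[OF G L(1) N f] \<pi>c[OF L(1)] t(1)] t(2) by simp
      also have "\<dots> = (fmor G L N ?f * \<theta> L) *\<^sub>v \<xi>"
        by (rule assoc_mult_mat_vec[OF functor_carrier[OF G L(1) N f] \<theta>c[OF L(1)] \<xi>, symmetric])
      also have "fmor G L N ?f * \<theta> L = \<theta> N * fmor frame_functor L N ?f"
        using \<theta> L(1) N f by (simp add: nat_trans_def)
      also have "\<dots> *\<^sub>v \<xi> = \<theta> N *\<^sub>v (fmor frame_functor L N ?f *\<^sub>v \<xi>)"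
        by (rule assoc_mult_mat_vec[OF \<theta>c[OF N] fmor_frame_carrier[OF L(1) N f] \<xi>])
      also have "fmor frame_functor L N ?f *\<^sub>v \<xi> = x"
        using fmor_frame_generator[OF N x, of "unit_vec 1 0"] by (simp add: \<xi>_def)
      finally show "(\<pi> N * \<theta>' N) *\<^sub>v x = \<theta> N *\<^sub>v x" .
    qed
  qed
qed

lemma frame_projective_cover:
  assumes D: "line_frame d L (\<lambda>N. rep_hom d N L) e' P' Q'"
  shows "\<exists>\<pi>. projective_cover d frame_functor (line_frame.frame_functor e' P' Q') \<pi>"
proof -
  interpret D: line_frame d L "\<lambda>N. rep_hom d N L" e' P' Q'
    by (rule D)
  define \<pi> where "\<pi> N = P' N * Q N" for N
  have \<pi>c: "\<pi> N \<in> carrier_mat (e' N) (e N)" if "N \<in> Bobj d" for N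
    using D.P_carrier[OF that] Q_carrier[OF that] by (auto simp: \<pi>_def)
  have \<pi>v: "\<pi> N *\<^sub>v x = P' N *\<^sub>v (Q N *\<^sub>v x)" if "N \<in> Bobj d" "x \<in> carrier_vec (e N)" for N x
    unfolding \<pi>_def by (rule assoc_mult_mat_vec[OF D.P_carrier[OF that(1)] Q_carrier[OF that(1)] that(2)])
  have nat: "nat_trans d frame_functor D.frame_functor \<pi>"
    unfolding nat_trans_def fobj_frame D.fobj_frame
  proof (intro conjI ballI)
    show "\<pi> N \<in> carrier_mat (e' N) (e N)" if "N \<in> Bobj d" for N
      by (rule \<pi>c[OF that])
    fix M N :: "'k rep" and f assume M: "M \<in> Bobj d" and N: "N \<in> Bobj d" and f: "f \<in> rep_hom d M N"
    note Df = D.fmor_frame_carrier[OF M N f] and Hf = fmor_frame_carrier[OF M N f]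
    show "fmor D.frame_functor M N f * \<pi> M = \<pi> N * fmor frame_functor M N f"
    proof (rule mat_eq_by_vecs)
      show "fmor D.frame_functor M N f * \<pi> M \<in> carrier_mat (e' N) (e M)"
        by (rule mult_carrier_mat[OF Df \<pi>c[OF M]])
      show "\<pi> N * fmor frame_functor M N f \<in> carrier_mat (e' N) (e M)"
        by (rule mult_carrier_mat[OF \<pi>c[OF N] Hf])
      fix x :: "'k vec" assume x: "x \<in> carrier_vec (e M)"
      have Qx: "Q M *\<^sub>v x \<in> invs M"
        by (rule Q_invs[OF M x])
      have fQx: "f *\<^sub>v (Q M *\<^sub>v x) \<in> invs N"
        by (rule invs_mult[OF M N f Qx])
      have "(fmor D.frame_functor M N f * \<pi> M) *\<^sub>v x = fmor D.frame_functor M N f *\<^sub>v (P' M *\<^sub>v (Q M *\<^sub>v x))"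
        using assoc_mult_mat_vec[OF Df \<pi>c[OF M] x] \<pi>v[OF M x] by simp
      also have "\<dots> = P' N *\<^sub>v (f *\<^sub>v (Q' M *\<^sub>v (P' M *\<^sub>v (Q M *\<^sub>v x))))"
        by (rule D.fmor_frame_vec[OF M N f D.P_vec_carrier[OF M invsD[OF Qx]]])
      also have "\<dots> = P' N *\<^sub>v (f *\<^sub>v (Q M *\<^sub>v x))"
        by (rule D.P_absorb[OF M N f Qx])
      also have "\<dots> = P' N *\<^sub>v (Q N *\<^sub>v (P N *\<^sub>v (f *\<^sub>v (Q M *\<^sub>v x))))"
        by (simp add: Q_P_vec[OF N fQx])
      also have "\<dots> = \<pi> N *\<^sub>v (fmor frame_functor M N f *\<^sub>v x)"
        using \<pi>v[OF N P_vec_carrier[OF N invsD[OF fQx]]] fmor_frame_vec[OF M N f x] by simp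
      also have "\<dots> = (\<pi> N * fmor frame_functor M N f) *\<^sub>v x"
        by (rule assoc_mult_mat_vec[OF \<pi>c[OF N] Hf x, symmetric])
      finally show "(fmor D.frame_functor M N f * \<pi> M) *\<^sub>v x = (\<pi> N * fmor frame_functor M N f) *\<^sub>v x" .
    qed
  qed
  have "functor_epi d frame_functor D.frame_functor \<pi>"
    unfolding functor_epi_def fobj_frame D.fobj_frame
  proof (intro conjI ballI nat equalityI subsetI)
    fix N :: "'k rep" and y assume N: "N \<in> Bobj d"
    show "y \<in> carrier_vec (e' N)" if "y \<in> (\<lambda>v. \<pi> N *\<^sub>v v) ` carrier_vec (e N)"
      using that \<pi>c[OF N] by auto
    assume y: "y \<in> carrier_vec (e' N)"
    have Qy: "Q' N *\<^sub>v y \<in> invs N"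
      by (rule D.Q_invs[OF N y])
    have c: "P N *\<^sub>v (Q' N *\<^sub>v y) \<in> carrier_vec (e N)"
      by (rule P_vec_carrier[OF N invsD[OF Qy]])
    have "y = \<pi> N *\<^sub>v (P N *\<^sub>v (Q' N *\<^sub>v y))"
      unfolding \<pi>v[OF N c] Q_P_vec[OF N Qy] D.P_Q_vec[OF N y] ..
    then show "y \<in> (\<lambda>v. \<pi> N *\<^sub>v v) ` carrier_vec (e N)"
      using c by blast
  qed
  moreover have "\<forall>M \<in> Bobj d. S M = carrier_vec (fobj frame_functor M)"
    if S: "subfunctor d frame_functor S"
      and onto: "\<forall>M \<in> Bobj d. (\<lambda>v. \<pi> M *\<^sub>v v) ` S M = carrier_vec (fobj D.frame_functor M)" for S
  proof
    have space: "col_space (e L) (S L)"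
      using S L(1) by (simp add: subfunctor_def subspace_vec_iff)
    \<comment> \<open>If every vector of \<open>S L\<close> lifted to zero, \<open>\<pi> L\<close>
      would kill \<open>S L\<close>, while it is onto a nonzero space.\<close>
    have "\<exists>x \<in> S L. (Q L *\<^sub>v x) $ 0 \<noteq> 0"
    proof (rule ccontr)
      assume "\<not> ?thesis"
      then have 0: "(Q L *\<^sub>v x) $ 0 = 0" if "x \<in> S L" for x
        using that by blast
      have zero: "\<pi> L *\<^sub>v x = 0\<^sub>v (e' L)" if x: "x \<in> S L" for x
      proof -
        have xc: "x \<in> carrier_vec (e L)"
          using x space by (auto simp: col_space_def)
        have "Q L *\<^sub>v x = 0\<^sub>v (rdim L)"
          using 0[OF x] Q_carrier[OF L(1)] L(2) by (intro eq_vecI) auto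
        then have "\<pi> L *\<^sub>v x = P' L *\<^sub>v 0\<^sub>v (rdim L)"
          by (simp only: \<pi>v[OF L(1) xc])
        also have "\<dots> = 0\<^sub>v (e' L)"
          using D.P_carrier[OF L(1)] by (intro eq_vecI) auto
        finally show ?thesis .
      qed
      have trivial: "v = 0\<^sub>v (e' L)" if v: "v \<in> carrier_vec (e' L)" for v :: "'k vec"
      proof -
        have "v \<in> (\<lambda>v. \<pi> L *\<^sub>v v) ` S L"
          using v onto L(1) by simp
        then obtain x where "x \<in> S L" "v = \<pi> L *\<^sub>v x"
          by (rule imageE)
        then show ?thesis
          using zero by simp
      qed
      \<comment> \<open>The identity of \<open>L\<close> is one of the functionals for the simple
        quotient, so absorption against it makes the lift of the generator equal to the
        generator.\<close>
      have "unit_vec 1 0 = Q' L *\<^sub>v (P' L *\<^sub>v (unit_vec 1 0 :: 'k vec))"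
      proof -
        have w: "unit_vec 1 0 \<in> D.invs L"
          by (rule D.invs_line) simp
        have "1\<^sub>m 1 *\<^sub>v (Q' L *\<^sub>v (P' L *\<^sub>v unit_vec 1 0)) = 1\<^sub>m 1 *\<^sub>v unit_vec 1 0"
          using D.absorb[OF L(1) rep_hom_one[OF Bobj_is_rep[OF L(1)]] D.invs_hom[OF w]] by (simp only: L(2))
        moreover have "Q' L *\<^sub>v (P' L *\<^sub>v unit_vec 1 0) \<in> carrier_vec 1"
          using D.Q_vec_carrier[OF L(1) D.P_vec_carrier[OF L(1) D.invsD[OF w]]] L(2) by simp
        ultimately show ?thesis
          by simp
      qed
      also have "P' L *\<^sub>v unit_vec 1 0 = 0\<^sub>v (e' L)"
        using L(2) by (intro trivial D.P_vec_carrier[OF L(1)]) simp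
      also have "Q' L *\<^sub>v 0\<^sub>v (e' L) = 0\<^sub>v 1"
        using D.Q_carrier[OF L(1)] L(2) by (intro eq_vecI) (auto simp: scalar_prod_def)
      finally have "unit_vec 1 0 = (0\<^sub>v 1 :: 'k vec)" .
      moreover have "unit_vec 1 0 \<noteq> (0\<^sub>v 1 :: 'k vec)"
        by (rule unit_vec_nonzero) simp
      ultimately show False
        by blast
    qed
    then obtain x where x: "x \<in> S L" "(Q L *\<^sub>v x) $ 0 \<noteq> 0"
      by blast
    have xc: "x \<in> carrier_vec (e L)"
      using x space by (auto simp: col_space_def)
    have z: "Q L *\<^sub>v x \<in> carrier_vec 1"
      using Q_vec_carrier[OF L(1) xc] L(2) by simp
    have "P L *\<^sub>v (Q L *\<^sub>v x) \<in> S L"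
      using x(1) by (simp add: P_Q_vec[OF L(1) xc])
    then show "S N = carrier_vec (fobj frame_functor N)" if "N \<in> Bobj d" for N
      unfolding fobj_frame by (rule subfunctor_full[OF S z x(2) _ that])
  qed
  ultimately show ?thesis
    using projective_frame unfolding projective_cover_def by blast
qed

end

text \<open>The two frame functors show that the choice has a candidate, so the chosen functor
  satisfies its specification. All later arguments about it start from there.\<close>

lemma simple_top_line:
  assumes "L \<in> Bobj d" "rdim L = 1"
  shows "simple_functor d (simple_top d L) \<and>
    (\<exists>H \<pi>. is_hom_functor d L H \<and> projective_cover d H (simple_top d L) \<pi>)"
proof -
  obtain e P Q where D: "line_frame d L (\<lambda>N. rep_hom d N L) e P Q"
    using line_frame_exists[OF assms functional_ideal_hom[OF assms]] by blast
  obtain e' P' Q' where H: "line_frame d L (\<lambda>N. carrier_mat 1 (rdim N)) e' P' Q'"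
    using line_frame_exists[OF assms functional_ideal_all] by blast
  have "\<exists>D. simple_functor d D \<and> (\<exists>H \<pi>. is_hom_functor d L H \<and> projective_cover d H D \<pi>)"
    using simple_frame_functor[OF D] hom_functor_frame[OF H] frame_projective_cover[OF H D] by blast
  then show ?thesis
    unfolding simple_top_def by (rule someI_ex)
qed

section \<open>Values and additivity of the simple top of a line\<close>

lemma one_hom_mult: "f \<in> rep_hom d M N \<Longrightarrow> f * 1\<^sub>m (rdim M) = f"
  using rep_hom_carrier by (rule right_mult_one_mat)

lemma functor_mult_vec:
  assumes F: "polynomial_functor d F" and obj: "L \<in> Bobj d" "M \<in> Bobj d" "N \<in> Bobj d"
    and f: "f \<in> rep_hom d L M" and g: "g \<in> rep_hom d M N" and v: "v \<in> carrier_vec (fobj F L)"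
  shows "fmor F M N g *\<^sub>v (fmor F L M f *\<^sub>v v) = fmor F L N (g * f) *\<^sub>v v"
  using functor_mult[OF F obj f g]
    assoc_mult_mat_vec[OF functor_carrier[OF F obj(2,3) g] functor_carrier[OF F obj(1,2) f] v] by simp

text \<open>
  In a simple top \<open>D\<close> of \<open>Hom(L, -)\<close> the image of the identity of \<open>L\<close> generates, and by simplicity
  no nonzero vector is killed by all maps to \<open>L\<close>.
\<close>

lemma simple_top_generator:
  fixes D :: "'k::field rep_functor"
  assumes L: "L \<in> Bobj d" and D: "simple_functor d D"
    and H: "is_hom_functor d L H" and cover: "projective_cover d H D \<pi>"
  obtains u where "u \<in> carrier_vec (fobj D L)" "u \<noteq> 0\<^sub>v (fobj D L)"
    "\<And>N v. N \<in> Bobj d \<Longrightarrow> v \<in> carrier_vec (fobj D N) \<Longrightarrow> \<exists>a \<in> rep_hom d L N. v = fmor D L N a *\<^sub>v u"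
    "\<And>N v. N \<in> Bobj d \<Longrightarrow> v \<in> carrier_vec (fobj D N) \<Longrightarrow>
      (\<And>b. b \<in> rep_hom d N L \<Longrightarrow> fmor D N L b *\<^sub>v v = 0\<^sub>v (fobj D L)) \<Longrightarrow> v = 0\<^sub>v (fobj D N)"
proof -
  obtain \<phi> where \<phi>: "\<And>N. N \<in> Bobj d \<Longrightarrow> bij_betw (\<phi> N) (rep_hom d L N) (carrier_vec (fobj H N))"
    and \<phi>_mult: "\<And>N N' f g. N \<in> Bobj d \<Longrightarrow> N' \<in> Bobj d \<Longrightarrow> f \<in> rep_hom d L N \<Longrightarrow> g \<in> rep_hom d N N' \<Longrightarrow>
      \<phi> N' (g * f) = fmor H N N' g *\<^sub>v \<phi> N f"
    using H unfolding is_hom_functor_def by metis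
  have D': "polynomial_functor d D" and H': "polynomial_functor d H"
    using D H by (simp_all add: simple_functor_def is_hom_functor_def)
  have epi: "functor_epi d H D \<pi>"
    using cover by (simp add: projective_cover_def)
  have \<pi>c: "\<pi> N \<in> carrier_mat (fobj D N) (fobj H N)" if "N \<in> Bobj d" for N
    using epi that by (simp add: functor_epi_def nat_trans_def)
  let ?id = "1\<^sub>m (rdim L) :: 'k mat"
  have one: "?id \<in> rep_hom d L L"
    by (rule rep_hom_one[OF Bobj_is_rep[OF L]])
  have \<phi>1: "\<phi> L ?id \<in> carrier_vec (fobj H L)"
    using bij_betwE[OF \<phi>[OF L]] one by blast
  define u where "u = \<pi> L *\<^sub>v \<phi> L ?id"
  have u: "u \<in> carrier_vec (fobj D L)"
    unfolding u_def by (rule mult_mat_vec_carrier[OF \<pi>c[OF L] \<phi>1])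
  have gen: "\<exists>a \<in> rep_hom d L N. v = fmor D L N a *\<^sub>v u"
    if N: "N \<in> Bobj d" and v: "v \<in> carrier_vec (fobj D N)" for N v
  proof -
    have "v \<in> (\<lambda>v. \<pi> N *\<^sub>v v) ` carrier_vec (fobj H N)"
      using epi N v by (simp add: functor_epi_def)
    then obtain h where h: "h \<in> carrier_vec (fobj H N)" "v = \<pi> N *\<^sub>v h"
      by (rule imageE)
    have "h \<in> \<phi> N ` rep_hom d L N"
      using h(1) bij_betw_imp_surj_on[OF \<phi>[OF N]] by simp
    then obtain a where a: "a \<in> rep_hom d L N" "h = \<phi> N a"
      by blast
    have Ha: "fmor H L N a \<in> carrier_mat (fobj H N) (fobj H L)"
      by (rule functor_carrier[OF H' L N a(1)])
    have "h = fmor H L N a *\<^sub>v \<phi> L ?id"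
      using \<phi>_mult[OF L N one a(1)] a by (simp add: one_hom_mult)
    then have "v = (\<pi> N * fmor H L N a) *\<^sub>v \<phi> L ?id"
      using assoc_mult_mat_vec[OF \<pi>c[OF N] Ha \<phi>1] h(2) by simp
    also have "\<pi> N * fmor H L N a = fmor D L N a * \<pi> L"
      using epi L N a(1) by (simp add: functor_epi_def nat_trans_def)
    also have "\<dots> *\<^sub>v \<phi> L ?id = fmor D L N a *\<^sub>v u"
      unfolding u_def by (rule assoc_mult_mat_vec[OF functor_carrier[OF D' L N a(1)] \<pi>c[OF L] \<phi>1])
    finally show ?thesis
      using a(1) by blast
  qed
  have zero_mult: "A *\<^sub>v 0\<^sub>v n = 0\<^sub>v m" if "A \<in> carrier_mat m n" for A :: "'k mat" and m n
    using that by (intro eq_vecI) auto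
  have u_nz: "u \<noteq> 0\<^sub>v (fobj D L)"
  proof
    assume u0: "u = 0\<^sub>v (fobj D L)"
    obtain M where M: "M \<in> Bobj d" "fobj D M \<noteq> 0"
      using D by (auto simp: simple_functor_def)
    obtain a where "a \<in> rep_hom d L M" "unit_vec (fobj D M) 0 = fmor D L M a *\<^sub>v u"
      using gen[OF M(1), of "unit_vec (fobj D M) 0"] by auto
    then have "unit_vec (fobj D M) 0 = (0\<^sub>v (fobj D M) :: 'k vec)"
      using zero_mult[OF functor_carrier[OF D' L M(1)]] u0 by simp
    moreover have "unit_vec (fobj D M) 0 \<noteq> (0\<^sub>v (fobj D M) :: 'k vec)"
      using M(2) by (intro unit_vec_nonzero) simp
    ultimately show False
      by blast
  qed
  \<comment> \<open>The largest subfunctor that is invisible to maps into \<open>L\<close>. It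
    misses the generator, as the identity of \<open>L\<close> is such a map; so simplicity makes it
    zero.\<close>
  define U where "U N = {v \<in> carrier_vec (fobj D N). \<forall>b \<in> rep_hom d N L. fmor D N L b *\<^sub>v v = 0\<^sub>v (fobj D L)}" for N
  have "subfunctor d D U"
    unfolding subfunctor_def subspace_vec_iff
  proof (intro conjI ballI)
    fix N :: "'k rep" assume N: "N \<in> Bobj d"
    note c = functor_carrier[OF D' N L]
    show "col_space (fobj D N) (U N)"
      unfolding col_space_def
    proof (intro conjI ballI allI)
      show "U N \<subseteq> carrier_vec (fobj D N)" "0\<^sub>v (fobj D N) \<in> U N"
        using zero_mult[OF c] by (auto simp: U_def)
      fix v assume v: "v \<in> U N"
      then show "s \<cdot>\<^sub>v v \<in> U N" for s
        using mult_mat_vec[OF c] by (auto simp: U_def)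
      fix w assume w: "w \<in> U N"
      show "v + w \<in> U N"
        using v w mult_add_distrib_mat_vec[OF c] by (auto simp: U_def)
    qed
  next
    fix M N :: "'k rep" and f v
    assume M: "M \<in> Bobj d" and N: "N \<in> Bobj d" and f: "f \<in> rep_hom d M N" and v: "v \<in> U M"
    have vc: "v \<in> carrier_vec (fobj D M)"
      using v by (simp add: U_def)
    have "fmor D N L b *\<^sub>v (fmor D M N f *\<^sub>v v) = 0\<^sub>v (fobj D L)" if b: "b \<in> rep_hom d N L" for b
      using functor_mult_vec[OF D' M N L f b vc] v Bobj_hom_mult[OF M N L f b] by (simp add: U_def)
    then show "fmor D M N f *\<^sub>v v \<in> U N"
      using mult_mat_vec_carrier[OF functor_carrier[OF D' M N f] vc] by (simp add: U_def)
  qed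
  then have "(\<forall>N \<in> Bobj d. U N = {0\<^sub>v (fobj D N)}) \<or> (\<forall>N \<in> Bobj d. U N = carrier_vec (fobj D N))"
    using D by (simp add: simple_functor_def)
  moreover have "u \<notin> U L"
  proof
    assume "u \<in> U L"
    then have "fmor D L L ?id *\<^sub>v u = 0\<^sub>v (fobj D L)"
      using one by (simp add: U_def)
    then show False
      using functor_one[OF D' L L] u u_nz by simp
  qed
  ultimately have U0: "U N = {0\<^sub>v (fobj D N)}" if "N \<in> Bobj d" for N
    using that L u by blast
  have "v = 0\<^sub>v (fobj D N)"
    if "N \<in> Bobj d" "v \<in> carrier_vec (fobj D N)"
      "\<And>b. b \<in> rep_hom d N L \<Longrightarrow> fmor D N L b *\<^sub>v v = 0\<^sub>v (fobj D L)" for N v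
    using U0[OF that(1)] that(2,3) by (auto simp: U_def)
  then show thesis
    using that[OF u u_nz gen] by blast
qed

lemma rep_hom_line_endo:
  assumes L: "rdim L = 1" "rdim L' = 1" and f: "f \<in> rep_hom d L L'"
  shows "f = f $$ (0, 0) \<cdot>\<^sub>m 1\<^sub>m (rdim L)"
  using rep_hom_carrier[OF f] L by (intro eq_matI) auto

text \<open>All three rest on the generator \<open>u\<close>. Endomorphisms of \<open>L\<close> are
  scalars, so \<open>u\<close> spans the value at \<open>L\<close>; other values consist of images
  of \<open>u\<close> under maps from \<open>L\<close>, so they vanish where no such map is
  nonzero.\<close>

lemma
  fixes L :: "'k::field rep"
  assumes L: "L \<in> Bobj d" "rdim L = 1"
  shows fobj_simple_top_line: "fobj (simple_top d L) L = 1"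
    and fobj_simple_top_zero: "N \<in> Bobj d \<Longrightarrow> rep_hom d L N \<subseteq> {0\<^sub>m (rdim N) (rdim L)} \<Longrightarrow>
      fobj (simple_top d L) N = 0"
    and additive_simple_top: "prime p \<Longrightarrow> CHAR('k) = p \<Longrightarrow> d = p ^ j \<Longrightarrow>
      (\<And>X. tensor_rep d X \<in> (Bobj d :: 'k rep set)) \<Longrightarrow> additive_polynomial_functor d (simple_top d L)"
proof -
  let ?D = "simple_top d L"
  have D: "simple_functor d ?D"
    using simple_top_line[OF L] by blast
  then have D': "polynomial_functor d ?D"
    by (simp add: simple_functor_def)
  obtain H \<pi> where "is_hom_functor d L H" "projective_cover d H ?D \<pi>"
    using simple_top_line[OF L] by blast
  then obtain u where u: "u \<in> carrier_vec (fobj ?D L)" "u \<noteq> 0\<^sub>v (fobj ?D L)"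
    and gen: "\<And>N v. N \<in> Bobj d \<Longrightarrow> v \<in> carrier_vec (fobj ?D N) \<Longrightarrow> \<exists>a \<in> rep_hom d L N. v = fmor ?D L N a *\<^sub>v u"
    and faithful: "\<And>N v. N \<in> Bobj d \<Longrightarrow> v \<in> carrier_vec (fobj ?D N) \<Longrightarrow>
      (\<And>b. b \<in> rep_hom d N L \<Longrightarrow> fmor ?D N L b *\<^sub>v v = 0\<^sub>v (fobj ?D L)) \<Longrightarrow> v = 0\<^sub>v (fobj ?D N)"
    using simple_top_generator[OF L(1) D] by metis
  have multiple: "\<exists>c. v = c \<cdot>\<^sub>v u" if v: "v \<in> carrier_vec (fobj ?D L)" for v
  proof -
    obtain a where a: "a \<in> rep_hom d L L" "v = fmor ?D L L a *\<^sub>v u"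
      using gen[OF L(1) v] by blast
    have "fmor ?D L L a = fmor ?D L L (a $$ (0, 0) \<cdot>\<^sub>m 1\<^sub>m (rdim L))"
      using rep_hom_line_endo[OF L(2) L(2) a(1)] by simp
    also have "\<dots> = a $$ (0, 0) \<cdot>\<^sub>m 1\<^sub>m (fobj ?D L)"
      unfolding functor_smult[OF D' L(1) L(1) rep_hom_one[OF Bobj_is_rep[OF L(1)]]] functor_one[OF D' L(1) L(1)] ..
    finally have "v = a $$ (0, 0) \<cdot>\<^sub>v (1\<^sub>m (fobj ?D L) *\<^sub>v u)"
      using a(2) smult_mat_mult_vec[OF one_carrier_mat u(1)] by simp
    then show ?thesis
      using u(1) by auto
  qed
  show "fobj ?D L = 1"
  proof (rule ccontr)
    let ?n = "fobj ?D L"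
    assume "?n \<noteq> 1"
    moreover have "?n \<noteq> 0"
    proof
      assume "?n = 0"
      then have "u = 0\<^sub>v ?n"
        using u(1) by (intro eq_vecI) auto
      then show False
        using u(2) by blast
    qed
    ultimately have n: "1 < ?n"
      by simp
    obtain c c' where c: "unit_vec ?n 0 = c \<cdot>\<^sub>v u" and c': "unit_vec ?n 1 = c' \<cdot>\<^sub>v u"
      using multiple[of "unit_vec ?n 0"] multiple[of "unit_vec ?n 1"] by auto
    have "(c \<cdot>\<^sub>v u) $ 0 = 1" "(c \<cdot>\<^sub>v u) $ 1 = 0" "(c' \<cdot>\<^sub>v u) $ 1 = 1"
      unfolding c[symmetric] c'[symmetric] using n by (simp_all add: unit_vec_def)
    then show False
      using n u(1) by auto
  qed
  show "fobj ?D N = 0" if N: "N \<in> Bobj d" and zero: "rep_hom d L N \<subseteq> {0\<^sub>m (rdim N) (rdim L)}"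
  proof (rule ccontr)
    assume n: "fobj ?D N \<noteq> 0"
    obtain a where a: "a \<in> rep_hom d L N" "unit_vec (fobj ?D N) 0 = fmor ?D L N a *\<^sub>v u"
      using gen[OF N, of "unit_vec (fobj ?D N) 0"] by auto
    then have "unit_vec (fobj ?D N) 0 = 0\<^sub>m (fobj ?D N) (fobj ?D L) *\<^sub>v u"
      using zero functor_zero[OF D' L(1) N] by auto
    also have "\<dots> = 0\<^sub>v (fobj ?D N)"
      using u(1) by (intro eq_vecI) (auto simp: scalar_prod_def)
    finally have "unit_vec (fobj ?D N) 0 = (0\<^sub>v (fobj ?D N) :: 'k vec)" .
    moreover have "unit_vec (fobj ?D N) 0 \<noteq> (0\<^sub>v (fobj ?D N) :: 'k vec)"
      using n by (intro unit_vec_nonzero) simp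
    ultimately show False
      by blast
  qed
  show "additive_polynomial_functor d ?D"
    if p: "prime p" "CHAR('k) = p" "d = p ^ j" and tensor: "\<And>X. tensor_rep d X \<in> (Bobj d :: 'k rep set)"
    unfolding additive_polynomial_functor_def induced_mor_def
  proof (intro conjI D' allI ballI)
    fix X Y and f g :: "'k mat" assume f: "f \<in> svec_hom X Y" and g: "g \<in> svec_hom X Y"
    let ?X = "tensor_rep d X :: 'k rep" and ?Y = "tensor_rep d Y :: 'k rep"
    let ?f = "tensor_map d f" and ?g = "tensor_map d g" and ?fg = "tensor_map d (f + g)"
    note X = tensor[of X] and Y = tensor[of Y]
    have hom: "?f \<in> rep_hom d ?X ?Y" "?g \<in> rep_hom d ?X ?Y" "?fg \<in> rep_hom d ?X ?Y"
      using f g by (simp_all add: tensor_map_rep_hom svec_hom_add)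
    note car = functor_carrier[OF D' X Y hom(1)] functor_carrier[OF D' X Y hom(2)] functor_carrier[OF D' X Y hom(3)]
    show "fmor ?D ?X ?Y ?fg = fmor ?D ?X ?Y ?f + fmor ?D ?X ?Y ?g"
    proof (rule mat_eq_by_vecs[OF car(3)])
      show "fmor ?D ?X ?Y ?f + fmor ?D ?X ?Y ?g \<in> carrier_mat (fobj ?D ?Y) (fobj ?D ?X)"
        by (rule add_carrier_mat[OF car(2)])
      fix v :: "'k vec" assume v: "v \<in> carrier_vec (fobj ?D ?X)"
      obtain a where a: "a \<in> rep_hom d L ?X" "v = fmor ?D L ?X a *\<^sub>v u"
        using gen[OF X v] by blast
      define w1 where "w1 = fmor ?D ?X ?Y ?fg *\<^sub>v v"
      define w2 where "w2 = fmor ?D ?X ?Y ?f *\<^sub>v v + fmor ?D ?X ?Y ?g *\<^sub>v v"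
      have w: "w1 \<in> carrier_vec (fobj ?D ?Y)" "w2 \<in> carrier_vec (fobj ?D ?Y)"
        unfolding w1_def w2_def using mult_mat_vec_carrier[OF car(1) v] mult_mat_vec_carrier[OF car(2) v]
          mult_mat_vec_carrier[OF car(3) v] by simp_all
      have "w1 - w2 = 0\<^sub>v (fobj ?D ?Y)"
      proof (rule faithful[OF Y])
        show "w1 - w2 \<in> carrier_vec (fobj ?D ?Y)"
          using w by simp
        fix b assume b: "b \<in> rep_hom d ?Y L"
        note Db = functor_carrier[OF D' Y L(1) b]
        \<comment> \<open>Once \<open>v\<close> is written as an image of \<open>u\<close>, probing
          by \<open>b\<close> leaves only the endomorphism \<open>b * h * a\<close> of the line, and
          the expansion of tensor powers between lines applies.\<close>
        have comp: "fmor ?D ?Y L b *\<^sub>v (fmor ?D ?X ?Y h *\<^sub>v v) = fmor ?D L L (b * h * a) *\<^sub>v u"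
          and endo: "b * h * a \<in> rep_hom d L L" if h: "h \<in> rep_hom d ?X ?Y" for h
        proof -
          note bh = Bobj_hom_mult[OF X Y L(1) h b]
          have "fmor ?D ?Y L b *\<^sub>v (fmor ?D ?X ?Y h *\<^sub>v v) = fmor ?D ?X L (b * h) *\<^sub>v v"
            by (rule functor_mult_vec[OF D' X Y L(1) h b v])
          also have "\<dots> = fmor ?D L L (b * h * a) *\<^sub>v u"
            unfolding a(2) by (rule functor_mult_vec[OF D' L(1) X L(1) a(1) bh u(1)])
          finally show "fmor ?D ?Y L b *\<^sub>v (fmor ?D ?X ?Y h *\<^sub>v v) = fmor ?D L L (b * h * a) *\<^sub>v u" .
          show "b * h * a \<in> rep_hom d L L"
            by (rule Bobj_hom_mult[OF L(1) X L(1) a(1) bh])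
        qed
        have "fmor ?D ?Y L b *\<^sub>v w1 = fmor ?D L L (b * ?fg * a) *\<^sub>v u"
          unfolding w1_def by (rule comp[OF hom(3)])
        also have "b * ?fg * a = b * ?f * a + b * ?g * a"
          by (rule tensor_map_add_between_lines[OF p Bobj_is_rep[OF L(1)] L(2) a(1) b f g])
        also have "fmor ?D L L (b * ?f * a + b * ?g * a) *\<^sub>v u
            = fmor ?D L L (b * ?f * a) *\<^sub>v u + fmor ?D L L (b * ?g * a) *\<^sub>v u"
          unfolding functor_add[OF D' L(1) L(1) endo[OF hom(1)] endo[OF hom(2)]]
          by (rule add_mult_distrib_mat_vec[OF functor_carrier[OF D' L(1) L(1) endo[OF hom(1)]]
                functor_carrier[OF D' L(1) L(1) endo[OF hom(2)]] u(1)])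
        also have "\<dots> = fmor ?D ?Y L b *\<^sub>v w2"
          unfolding w2_def comp[OF hom(1), symmetric] comp[OF hom(2), symmetric]
          by (rule mult_add_distrib_mat_vec[OF Db mult_mat_vec_carrier[OF car(1) v]
                mult_mat_vec_carrier[OF car(2) v], symmetric])
        finally show "fmor ?D ?Y L b *\<^sub>v (w1 - w2) = 0\<^sub>v (fobj ?D L)"
          using mult_minus_distrib_mat_vec[OF Db w] mult_mat_vec_carrier[OF Db w(2)] by simp
      qed
      then have "(w1 - w2) $ i = 0" if "i < fobj ?D ?Y" for i
        using that by simp
      then have "w1 = w2"
        using w by (intro eq_vecI) auto
      then show "fmor ?D ?X ?Y ?fg *\<^sub>v v = (fmor ?D ?X ?Y ?f + fmor ?D ?X ?Y ?g) *\<^sub>v v"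
        unfolding w1_def w2_def add_mult_distrib_mat_vec[OF car(1,2) v] .
    qed
  qed
qed

lemma additive_polynomial: "additive_polynomial_functor d F \<Longrightarrow> polynomial_functor d F"
  by (simp add: additive_polynomial_functor_def)

lemma additive_functor_add:
  assumes "additive_polynomial_functor d F" "f \<in> svec_hom X Y" "g \<in> svec_hom X Y"
  shows "fmor F (tensor_rep d X) (tensor_rep d Y) (tensor_map d (f + g))
    = fmor F (tensor_rep d X) (tensor_rep d Y) (tensor_map d f)
      + fmor F (tensor_rep d X) (tensor_rep d Y) (tensor_map d g)"
  using assms unfolding additive_polynomial_functor_def induced_mor_def by blast

section \<open>Direct sums\<close>

text \<open>The two-block case, which lets lists of functors and of representations be treated by
  induction along the list.\<close>

definition block_sum :: "'k::zero mat \<Rightarrow> 'k mat \<Rightarrow> 'k mat" where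
  "block_sum A B = four_block_mat A (0\<^sub>m (dim_row A) (dim_col B)) (0\<^sub>m (dim_row B) (dim_col A)) B"

lemma diag_block_mat_Cons: "diag_block_mat (A # As) = block_sum A (diag_block_mat As)"
  by (simp add: block_sum_def Let_def)

lemma block_sum_carrier:
  "A \<in> carrier_mat m n \<Longrightarrow> B \<in> carrier_mat m' n' \<Longrightarrow> block_sum A B \<in> carrier_mat (m + m') (n + n')"
  by (simp add: block_sum_def)

lemma block_sum_one: "block_sum (1\<^sub>m m) (1\<^sub>m n) = (1\<^sub>m (m + n) :: 'k::{zero, one} mat)"
  by (simp add: block_sum_def)

lemma block_sum_mult:
  fixes A B C D :: "'k::field mat"
  assumes "A \<in> carrier_mat m n" "B \<in> carrier_mat m' n'" "C \<in> carrier_mat n l" "D \<in> carrier_mat n' l'"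
  shows "block_sum A B * block_sum C D = block_sum (A * C) (B * D)"
proof -
  have "block_sum A B * block_sum C D = four_block_mat (A * C + 0\<^sub>m m n' * 0\<^sub>m n' l)
      (A * 0\<^sub>m n l' + 0\<^sub>m m n' * D) (0\<^sub>m m' n * C + B * 0\<^sub>m n' l) (0\<^sub>m m' n * 0\<^sub>m n l' + B * D)"
    unfolding block_sum_def using assms
    by (subst mult_four_block_mat[of A m n _ n' _ m' B C l _ l' _ D]) auto
  also have "\<dots> = block_sum (A * C) (B * D)"
    unfolding block_sum_def using assms by (intro cong_four_block_mat) (auto intro!: eq_matI)
  finally show ?thesis .
qed

lemma block_sum_add:
  fixes A B C D :: "'k::field mat"
  assumes "A \<in> carrier_mat m n" "B \<in> carrier_mat m' n'" "C \<in> carrier_mat m n" "D \<in> carrier_mat m' n'"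
  shows "block_sum (A + C) (B + D) = block_sum A B + block_sum C D"
  using assms unfolding block_sum_def
  by (subst add_four_block_mat[of A m n _ n' _ m' B C _ _ D]) auto

lemma block_sum_smult:
  fixes A B :: "'k::field mat"
  assumes "A \<in> carrier_mat m n" "B \<in> carrier_mat m' n'"
  shows "block_sum (c \<cdot>\<^sub>m A) (c \<cdot>\<^sub>m B) = c \<cdot>\<^sub>m block_sum A B"
  using assms unfolding block_sum_def
  by (subst smult_four_block_mat[of A m n _ n' _ m' B]) auto

lemma functor_sum_Nil: "fobj (functor_sum []) M = 0" "fmor (functor_sum []) M N f = 0\<^sub>m 0 0"
  by (simp_all add: functor_sum_def)

lemma functor_sum_Cons:
  "fobj (functor_sum (F # Fs)) M = fobj F M + fobj (functor_sum Fs) M"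
  "fmor (functor_sum (F # Fs)) M N f = block_sum (fmor F M N f) (fmor (functor_sum Fs) M N f)"
  by (simp_all add: functor_sum_def diag_block_mat_Cons del: diag_block_mat.simps)

lemma polynomial_functor_sum:
  assumes "\<And>F. F \<in> set Fs \<Longrightarrow> polynomial_functor d F"
  shows "polynomial_functor d (functor_sum Fs :: 'k::field rep_functor)"
  using assms
proof (induction Fs)
  case Nil
  show ?case
    unfolding polynomial_functor_def functor_sum_Nil by (auto intro!: eq_matI)
next
  case (Cons F Fs)
  have F: "polynomial_functor d F" and G: "polynomial_functor d (functor_sum Fs)"
    using Cons by auto
  let ?B = "\<lambda>M N f. block_sum (fmor F M N f) (fmor (functor_sum Fs) M N f)"
  show ?case
    unfolding polynomial_functor_def functor_sum_Cons
  proof (intro conjI ballI allI)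
    fix M N :: "'k rep" and f assume *: "M \<in> Bobj d" "N \<in> Bobj d" and f: "f \<in> rep_hom d M N"
    note Ff = functor_carrier[OF F * f] and Gf = functor_carrier[OF G * f]
    show "?B M N f \<in> carrier_mat (fobj F N + fobj (functor_sum Fs) N) (fobj F M + fobj (functor_sum Fs) M)"
      by (rule block_sum_carrier[OF Ff Gf])
    show "?B M N (c \<cdot>\<^sub>m f) = c \<cdot>\<^sub>m ?B M N f" for c
      unfolding functor_smult[OF F * f] functor_smult[OF G * f] by (rule block_sum_smult[OF Ff Gf])
    fix g assume g: "g \<in> rep_hom d M N"
    show "?B M N (f + g) = ?B M N f + ?B M N g"
      unfolding functor_add[OF F * f g] functor_add[OF G * f g]
      by (rule block_sum_add[OF Ff Gf functor_carrier[OF F * g] functor_carrier[OF G * g]])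
  next
    fix M :: "'k rep" assume M: "M \<in> Bobj d"
    show "?B M M (1\<^sub>m (rdim M)) = 1\<^sub>m (fobj F M + fobj (functor_sum Fs) M)"
      unfolding functor_one[OF F M M] functor_one[OF G M M] by (rule block_sum_one)
  next
    fix L M N :: "'k rep" and f g
    assume *: "L \<in> Bobj d" "M \<in> Bobj d" "N \<in> Bobj d" "f \<in> rep_hom d L M" "g \<in> rep_hom d M N"
    show "?B L N (g * f) = ?B M N g * ?B L M f"
      unfolding functor_mult[OF F *] functor_mult[OF G *]
      by (rule block_sum_mult[symmetric, OF functor_carrier[OF F *(2,3,5)] functor_carrier[OF G *(2,3,5)]
            functor_carrier[OF F *(1,2,4)] functor_carrier[OF G *(1,2,4)]])
  qed
qed

lemma additive_functor_sum:
  fixes Fs :: "'k::field rep_functor list"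
  assumes tensor: "\<And>X. tensor_rep d X \<in> (Bobj d :: 'k rep set)"
    and "\<And>F. F \<in> set Fs \<Longrightarrow> additive_polynomial_functor d F"
  shows "additive_polynomial_functor d (functor_sum Fs)"
  using assms(2)
proof (induction Fs)
  case Nil
  have "polynomial_functor d (functor_sum [] :: 'k rep_functor)"
    by (rule polynomial_functor_sum) simp
  then show ?case
    unfolding additive_polynomial_functor_def induced_mor_def functor_sum_Nil by (auto intro!: eq_matI)
next
  case (Cons F Fs)
  have F: "additive_polynomial_functor d F" and G: "additive_polynomial_functor d (functor_sum Fs)"
    using Cons by auto
  note F' = additive_polynomial[OF F] and G' = additive_polynomial[OF G]
  have "polynomial_functor d (functor_sum (F # Fs))"
    using Cons.prems by (intro polynomial_functor_sum additive_polynomial)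
  moreover have "induced_mor d (functor_sum (F # Fs)) X Y (f + g)
      = induced_mor d (functor_sum (F # Fs)) X Y f + induced_mor d (functor_sum (F # Fs)) X Y g"
    if f: "f \<in> svec_hom X Y" and g: "g \<in> svec_hom X Y" for X Y f g
  proof -
    note hom = tensor_map_rep_hom[OF f, of d] tensor_map_rep_hom[OF g, of d]
    show ?thesis
      unfolding induced_mor_def functor_sum_Cons additive_functor_add[OF F f g] additive_functor_add[OF G f g]
      using block_sum_add[OF functor_carrier[OF F' tensor tensor hom(1)] functor_carrier[OF G' tensor tensor hom(1)]
          functor_carrier[OF F' tensor tensor hom(2)] functor_carrier[OF G' tensor tensor hom(2)]] by simp
  qed
  ultimately show ?case
    by (simp add: additive_polynomial_functor_def)
qed

text \<open>\<open>inverts_mat\<close> leaves the shape of the inverse open; it is recovered by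
  comparing dimensions in the two product equations.\<close>

lemma invertible_matE:
  fixes A :: "'k::field mat"
  assumes "A \<in> carrier_mat m n" "invertible_mat A"
  obtains B where "m = n" "B \<in> carrier_mat n n" "A * B = 1\<^sub>m n" "B * A = 1\<^sub>m n"
proof -
  have A: "dim_row A = m" "dim_col A = n"
    using assms(1) by (rule carrier_matD)+
  have mn: "m = n"
    using assms(2) unfolding invertible_mat_def square_mat.simps A by simp
  obtain B where B: "A * B = 1\<^sub>m m" "B * A = 1\<^sub>m (dim_row B)"
    using assms(2) unfolding invertible_mat_def inverts_mat_def A by blast
  have "dim_col B = m" "dim_row B = n"
    using arg_cong[OF B(1), of dim_col] arg_cong[OF B(2), of dim_col] A(2) by simp_all
  then have "B \<in> carrier_mat n n"
    unfolding mn by (rule carrier_matI[rotated])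
  then show thesis
    using that[OF mn] B \<open>dim_row B = n\<close> unfolding mn by metis
qed

lemma invertible_matI:
  fixes A :: "'k::field mat"
  assumes "A \<in> carrier_mat n n" "B \<in> carrier_mat n n" "A * B = 1\<^sub>m n" "B * A = 1\<^sub>m n"
  shows "invertible_mat A"
  using assms by (auto simp: invertible_mat_def inverts_mat_def)

text \<open>Additivity of \<open>G\<close> is carried across the naturality squares from
  \<open>?X\<close> to \<open>?Y\<close>, and \<open>\<eta> ?Y\<close> is then cancelled by its
  inverse.\<close>

lemma additive_functor_iso:
  fixes F G :: "'k::field rep_functor"
  assumes tensor: "\<And>X. tensor_rep d X \<in> (Bobj d :: 'k rep set)"
    and F: "polynomial_functor d F" and G: "additive_polynomial_functor d G" and iso: "functor_iso d F G"
  shows "additive_polynomial_functor d F"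
  unfolding additive_polynomial_functor_def induced_mor_def
proof (intro conjI F allI ballI)
  fix X Y and f g :: "'k mat" assume f: "f \<in> svec_hom X Y" and g: "g \<in> svec_hom X Y"
  let ?X = "tensor_rep d X :: 'k rep" and ?Y = "tensor_rep d Y :: 'k rep"
  let ?F = "\<lambda>f. fmor F ?X ?Y (tensor_map d f)" and ?G = "\<lambda>f. fmor G ?X ?Y (tensor_map d f)"
  obtain \<eta> where \<eta>: "nat_trans d F G \<eta>" and inv: "\<And>M. M \<in> Bobj d \<Longrightarrow> invertible_mat (\<eta> M)"
    using iso by (auto simp: functor_iso_def)
  have \<eta>c: "\<eta> M \<in> carrier_mat (fobj G M) (fobj F M)" if "M \<in> Bobj d" for M
    using \<eta> that by (simp add: nat_trans_def)
  note G' = additive_polynomial[OF G]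
  have hom: "tensor_map d h \<in> rep_hom d ?X ?Y" if "h \<in> svec_hom X Y" for h
    by (rule tensor_map_rep_hom[OF that])
  note car = functor_carrier[OF F tensor tensor hom] and carG = functor_carrier[OF G' tensor tensor hom]
  have nat: "?G h * \<eta> ?X = \<eta> ?Y * ?F h" if "h \<in> svec_hom X Y" for h
    using \<eta> hom[OF that] tensor by (simp add: nat_trans_def)
  obtain B where "fobj G ?Y = fobj F ?Y" and B: "B \<in> carrier_mat (fobj F ?Y) (fobj F ?Y)" "B * \<eta> ?Y = 1\<^sub>m (fobj F ?Y)"
    using invertible_matE[OF \<eta>c[OF tensor] inv[OF tensor]] by metis
  then have \<eta>Y: "\<eta> ?Y \<in> carrier_mat (fobj F ?Y) (fobj F ?Y)"
    using \<eta>c[OF tensor, of Y] by simp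
  have cancel: "B * (\<eta> ?Y * A) = A" if "A \<in> carrier_mat (fobj F ?Y) (fobj F ?X)" for A
    using assoc_mult_mat[OF B(1) \<eta>Y that] B(2) that by simp
  note fg = svec_hom_add[OF f g]
  have "?G (f + g) = ?G f + ?G g"
    by (rule additive_functor_add[OF G f g])
  then have "\<eta> ?Y * ?F (f + g) = (?G f + ?G g) * \<eta> ?X"
    using nat[OF fg] by simp
  also have "\<dots> = ?G f * \<eta> ?X + ?G g * \<eta> ?X"
    by (rule add_mult_distrib_mat[OF carG[OF f] carG[OF g] \<eta>c[OF tensor]])
  also have "\<dots> = \<eta> ?Y * (?F f + ?F g)"
    unfolding nat[OF f] nat[OF g] by (rule mult_add_distrib_mat[OF \<eta>Y car[OF f] car[OF g], symmetric])
  finally have "B * (\<eta> ?Y * ?F (f + g)) = B * (\<eta> ?Y * (?F f + ?F g))"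
    by simp
  then show "?F (f + g) = ?F f + ?F g"
    unfolding cancel[OF car[OF fg]] cancel[OF add_carrier_mat[OF car[OF g]]] .
qed

section \<open>Additive functors are determined by their values on lines\<close>

text \<open>The dimensions are arguments because the empty sum has to be a zero matrix of known
  size.\<close>

fun mat_list_sum :: "nat \<Rightarrow> nat \<Rightarrow> 'k::field mat list \<Rightarrow> 'k mat" where
  "mat_list_sum m n [] = 0\<^sub>m m n"
| "mat_list_sum m n (A # As) = A + mat_list_sum m n As"

lemma mat_list_sum_carrier:
  "(\<And>A. A \<in> set As \<Longrightarrow> A \<in> carrier_mat m n) \<Longrightarrow> mat_list_sum m n As \<in> carrier_mat m n"
  by (induction As) auto

lemma mult_mat_list_sum:
  assumes "B \<in> carrier_mat l m" "\<And>A. A \<in> set As \<Longrightarrow> A \<in> carrier_mat m n"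
  shows "B * mat_list_sum m n As = mat_list_sum l n (map (\<lambda>A. B * A) As)"
  using assms(2)
proof (induction As)
  case (Cons A As)
  then have "mat_list_sum m n As \<in> carrier_mat m n"
    by (intro mat_list_sum_carrier) simp
  then show ?case
    using Cons mult_add_distrib_mat[OF assms(1), of A n] by simp
qed (use assms(1) in simp)

lemma mat_list_sum_mult:
  assumes "B \<in> carrier_mat n l" "\<And>A. A \<in> set As \<Longrightarrow> A \<in> carrier_mat m n"
  shows "mat_list_sum m n As * B = mat_list_sum m l (map (\<lambda>A. A * B) As)"
  using assms(2)
proof (induction As)
  case (Cons A As)
  then have "mat_list_sum m n As \<in> carrier_mat m n"
    by (intro mat_list_sum_carrier) simp
  then show ?case
    using Cons add_mult_distrib_mat[of A m n "mat_list_sum m n As" B l] assms(1) by simp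
qed (use assms(1) in simp)

lemma mat_list_sum_append:
  assumes "\<And>A. A \<in> set As \<union> set Bs \<Longrightarrow> A \<in> carrier_mat m n"
  shows "mat_list_sum m n (As @ Bs) = mat_list_sum m n As + mat_list_sum m n Bs"
  using assms
proof (induction As)
  case Nil
  then have "mat_list_sum m n Bs \<in> carrier_mat m n"
    by (intro mat_list_sum_carrier) simp
  then show ?case
    by simp
next
  case (Cons A As)
  then have "mat_list_sum m n As \<in> carrier_mat m n" "mat_list_sum m n Bs \<in> carrier_mat m n" "A \<in> carrier_mat m n"
    by (auto intro!: mat_list_sum_carrier)
  then show ?case
    using Cons by (simp add: assoc_add_mat[of _ m n])
qed

abbreviation line_terms ::
  "'k::field rep_functor \<Rightarrow> 'k rep \<Rightarrow> ('k rep \<times> 'k mat \<times> 'k mat) list \<Rightarrow> 'k mat list" where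
  "line_terms F M xs \<equiv> map (\<lambda>(L, a, b). fmor F L M a * fmor F M L b) xs"

abbreviation through ::
  "'k::field mat \<Rightarrow> 'k mat \<Rightarrow> ('k rep \<times> 'k mat \<times> 'k mat) list \<Rightarrow> ('k rep \<times> 'k mat \<times> 'k mat) list" where
  "through \<alpha> \<beta> xs \<equiv> map (\<lambda>(L, a, b). (L, \<alpha> * a, b * \<beta>)) xs"

text \<open>The list contains pairs of maps from a line to \<open>M\<close> and back. Their
  composites need not sum to the identity of \<open>M\<close>, but their images under every additive
  functor sum to the identity of its value. The quantifier over functors stands inside, so that one
  list can serve two functors at once.\<close>

definition splits ::
  "nat \<Rightarrow> 'k::field rep set \<Rightarrow> 'k rep \<Rightarrow> ('k rep \<times> 'k mat \<times> 'k mat) list \<Rightarrow> bool" where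
  "splits d \<L> M xs \<longleftrightarrow>
     (\<forall>(L, a, b) \<in> set xs. L \<in> \<L> \<and> a \<in> rep_hom d L M \<and> b \<in> rep_hom d M L) \<and>
     (\<forall>F. additive_polynomial_functor d F \<longrightarrow>
        mat_list_sum (fobj F M) (fobj F M) (line_terms F M xs) = 1\<^sub>m (fobj F M))"

lemma splitsD:
  assumes "splits d \<L> M xs" "\<L> \<subseteq> Bobj d" "(L, a, b) \<in> set xs"
  shows "L \<in> \<L>" "L \<in> Bobj d" "a \<in> rep_hom d L M" "b \<in> rep_hom d M L"
  using assms by (auto simp: splits_def)

lemma splits_term_carrier:
  assumes F: "polynomial_functor d F" and M: "M \<in> Bobj d" and xs: "splits d \<L> M xs" "\<L> \<subseteq> Bobj d"
    and X: "X \<in> set (line_terms F M xs)"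
  shows "X \<in> carrier_mat (fobj F M) (fobj F M)"
proof -
  obtain L a b where x: "(L, a, b) \<in> set xs" and X': "X = fmor F L M a * fmor F M L b"
    using X by auto
  note hom = splitsD[OF xs x]
  show ?thesis
    unfolding X' by (rule mult_carrier_mat[OF functor_carrier[OF F hom(2) M hom(3)] functor_carrier[OF F M hom(2,4)]])
qed

text \<open>Writing the identity of the value of \<open>F\<close> at \<open>M\<close> as a sum of
  terms F(a) F(b) gives \<open>A\<close> as the sum of F(a) (F(b) A), and the inner factors are
  known.\<close>

lemma splits_jointly_mono:
  fixes F :: "'k::field rep_functor"
  assumes F: "additive_polynomial_functor d F" and M: "M \<in> Bobj d" and \<L>: "\<L> \<subseteq> Bobj d"
    and xs: "splits d \<L> M xs"
    and A: "A \<in> carrier_mat (fobj F M) n" and B: "B \<in> carrier_mat (fobj F M) n"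
    and eq: "\<And>L h. L \<in> \<L> \<Longrightarrow> h \<in> rep_hom d M L \<Longrightarrow> fmor F M L h * A = fmor F M L h * B"
  shows "A = B"
proof -
  note F' = additive_polynomial[OF F]
  note hom = splitsD[OF xs \<L>] and car = splits_term_carrier[OF F' M xs \<L>]
  let ?S = "line_terms F M xs"
  have "mat_list_sum (fobj F M) (fobj F M) ?S = 1\<^sub>m (fobj F M)"
    using xs F by (simp add: splits_def)
  then have sum: "C = mat_list_sum (fobj F M) n (map (\<lambda>X. X * C) ?S)" if C: "C \<in> carrier_mat (fobj F M) n" for C
    using mat_list_sum_mult[OF C, of ?S, OF car] C by (simp only: left_mult_one_mat)
  have map_eq: "map (\<lambda>X. X * A) ?S = map (\<lambda>X. X * B) ?S"
  proof (rule map_cong)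
    fix X assume "X \<in> set ?S"
    then obtain L a b where x: "(L, a, b) \<in> set xs" and X': "X = fmor F L M a * fmor F M L b"
      by auto
    note Fa = functor_carrier[OF F' hom(2)[OF x] M hom(3)[OF x]]
      and Fb = functor_carrier[OF F' M hom(2)[OF x] hom(4)[OF x]]
    show "X * A = X * B"
      unfolding X' assoc_mult_mat[OF Fa Fb A] assoc_mult_mat[OF Fa Fb B] eq[OF hom(1)[OF x] hom(4)[OF x]] ..
  qed simp
  have "A = mat_list_sum (fobj F M) n (map (\<lambda>X. X * A) ?S)"
    by (rule sum[OF A])
  also have "\<dots> = B"
    unfolding map_eq by (rule sum[OF B, symmetric])
  finally show ?thesis .
qed

text \<open>The matrix is the sum of G(a) F(b) over the list, which makes sense because
  \<open>F\<close> and \<open>G\<close> have equal dimensions at lines. After a map \<open>h\<close>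
  to a line, G(h a) may be replaced by F(h a), and the sum collapses to F(h).\<close>

lemma splits_transfer_exists:
  fixes F G :: "'k::field rep_functor"
  assumes F: "additive_polynomial_functor d F" and G: "additive_polynomial_functor d G"
    and M: "M \<in> Bobj d" and \<L>: "\<L> \<subseteq> Bobj d" and xs: "splits d \<L> M xs"
    and obj: "\<And>L. L \<in> \<L> \<Longrightarrow> fobj F L = fobj G L"
    and mor: "\<And>L L' h. L \<in> \<L> \<Longrightarrow> L' \<in> \<L> \<Longrightarrow> h \<in> rep_hom d L L' \<Longrightarrow> fmor F L L' h = fmor G L L' h"
  shows "\<exists>A \<in> carrier_mat (fobj G M) (fobj F M).
    \<forall>L \<in> \<L>. \<forall>h \<in> rep_hom d M L. fmor G M L h * A = fmor F M L h"
proof -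
  note F' = additive_polynomial[OF F] and G' = additive_polynomial[OF G]
  note hom = splitsD[OF xs \<L>] and carS = splits_term_carrier[OF F' M xs \<L>]
  let ?T = "\<lambda>(L, a, b). fmor G L M a * fmor F M L b" and ?S = "\<lambda>(L, a, b). fmor F L M a * fmor F M L b"
  have carT: "X \<in> carrier_mat (fobj G M) (fobj F M)" if X: "X \<in> set (map ?T xs)" for X
  proof -
    obtain L a b where x: "(L, a, b) \<in> set xs" and X': "X = fmor G L M a * fmor F M L b"
      using X by auto
    show ?thesis
      unfolding X' by (rule mult_carrier_mat[OF functor_carrier[OF G' hom(2)[OF x] M hom(3)[OF x], folded obj[OF hom(1)[OF x]]]
            functor_carrier[OF F' M hom(2)[OF x] hom(4)[OF x]]])
  qed
  let ?A = "mat_list_sum (fobj G M) (fobj F M) (map ?T xs)"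
  have "fmor G M K h * ?A = fmor F M K h" if K: "K \<in> \<L>" and h: "h \<in> rep_hom d M K" for K h
  proof -
    have K': "K \<in> Bobj d"
      using K \<L> by blast
    note Fh = functor_carrier[OF F' M K' h] and Gh = functor_carrier[OF G' M K' h, folded obj[OF K]]
    have "fmor G M K h * ?A = mat_list_sum (fobj F K) (fobj F M) (map (\<lambda>X. fmor G M K h * X) (map ?T xs))"
      by (rule mult_mat_list_sum[OF Gh carT])
    also have "map (\<lambda>X. fmor G M K h * X) (map ?T xs) = map (\<lambda>X. fmor F M K h * X) (map ?S xs)"
      unfolding map_map
    proof (rule map_cong)
      fix x assume "x \<in> set xs"
      then obtain L a b where x: "(L, a, b) \<in> set xs" "x = (L, a, b)"
        by (metis prod_cases3)
      note L = hom[OF x(1)]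
      note Fa = functor_carrier[OF F' L(2) M L(3)] and Fb = functor_carrier[OF F' M L(2,4)]
        and Ga = functor_carrier[OF G' L(2) M L(3), folded obj[OF L(1)]]
      have ha: "h * a \<in> rep_hom d L K"
        by (rule Bobj_hom_mult[OF L(2) M K' L(3) h])
      have "fmor G M K h * (fmor G L M a * fmor F M L b) = fmor G M K h * fmor G L M a * fmor F M L b"
        by (rule assoc_mult_mat[OF Gh Ga Fb, symmetric])
      also have "fmor G M K h * fmor G L M a = fmor F M K h * fmor F L M a"
        unfolding functor_mult[OF G' L(2) M K' L(3) h, symmetric] functor_mult[OF F' L(2) M K' L(3) h, symmetric]
        by (rule mor[OF L(1) K ha, symmetric])
      also have "\<dots> * fmor F M L b = fmor F M K h * (fmor F L M a * fmor F M L b)"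
        by (rule assoc_mult_mat[OF Fh Fa Fb])
      finally show "((\<lambda>X. fmor G M K h * X) \<circ> ?T) x = ((\<lambda>X. fmor F M K h * X) \<circ> ?S) x"
        by (simp add: x(2))
    qed simp
    also have "mat_list_sum (fobj F K) (fobj F M) \<dots> = fmor F M K h * mat_list_sum (fobj F M) (fobj F M) (map ?S xs)"
      by (rule mult_mat_list_sum[OF Fh carS, symmetric])
    also have "mat_list_sum (fobj F M) (fobj F M) (map ?S xs) = 1\<^sub>m (fobj F M)"
      using xs F by (simp add: splits_def)
    finally show ?thesis
      using right_mult_one_mat[OF Fh] by simp
  qed
  then show ?thesis
    using mat_list_sum_carrier[OF carT] by blast
qed

text \<open>Both sides become F(h) after any map \<open>h\<close> to a line, and such maps determine
  the matrix.\<close>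

lemma splits_transfer_inverse:
  fixes F G :: "'k::field rep_functor"
  assumes F: "additive_polynomial_functor d F" and M: "M \<in> Bobj d" and \<L>: "\<L> \<subseteq> Bobj d"
    and xs: "splits d \<L> M xs"
    and A: "A \<in> carrier_mat (fobj G M) (fobj F M)" and B: "B \<in> carrier_mat (fobj F M) (fobj G M)"
    and GA: "\<And>L h. L \<in> \<L> \<Longrightarrow> h \<in> rep_hom d M L \<Longrightarrow> fmor G M L h * A = fmor F M L h"
    and FB: "\<And>L h. L \<in> \<L> \<Longrightarrow> h \<in> rep_hom d M L \<Longrightarrow> fmor F M L h * B = fmor G M L h"
  shows "B * A = 1\<^sub>m (fobj F M)"
proof (rule splits_jointly_mono[OF F M \<L> xs mult_carrier_mat[OF B A] one_carrier_mat])
  fix L h assume L: "L \<in> \<L>" and h: "h \<in> rep_hom d M L"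
  have "polynomial_functor d F" "L \<in> Bobj d"
    using additive_polynomial[OF F] L \<L> by blast+
  note Fh = functor_carrier[OF this(1) M this(2) h]
  show "fmor F M L h * (B * A) = fmor F M L h * 1\<^sub>m (fobj F M)"
    using assoc_mult_mat[OF Fh B A] FB[OF L h] GA[OF L h] right_mult_one_mat[OF Fh] by simp
qed

text \<open>The components are characterised by compatibility with all maps to lines, hence do not
  depend on the lists they were built from. Naturality and invertibility become instances of that
  uniqueness.\<close>

lemma functor_iso_by_lines:
  fixes F G :: "'k::field rep_functor"
  assumes F: "additive_polynomial_functor d F" and G: "additive_polynomial_functor d G"
    and \<L>: "\<L> \<subseteq> Bobj d" and split: "\<And>M. M \<in> Bobj d \<Longrightarrow> \<exists>xs. splits d \<L> M xs"
    and obj: "\<And>L. L \<in> \<L> \<Longrightarrow> fobj F L = fobj G L"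
    and mor: "\<And>L L' h. L \<in> \<L> \<Longrightarrow> L' \<in> \<L> \<Longrightarrow> h \<in> rep_hom d L L' \<Longrightarrow> fmor F L L' h = fmor G L L' h"
  shows "functor_iso d F G"
proof -
  note F' = additive_polynomial[OF F] and G' = additive_polynomial[OF G]
  have "\<forall>M \<in> Bobj d. \<exists>A \<in> carrier_mat (fobj G M) (fobj F M).
      \<forall>L \<in> \<L>. \<forall>h \<in> rep_hom d M L. fmor G M L h * A = fmor F M L h"
    using splits_transfer_exists[OF F G _ \<L> _ obj mor] split by blast
  then obtain \<eta> where \<eta>: "\<And>M. M \<in> Bobj d \<Longrightarrow> \<eta> M \<in> carrier_mat (fobj G M) (fobj F M)"
    and G\<eta>: "\<And>M L h. M \<in> Bobj d \<Longrightarrow> L \<in> \<L> \<Longrightarrow> h \<in> rep_hom d M L \<Longrightarrow> fmor G M L h * \<eta> M = fmor F M L h"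
    by metis
  have "\<forall>M \<in> Bobj d. \<exists>A \<in> carrier_mat (fobj F M) (fobj G M).
      \<forall>L \<in> \<L>. \<forall>h \<in> rep_hom d M L. fmor F M L h * A = fmor G M L h"
    using splits_transfer_exists[OF G F _ \<L> _ obj[symmetric] mor[symmetric]] split by blast
  then obtain \<zeta> where \<zeta>: "\<And>M. M \<in> Bobj d \<Longrightarrow> \<zeta> M \<in> carrier_mat (fobj F M) (fobj G M)"
    and F\<zeta>: "\<And>M L h. M \<in> Bobj d \<Longrightarrow> L \<in> \<L> \<Longrightarrow> h \<in> rep_hom d M L \<Longrightarrow> fmor F M L h * \<zeta> M = fmor G M L h"
    by metis
  have inverse: "\<zeta> M * \<eta> M = 1\<^sub>m (fobj F M)" "\<eta> M * \<zeta> M = 1\<^sub>m (fobj G M)" if M: "M \<in> Bobj d" for M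
  proof -
    obtain xs where xs: "splits d \<L> M xs"
      using split[OF M] by blast
    show "\<zeta> M * \<eta> M = 1\<^sub>m (fobj F M)"
      by (rule splits_transfer_inverse[OF F M \<L> xs \<eta>[OF M] \<zeta>[OF M] G\<eta>[OF M] F\<zeta>[OF M]])
    show "\<eta> M * \<zeta> M = 1\<^sub>m (fobj G M)"
      by (rule splits_transfer_inverse[OF G M \<L> xs \<zeta>[OF M] \<eta>[OF M] F\<zeta>[OF M] G\<eta>[OF M]])
  qed
  have "invertible_mat (\<eta> M)" if M: "M \<in> Bobj d" for M
    unfolding invertible_mat_def inverts_mat_def
  proof (intro conjI exI)
    \<comment> \<open>\<open>invertible_mat\<close> includes squareness; each of the two product
      equations bounds one dimension by the other.\<close>
    have "fobj F M \<le> fobj G M" "fobj G M \<le> fobj F M"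
      using mult_eq_one_imp_dim_le[OF \<zeta>[OF M] \<eta>[OF M] inverse(1)[OF M]]
        mult_eq_one_imp_dim_le[OF \<eta>[OF M] \<zeta>[OF M] inverse(2)[OF M]] by simp_all
    then show "square_mat (\<eta> M)"
      using \<eta>[OF M] by simp
    show "\<eta> M * \<zeta> M = 1\<^sub>m (dim_row (\<eta> M))" "\<zeta> M * \<eta> M = 1\<^sub>m (dim_row (\<zeta> M))"
      using inverse[OF M] \<eta>[OF M] \<zeta>[OF M] by simp_all
  qed
  moreover have "fmor G M N f * \<eta> M = \<eta> N * fmor F M N f"
    if M: "M \<in> Bobj d" and N: "N \<in> Bobj d" and f: "f \<in> rep_hom d M N" for M N f
  proof -
    obtain xs where xs: "splits d \<L> N xs"
      using split[OF N] by blast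
    note Ff = functor_carrier[OF F' M N f] and Gf = functor_carrier[OF G' M N f]
    show ?thesis
    proof (rule splits_jointly_mono[OF G N \<L> xs mult_carrier_mat[OF Gf \<eta>[OF M]] mult_carrier_mat[OF \<eta>[OF N] Ff]])
      fix L h assume L: "L \<in> \<L>" and h: "h \<in> rep_hom d N L"
      have L': "L \<in> Bobj d"
        using L \<L> by blast
      note Gh = functor_carrier[OF G' N L' h] and hf = Bobj_hom_mult[OF M N L' f h]
      have "fmor G N L h * (fmor G M N f * \<eta> M) = fmor G M L (h * f) * \<eta> M"
        using assoc_mult_mat[OF Gh Gf \<eta>[OF M]] functor_mult[OF G' M N L' f h] by simp
      also have "\<dots> = fmor F N L h * fmor F M N f"
        using G\<eta>[OF M L hf] functor_mult[OF F' M N L' f h] by simp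
      also have "\<dots> = fmor G N L h * (\<eta> N * fmor F M N f)"
        using assoc_mult_mat[OF Gh \<eta>[OF N] Ff] G\<eta>[OF N L h] by simp
      finally show "fmor G N L h * (fmor G M N f * \<eta> M) = fmor G N L h * (\<eta> N * fmor F M N f)" .
    qed
  qed
  ultimately show ?thesis
    using \<eta> unfolding functor_iso_def nat_trans_def by blast
qed

section \<open>Splitting the objects through lines\<close>

text \<open>F(\<alpha>) and F(\<beta>) can be taken out of the sum, and what remains between them is
  the identity. Retracts and direct sums are both reduced to this.\<close>

lemma splits_sum_through:
  fixes F :: "'k::field rep_functor"
  assumes F: "additive_polynomial_functor d F" and \<L>: "\<L> \<subseteq> Bobj d"
    and T: "T \<in> Bobj d" and S: "S \<in> Bobj d" and xs: "splits d \<L> T xs"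
    and \<alpha>: "\<alpha> \<in> rep_hom d T S" and \<beta>: "\<beta> \<in> rep_hom d S T"
  shows "mat_list_sum (fobj F S) (fobj F S)
      (line_terms F S (through \<alpha> \<beta> xs))
    = fmor F S S (\<alpha> * \<beta>)"
proof -
  note F' = additive_polynomial[OF F]
  note hom = splitsD(2-4)[OF xs \<L>] and car = splits_term_carrier[OF F' T xs \<L>]
  note F\<alpha> = functor_carrier[OF F' T S \<alpha>] and F\<beta> = functor_carrier[OF F' S T \<beta>]
  let ?S = "line_terms F T xs"
  have 1: "line_terms F S (through \<alpha> \<beta> xs)
      = map (\<lambda>X. fmor F T S \<alpha> * X) (map (\<lambda>X. X * fmor F S T \<beta>) ?S)"
    unfolding map_map
  proof (rule map_cong)
    fix x assume "x \<in> set xs"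
    then obtain L a b where x: "(L, a, b) \<in> set xs" "x = (L, a, b)"
      by (metis prod_cases3)
    note L = hom[OF x(1)]
    note Fa = functor_carrier[OF F' L(1) T L(2)] and Fb = functor_carrier[OF F' T L(1,3)]
    have "fmor F L S (\<alpha> * a) * fmor F S L (b * \<beta>)
        = fmor F T S \<alpha> * fmor F L T a * (fmor F T L b * fmor F S T \<beta>)"
      unfolding functor_mult[OF F' L(1) T S L(2) \<alpha>] functor_mult[OF F' S T L(1) \<beta> L(3)] ..
    also have "\<dots> = fmor F T S \<alpha> * (fmor F L T a * (fmor F T L b * fmor F S T \<beta>))"
      by (rule assoc_mult_mat[OF F\<alpha> Fa mult_carrier_mat[OF Fb F\<beta>]])
    also have "fmor F L T a * (fmor F T L b * fmor F S T \<beta>) = fmor F L T a * fmor F T L b * fmor F S T \<beta>"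
      by (rule assoc_mult_mat[OF Fa Fb F\<beta>, symmetric])
    finally show "((\<lambda>(L, a, b). fmor F L S a * fmor F S L b) \<circ> (\<lambda>(L, a, b). (L, \<alpha> * a, b * \<beta>))) x
        = ((\<lambda>X. fmor F T S \<alpha> * X) \<circ> ((\<lambda>X. X * fmor F S T \<beta>) \<circ> (\<lambda>(L, a, b). fmor F L T a * fmor F T L b))) x"
      by (simp add: x(2))
  qed simp
  have 2: "mat_list_sum (fobj F S) (fobj F S) (map (\<lambda>X. fmor F T S \<alpha> * X) (map (\<lambda>X. X * fmor F S T \<beta>) ?S))
      = fmor F T S \<alpha> * mat_list_sum (fobj F T) (fobj F S) (map (\<lambda>X. X * fmor F S T \<beta>) ?S)"
  proof (rule mult_mat_list_sum[OF F\<alpha>, symmetric])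
    fix Y assume "Y \<in> set (map (\<lambda>X. X * fmor F S T \<beta>) ?S)"
    then obtain X where X: "X \<in> set ?S" "Y = X * fmor F S T \<beta>"
      unfolding set_map[of "\<lambda>X. X * fmor F S T \<beta>"] by (rule imageE)
    show "Y \<in> carrier_mat (fobj F T) (fobj F S)"
      unfolding X(2) by (rule mult_carrier_mat[OF car[OF X(1)] F\<beta>])
  qed
  have 3: "mat_list_sum (fobj F T) (fobj F S) (map (\<lambda>X. X * fmor F S T \<beta>) ?S)
      = mat_list_sum (fobj F T) (fobj F T) ?S * fmor F S T \<beta>"
    by (rule mat_list_sum_mult[OF F\<beta> car, symmetric])
  have 4: "mat_list_sum (fobj F T) (fobj F T) ?S = 1\<^sub>m (fobj F T)"
    using xs F by (simp add: splits_def)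
  show ?thesis
    unfolding 1 2 3 4 left_mult_one_mat[OF F\<beta>] by (rule functor_mult[OF F' S T S \<beta> \<alpha>, symmetric])
qed

lemma splits_hom_through:
  assumes \<L>: "\<L> \<subseteq> Bobj d" and T: "T \<in> Bobj d" and S: "S \<in> Bobj d" and xs: "splits d \<L> T xs"
    and \<alpha>: "\<alpha> \<in> rep_hom d T S" and \<beta>: "\<beta> \<in> rep_hom d S T"
    and x: "(L, a, b) \<in> set (through \<alpha> \<beta> xs)"
  shows "L \<in> \<L> \<and> a \<in> rep_hom d L S \<and> b \<in> rep_hom d S L"
proof -
  obtain a' b' where x': "(L, a', b') \<in> set xs" "a = \<alpha> * a'" "b = b' * \<beta>"
    using x by auto
  then have "L \<in> \<L>" "a' \<in> rep_hom d L T" "b' \<in> rep_hom d T L"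
    using xs by (auto simp: splits_def)
  then show ?thesis
    unfolding x' using Bobj_hom_mult[OF _ T S _ \<alpha>, of L a'] Bobj_hom_mult[OF S T _ \<beta>, of L b'] \<L> by blast
qed

lemma splits_retract:
  fixes S :: "'k::field rep"
  assumes \<L>: "\<L> \<subseteq> Bobj d" and T: "T \<in> Bobj d" and S: "S \<in> Bobj d" and xs: "splits d \<L> T xs"
    and \<alpha>: "\<alpha> \<in> rep_hom d T S" and \<beta>: "\<beta> \<in> rep_hom d S T" and one: "\<alpha> * \<beta> = 1\<^sub>m (rdim S)"
  shows "splits d \<L> S (through \<alpha> \<beta> xs)"
  unfolding splits_def
proof (intro conjI ballI allI impI)
  fix x assume x: "x \<in> set (through \<alpha> \<beta> xs)"
  obtain L a b where eq: "x = (L, a, b)"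
    by (rule prod_cases3)
  show "case x of (L, a, b) \<Rightarrow> L \<in> \<L> \<and> a \<in> rep_hom d L S \<and> b \<in> rep_hom d S L"
    unfolding eq prod.case by (rule splits_hom_through[OF \<L> T S xs \<alpha> \<beta> x[unfolded eq]])
next
  fix F :: "'k rep_functor" assume F: "additive_polynomial_functor d F"
  note F' = additive_polynomial[OF F]
  show "mat_list_sum (fobj F S) (fobj F S)
      (line_terms F S (through \<alpha> \<beta> xs))
    = 1\<^sub>m (fobj F S)"
    unfolding splits_sum_through[OF F \<L> T S xs \<alpha> \<beta>] one by (rule functor_one[OF F' S S])
qed

text \<open>The two parts contribute the images of \<open>\<alpha> * \<beta>\<close> and
  \<open>\<alpha>' * \<beta>'\<close>, which are added by linearity of \<open>F\<close> on morphisms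
  of representations.\<close>

lemma splits_biproduct:
  fixes S :: "'k::field rep"
  assumes \<L>: "\<L> \<subseteq> Bobj d" and S: "S \<in> Bobj d" and T: "T \<in> Bobj d" "T' \<in> Bobj d"
    and xs: "splits d \<L> T xs" "splits d \<L> T' ys"
    and \<alpha>: "\<alpha> \<in> rep_hom d T S" "\<alpha>' \<in> rep_hom d T' S" and \<beta>: "\<beta> \<in> rep_hom d S T" "\<beta>' \<in> rep_hom d S T'"
    and one: "\<alpha> * \<beta> + \<alpha>' * \<beta>' = 1\<^sub>m (rdim S)"
  shows "splits d \<L> S
    (through \<alpha> \<beta> xs @ through \<alpha>' \<beta>' ys)"
  unfolding splits_def
proof (intro conjI ballI allI impI)
  let ?xs = "through \<alpha> \<beta> xs" and ?ys = "through \<alpha>' \<beta>' ys"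
  have hom: "L \<in> \<L> \<and> a \<in> rep_hom d L S \<and> b \<in> rep_hom d S L" if "(L, a, b) \<in> set ?xs \<or> (L, a, b) \<in> set ?ys" for L a b
    using that splits_hom_through[OF \<L> T(1) S xs(1) \<alpha>(1) \<beta>(1)] splits_hom_through[OF \<L> T(2) S xs(2) \<alpha>(2) \<beta>(2)]
    by blast
  show "case x of (L, a, b) \<Rightarrow> L \<in> \<L> \<and> a \<in> rep_hom d L S \<and> b \<in> rep_hom d S L" if x: "x \<in> set (?xs @ ?ys)" for x
  proof -
    obtain L a b where eq: "x = (L, a, b)"
      by (rule prod_cases3)
    show ?thesis
      using x hom unfolding eq prod.case set_append Un_iff by blast
  qed
  fix F :: "'k rep_functor" assume F: "additive_polynomial_functor d F"
  note F' = additive_polynomial[OF F]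
  let ?S = "\<lambda>(L, a, b). fmor F L S a * fmor F S L b"
  have car: "X \<in> carrier_mat (fobj F S) (fobj F S)" if X: "X \<in> set (map ?S ?xs) \<union> set (map ?S ?ys)" for X
  proof -
    have "X \<in> ?S ` (set ?xs \<union> set ?ys)"
      using X by (simp only: set_map image_Un)
    then obtain x where x': "x \<in> set ?xs \<union> set ?ys" "X = ?S x"
      by (rule imageE)
    obtain L a b where eq: "x = (L, a, b)"
      by (rule prod_cases3)
    have x: "(L, a, b) \<in> set ?xs \<or> (L, a, b) \<in> set ?ys" and X': "X = fmor F L S a * fmor F S L b"
      using x' unfolding eq prod.case Un_iff by simp_all
    have L: "L \<in> Bobj d"
      using hom[OF x] \<L> by blast
    show ?thesis
      unfolding X' using hom[OF x]
      by (intro mult_carrier_mat[OF functor_carrier[OF F' L S] functor_carrier[OF F' S L]]) simp_all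
  qed
  have "mat_list_sum (fobj F S) (fobj F S) (map ?S (?xs @ ?ys))
      = mat_list_sum (fobj F S) (fobj F S) (map ?S ?xs) + mat_list_sum (fobj F S) (fobj F S) (map ?S ?ys)"
    unfolding map_append by (rule mat_list_sum_append) (rule car)
  also have "mat_list_sum (fobj F S) (fobj F S) (map ?S ?xs) = fmor F S S (\<alpha> * \<beta>)"
    by (rule splits_sum_through[OF F \<L> T(1) S xs(1) \<alpha>(1) \<beta>(1)])
  also have "mat_list_sum (fobj F S) (fobj F S) (map ?S ?ys) = fmor F S S (\<alpha>' * \<beta>')"
    by (rule splits_sum_through[OF F \<L> T(2) S xs(2) \<alpha>(2) \<beta>(2)])
  also have "fmor F S S (\<alpha> * \<beta>) + fmor F S S (\<alpha>' * \<beta>') = fmor F S S (\<alpha> * \<beta> + \<alpha>' * \<beta>')"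
    by (rule functor_add[OF F' S S Bobj_hom_mult[OF S T(1) S \<beta>(1) \<alpha>(1)] Bobj_hom_mult[OF S T(2) S \<beta>(2) \<alpha>(2)], symmetric])
  also have "\<dots> = 1\<^sub>m (fobj F S)"
    unfolding one by (rule functor_one[OF F' S S])
  finally show "mat_list_sum (fobj F S) (fobj F S) (map ?S (?xs @ ?ys)) = 1\<^sub>m (fobj F S)" .
qed

definition basis_projection :: "nat \<Rightarrow> nat \<Rightarrow> 'k::field mat" where
  "basis_projection q i = mat q q (\<lambda>(r, c). if r = i \<and> c = i then 1 else 0)"

definition basis_truncation :: "nat \<Rightarrow> nat \<Rightarrow> 'k::field mat" where
  "basis_truncation q k = mat q q (\<lambda>(r, c). if r = c \<and> r < k then 1 else 0)"

definition basis_line :: "svec \<Rightarrow> nat \<Rightarrow> svec" where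
  "basis_line X i = (if odd_index X i then (0, 1) else (1, 0))"

lemma sdim_basis_line: "sdim (basis_line X i) = 1"
  by (simp add: basis_line_def sdim_def)

lemma odd_index_basis_line: "odd_index (basis_line X i) 0 = odd_index X i"
  by (simp add: basis_line_def odd_index_def)

lemma letter_1: "letter (Suc 0) i t = 0"
  by (simp add: letter_def)

text \<open>The projection to a basis vector is a column times a row, and both preserve parity when
  the line in the middle has the parity of that basis vector. Their tensor powers give the
  factorization.\<close>

lemma tensor_map_basis_projection:
  fixes X :: svec
  assumes i: "i < sdim X"
  shows "\<exists>a b. a \<in> rep_hom d (tensor_rep d (basis_line X i)) (tensor_rep d X :: 'k::field rep) \<and>
    b \<in> rep_hom d (tensor_rep d X) (tensor_rep d (basis_line X i)) \<and>
    a * b = tensor_map d (basis_projection (sdim X) i :: 'k mat)"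
proof -
  let ?q = "sdim X"
  define c where "c = mat ?q 1 (\<lambda>(r, _). if r = i then 1 else 0 :: 'k)"
  define r where "r = mat 1 ?q (\<lambda>(_, c). if c = i then 1 else 0 :: 'k)"
  have c: "c \<in> svec_hom (basis_line X i) X" and r: "r \<in> svec_hom X (basis_line X i)"
    using i by (auto simp: svec_hom_def c_def r_def sdim_basis_line odd_index_basis_line)
  have "tensor_map d c * tensor_map d r = (tensor_map d (basis_projection ?q i) :: 'k mat)"
  proof (rule eq_matI)
    fix u v
    assume "u < dim_row (tensor_map d (basis_projection ?q i) :: 'k mat)"
      "v < dim_col (tensor_map d (basis_projection ?q i) :: 'k mat)"
    then have uv: "u < ?q ^ d" "v < ?q ^ d"
      by (simp_all add: tensor_map_def basis_projection_def)
    then have lt: "letter ?q u t < ?q" "letter ?q v t < ?q" for t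
      using i by (simp_all add: letter_less)
    let ?u = "\<lambda>t. if letter ?q u t = i then 1 else 0 :: 'k" and ?v = "\<lambda>t. if letter ?q v t = i then 1 else 0 :: 'k"
    have "tensor_map d c \<in> carrier_mat (?q ^ d) 1" "tensor_map d r \<in> carrier_mat 1 (?q ^ d)"
      by (simp_all add: tensor_map_def c_def r_def)
    then have "(tensor_map d c * tensor_map d r) $$ (u, v) = tensor_map d c $$ (u, 0) * tensor_map d r $$ (0, v)"
      using uv by (simp add: scalar_prod_def)
    also have "tensor_map d c $$ (u, 0) = (\<Prod>t<d. ?u t)"
      using uv lt by (simp add: tensor_map_def c_def letter_1)
    also have "tensor_map d r $$ (0, v) = (\<Prod>t<d. ?v t)"
      using uv lt by (simp add: tensor_map_def r_def letter_1)
    also have "(\<Prod>t<d. ?u t) * (\<Prod>t<d. ?v t) = (\<Prod>t<d. ?u t * ?v t)"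
      by (rule prod.distrib[symmetric])
    also have "\<dots> = (\<Prod>t<d. basis_projection ?q i $$ (letter ?q u t, letter ?q v t))"
      by (rule prod.cong) (simp_all add: basis_projection_def lt)
    also have "\<dots> = tensor_map d (basis_projection ?q i) $$ (u, v)"
      using uv by (simp add: tensor_map_def basis_projection_def)
    finally show "(tensor_map d c * tensor_map d r) $$ (u, v) = tensor_map d (basis_projection ?q i) $$ (u, v)" .
  qed (simp_all add: tensor_map_def basis_projection_def c_def r_def)
  then show ?thesis
    using tensor_map_rep_hom[OF c] tensor_map_rep_hom[OF r] by blast
qed

lemma tensor_map_one: "tensor_map d (1\<^sub>m q) = (1\<^sub>m (q ^ d) :: 'k::field mat)"
proof (rule eq_matI)
  fix i j assume "i < dim_row (1\<^sub>m (q ^ d) :: 'k mat)" "j < dim_col (1\<^sub>m (q ^ d) :: 'k mat)"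
  then have ij: "i < q ^ d" "j < q ^ d"
    by simp_all
  have lt: "letter q i t < q" "letter q j t < q" if "t < d" for t
    using ij that by (auto intro!: letter_less intro: gr0I simp: power_0_left)
  have "(\<Prod>t<d. 1\<^sub>m q $$ (letter q i t, letter q j t)) = (1\<^sub>m (q ^ d) $$ (i, j) :: 'k)"
  proof (cases "i = j")
    case True
    then show ?thesis
      using ij lt by simp
  next
    case False
    then obtain t where "t < d" "letter q i t \<noteq> letter q j t"
      using word_eqI[OF ij] by blast
    then have "(\<Prod>t<d. 1\<^sub>m q $$ (letter q i t, letter q j t)) = (0 :: 'k)"
      using lt[of t] by (intro prod_zero bexI[of _ t]) auto
    then show ?thesis
      using False ij by simp
  qed
  then show "tensor_map d (1\<^sub>m q) $$ (i, j) = (1\<^sub>m (q ^ d) $$ (i, j) :: 'k)"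
    using ij by (simp add: tensor_map_def)
qed (simp_all add: tensor_map_def)

text \<open>The truncations are the partial sums of the basis projections, so the induction adds two
  morphisms at a time, as in the definition of additivity. The tensor powers of the even and the odd
  line are asked to be retracts of members of \<open>\<L>\<close>, since the standard lines agree
  with them as actions but not as records.\<close>

lemma splits_tensor_rep:
  fixes X :: svec and \<L> :: "'k::field rep set"
  assumes tensor: "\<And>X. tensor_rep d X \<in> (Bobj d :: 'k rep set)" and \<L>: "\<L> \<subseteq> Bobj d"
    and lines: "\<And>X. X = (1, 0) \<or> X = (0, 1) \<Longrightarrow> \<exists>L \<in> \<L>. \<exists>f \<in> rep_hom d L (tensor_rep d X).
      \<exists>g \<in> rep_hom d (tensor_rep d X) L. f * g = 1\<^sub>m (rdim (tensor_rep d X :: 'k rep))"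
  shows "\<exists>xs. splits d \<L> (tensor_rep d X) xs"
proof -
  let ?T = "tensor_rep d X :: 'k rep" and ?q = "sdim X"
  have "\<exists>L a b. L \<in> \<L> \<and> a \<in> rep_hom d L ?T \<and> b \<in> rep_hom d ?T L \<and> a * b = tensor_map d (basis_projection ?q i)"
    if i: "i < ?q" for i
  proof -
    let ?X = "tensor_rep d (basis_line X i) :: 'k rep"
    obtain a b where ab: "a \<in> rep_hom d ?X ?T" "b \<in> rep_hom d ?T ?X" "a * b = tensor_map d (basis_projection ?q i)"
      using tensor_map_basis_projection[OF i] by blast
    have "basis_line X i = (1, 0) \<or> basis_line X i = (0, 1)"
      by (simp add: basis_line_def)
    then obtain L f g where L: "L \<in> \<L>" "f \<in> rep_hom d L ?X" "g \<in> rep_hom d ?X L" "f * g = 1\<^sub>m (rdim ?X)"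
      using lines by blast
    have L': "L \<in> Bobj d"
      using L(1) \<L> by blast
    have "a * f * (g * b) = a * (f * g) * b"
      by (rule assoc_mult_mat_middle[OF rep_hom_carrier[OF ab(1)] rep_hom_carrier[OF L(2)]
            rep_hom_carrier[OF L(3)] rep_hom_carrier[OF ab(2)]])
    also have "\<dots> = tensor_map d (basis_projection ?q i)"
      unfolding L(4) one_hom_mult[OF ab(1)] ab(3) ..
    finally show ?thesis
      using Bobj_hom_mult[OF L' tensor tensor L(2) ab(1)] Bobj_hom_mult[OF tensor tensor L' ab(2) L(3)] L(1) by blast
  qed
  then obtain L a b where
    Lab: "\<And>i. i < ?q \<Longrightarrow> L i \<in> \<L> \<and> a i \<in> rep_hom d (L i) ?T \<and> b i \<in> rep_hom d ?T (L i) \<and>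
      a i * b i = tensor_map d (basis_projection ?q i)"
    by metis
  \<comment> \<open>Reversed, so that passing from \<open>k\<close> to \<open>Suc k\<close> puts the
    new term at the head, where \<open>mat_list_sum\<close> adds it.\<close>
  let ?xs = "\<lambda>k. map (\<lambda>i. (L i, a i, b i)) (rev [0..<k])"
  have "splits d \<L> ?T (?xs ?q)"
    unfolding splits_def
  proof (intro conjI ballI allI impI)
    show "case x of (L, a, b) \<Rightarrow> L \<in> \<L> \<and> a \<in> rep_hom d L ?T \<and> b \<in> rep_hom d ?T L" if "x \<in> set (?xs ?q)" for x
      using that Lab by auto
    fix F :: "'k rep_functor" assume F: "additive_polynomial_functor d F"
    note F' = additive_polynomial[OF F]
    let ?F = "\<lambda>f. fmor F ?T ?T (tensor_map d f)"
    have proj: "basis_projection ?q i \<in> svec_hom X X" for i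
      by (auto simp: svec_hom_def basis_projection_def)
    have trunc: "basis_truncation ?q k \<in> svec_hom X X" for k
      by (auto simp: svec_hom_def basis_truncation_def)
    note car = functor_carrier[OF F' tensor tensor tensor_map_rep_hom]
    have "mat_list_sum (fobj F ?T) (fobj F ?T) (map (\<lambda>(L, a, b). fmor F L ?T a * fmor F ?T L b) (?xs k))
        = ?F (basis_truncation ?q k)" if "k \<le> ?q" for k
      using that
    proof (induction k)
      \<comment> \<open>The value at the zero map is found by doubling. Linearity would not give it
        for \<open>d = 0\<close>, where the tensor power of the zero map is an identity
        matrix.\<close>
      case 0
      let ?z = "basis_truncation ?q 0 :: 'k mat"
      have "?z + ?z = ?z"
        by (rule eq_matI) (auto simp: basis_truncation_def)
      then have double: "?F ?z = ?F ?z + ?F ?z"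
        using additive_functor_add[OF F trunc[of 0] trunc[of 0]] by simp
      have "?F ?z $$ (i, j) = 0" if "i < fobj F ?T" "j < fobj F ?T" for i j
      proof -
        have "?F ?z $$ (i, j) = (?F ?z + ?F ?z) $$ (i, j)"
          by (rule arg_cong[OF double])
        also have "\<dots> = ?F ?z $$ (i, j) + ?F ?z $$ (i, j)"
          using that car[OF trunc[of 0]] by (intro index_add_mat(1)) auto
        finally show ?thesis
          by (simp only: add_cancel_right_right)
      qed
      then have "?F ?z = 0\<^sub>m (fobj F ?T) (fobj F ?T)"
        using car[OF trunc[of 0]] by (intro eq_matI) auto
      then show ?case
        by simp
    next
      case (Suc k)
      then have k: "k < ?q"
        by simp
      have "L k \<in> Bobj d"
        using Lab[OF k] \<L> by blast
      then have "fmor F (L k) ?T (a k) * fmor F ?T (L k) (b k) = ?F (basis_projection ?q k)"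
        using functor_mult[OF F' tensor _ tensor, of "L k" "b k" X "a k" X] Lab[OF k] by simp
      moreover have "basis_projection ?q k + basis_truncation ?q k = (basis_truncation ?q (Suc k) :: 'k mat)"
        by (rule eq_matI) (auto simp: basis_projection_def basis_truncation_def)
      then have "?F (basis_truncation ?q (Suc k)) = ?F (basis_projection ?q k) + ?F (basis_truncation ?q k)"
        using additive_functor_add[OF F proj[of k] trunc[of k]] by simp
      ultimately show ?case
        using Suc by simp
    qed
    from this[of ?q] have "mat_list_sum (fobj F ?T) (fobj F ?T) (map (\<lambda>(L, a, b). fmor F L ?T a * fmor F ?T L b) (?xs ?q))
        = ?F (basis_truncation ?q ?q)"
      by simp
    also have "basis_truncation ?q ?q = (1\<^sub>m ?q :: 'k mat)"
      by (rule eq_matI) (auto simp: basis_truncation_def)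
    also have "?F (1\<^sub>m ?q) = 1\<^sub>m (fobj F ?T)"
      using functor_one[OF F' tensor tensor, of X] by (simp add: tensor_map_one)
    finally show "mat_list_sum (fobj F ?T) (fobj F ?T) (map (\<lambda>(L, a, b). fmor F L ?T a * fmor F ?T L b) (?xs ?q))
        = 1\<^sub>m (fobj F ?T)" .
  qed
  then show ?thesis
    by blast
qed

section \<open>Direct sums of representations\<close>

text \<open>Here and in \<open>proj\<close>, \<open>p\<close> is the total dimension,
  \<open>n\<close> the size of the block and \<open>s\<close> its offset.\<close>

definition incl :: "nat \<Rightarrow> nat \<Rightarrow> nat \<Rightarrow> 'k::field mat" where
  "incl p n s = mat p n (\<lambda>(i, j). if i = s + j then 1 else 0)"

definition proj :: "nat \<Rightarrow> nat \<Rightarrow> nat \<Rightarrow> 'k::field mat" where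
  "proj p n s = mat n p (\<lambda>(i, j). if s + i = j then 1 else 0)"

lemma incl_carrier: "incl p n s \<in> carrier_mat p n" and proj_carrier: "proj p n s \<in> carrier_mat n p"
  by (simp_all add: incl_def proj_def)

lemma sum_mult_delta:
  fixes f :: "nat \<Rightarrow> 'k::field"
  shows "(\<Sum>k = 0..<p. f k * (if k = j then 1 else 0)) = (if j < p then f j else 0)"
  by (simp add: if_distrib[of "\<lambda>x. _ * x"] cong: if_cong)

lemma sum_mult_delta_shift:
  fixes f :: "nat \<Rightarrow> 'k::field"
  shows "(\<Sum>k = 0..<n. f k * (if s + k = j then 1 else 0)) = (if s \<le> j \<and> j < s + n then f (j - s) else 0)"
proof (cases "s \<le> j")
  case True
  then have "(s + k = j) = (k = j - s)" for k
    by auto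
  then show ?thesis
    using True by (simp add: sum_mult_delta less_diff_conv2 add.commute)
next
  case False
  then have "(s + k = j) = False" for k
    by auto
  then show ?thesis
    using False by simp
qed

lemma index_mult_mat_sum:
  fixes A :: "'k::field mat"
  assumes "A \<in> carrier_mat m n" "B \<in> carrier_mat n l" "i < m" "j < l"
  shows "(A * B) $$ (i, j) = (\<Sum>k = 0..<n. A $$ (i, k) * B $$ (k, j))"
  using assms by (simp add: scalar_prod_def)

lemma index_mult_incl:
  fixes X :: "'k::field mat"
  assumes "X \<in> carrier_mat l p" "i < l" "j < n" "s + n \<le> p"
  shows "(X * incl p n s) $$ (i, j) = X $$ (i, s + j)"
proof -
  have "(X * incl p n s) $$ (i, j) = (\<Sum>k = 0..<p. X $$ (i, k) * (if k = s + j then 1 else 0))"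
    unfolding index_mult_mat_sum[OF assms(1) incl_carrier assms(2,3)]
    by (rule sum.cong) (use assms in \<open>simp_all add: incl_def\<close>)
  then show ?thesis
    using assms by (simp add: sum_mult_delta)
qed

lemma index_mult_proj:
  fixes X :: "'k::field mat"
  assumes "X \<in> carrier_mat l n" "i < l" "j < p"
  shows "(X * proj p n s) $$ (i, j) = (if s \<le> j \<and> j < s + n then X $$ (i, j - s) else 0)"
proof -
  have "(X * proj p n s) $$ (i, j) = (\<Sum>k = 0..<n. X $$ (i, k) * (if s + k = j then 1 else 0))"
    unfolding index_mult_mat_sum[OF assms(1) proj_carrier assms(2,3)]
    by (rule sum.cong) (use assms in \<open>simp_all add: proj_def\<close>)
  then show ?thesis
    by (simp only: sum_mult_delta_shift)
qed

lemma index_proj_mult: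
  fixes X :: "'k::field mat"
  assumes "X \<in> carrier_mat p l" "i < n" "j < l" "s + n \<le> p"
  shows "(proj p n s * X) $$ (i, j) = X $$ (s + i, j)"
proof -
  have "(proj p n s * X) $$ (i, j) = (\<Sum>k = 0..<p. X $$ (k, j) * (if k = s + i then 1 else 0))"
    unfolding index_mult_mat_sum[OF proj_carrier assms(1-3)]
    by (rule sum.cong) (use assms in \<open>auto simp: proj_def\<close>)
  then show ?thesis
    using assms by (simp add: sum_mult_delta)
qed

lemma index_incl_mult:
  fixes X :: "'k::field mat"
  assumes "X \<in> carrier_mat n l" "i < p" "j < l"
  shows "(incl p n s * X) $$ (i, j) = (if s \<le> i \<and> i < s + n then X $$ (i - s, j) else 0)"
proof -
  have "(incl p n s * X) $$ (i, j) = (\<Sum>k = 0..<n. X $$ (k, j) * (if s + k = i then 1 else 0))"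
    unfolding index_mult_mat_sum[OF incl_carrier assms]
    by (rule sum.cong) (use assms in \<open>auto simp: incl_def\<close>)
  then show ?thesis
    by (simp only: sum_mult_delta_shift)
qed

lemma mat_eqI_carrier:
  assumes "X \<in> carrier_mat a b" "Y \<in> carrier_mat a b"
    and "\<And>i j. i < a \<Longrightarrow> j < b \<Longrightarrow> X $$ (i, j) = Y $$ (i, j)"
  shows "X = Y"
  using assms by (intro eq_matI) auto

lemma index_block_sum:
  assumes "A \<in> carrier_mat n n" "B \<in> carrier_mat m m" "i < n + m" "j < n + m"
  shows "block_sum A B $$ (i, j) = (if i < n then if j < n then A $$ (i, j) else 0
    else if j < n then 0 else B $$ (i - n, j - n))"
  using assms by (simp add: block_sum_def)

lemma
  fixes A B :: "'k::field mat"
  assumes A: "A \<in> carrier_mat n n" and B: "B \<in> carrier_mat m m"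
  shows incl_mult_left: "incl (n + m) n 0 * A = block_sum A B * incl (n + m) n 0"
    and incl_mult_right: "incl (n + m) m n * B = block_sum A B * incl (n + m) m n"
    and proj_mult_left: "proj (n + m) n 0 * block_sum A B = A * proj (n + m) n 0"
    and proj_mult_right: "proj (n + m) m n * block_sum A B = B * proj (n + m) m n"
proof -
  note AB = block_sum_carrier[OF A B]
  show "incl (n + m) n 0 * A = block_sum A B * incl (n + m) n 0"
    by (rule mat_eqI_carrier[OF mult_carrier_mat[OF incl_carrier A] mult_carrier_mat[OF AB incl_carrier]])
      (simp add: index_mult_incl[OF AB] index_incl_mult[OF A] index_block_sum[OF A B])
  show "incl (n + m) m n * B = block_sum A B * incl (n + m) m n"
    by (rule mat_eqI_carrier[OF mult_carrier_mat[OF incl_carrier B] mult_carrier_mat[OF AB incl_carrier]])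
      (simp add: index_mult_incl[OF AB] index_incl_mult[OF B] index_block_sum[OF A B])
  show "proj (n + m) n 0 * block_sum A B = A * proj (n + m) n 0"
    by (rule mat_eqI_carrier[OF mult_carrier_mat[OF proj_carrier AB] mult_carrier_mat[OF A proj_carrier]])
      (simp add: index_proj_mult[OF AB] index_mult_proj[OF A] index_block_sum[OF A B])
  show "proj (n + m) m n * block_sum A B = B * proj (n + m) m n"
    by (rule mat_eqI_carrier[OF mult_carrier_mat[OF proj_carrier AB] mult_carrier_mat[OF B proj_carrier]])
      (simp add: index_proj_mult[OF AB] index_mult_proj[OF B] index_block_sum[OF A B])
qed

lemma proj_incl: "proj (n + m) n 0 * incl (n + m) n 0 = (1\<^sub>m n :: 'k::field mat)"
  by (rule mat_eqI_carrier[OF mult_carrier_mat[OF proj_carrier incl_carrier] one_carrier_mat])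
    (simp add: index_proj_mult[OF incl_carrier], simp add: incl_def)

lemma incl_proj_sum:
  "incl (n + m) n 0 * proj (n + m) n 0 + incl (n + m) m n * proj (n + m) m n = (1\<^sub>m (n + m) :: 'k::field mat)"
    (is "?A + ?B = _")
proof (rule mat_eqI_carrier)
  have B: "?B \<in> carrier_mat (n + m) (n + m)"
    by (rule mult_carrier_mat[OF incl_carrier proj_carrier])
  then show "?A + ?B \<in> carrier_mat (n + m) (n + m)"
    by (rule add_carrier_mat)
  fix i j assume ij: "i < n + m" "j < n + m"
  have "(?A + ?B) $$ (i, j) = ?A $$ (i, j) + ?B $$ (i, j)"
    using ij carrier_matD[OF B] by (intro index_add_mat(1)) simp_all
  also have "\<dots> = (if i < n then proj (n + m) n 0 $$ (i, j) else proj (n + m) m n $$ (i - n, j))"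
    using ij by (simp add: index_incl_mult[OF proj_carrier])
  also have "\<dots> = 1\<^sub>m (n + m) $$ (i, j)"
    using ij by (auto simp: proj_def)
  finally show "(?A + ?B) $$ (i, j) = (1\<^sub>m (n + m) :: 'k mat) $$ (i, j)" .
qed simp

lemma rdim_rep_sum_Cons: "rdim (rep_sum (S # Ss)) = rdim S + rdim (rep_sum Ss)"
  by (simp add: rep_sum_def)

lemma ract_rep_sum_Cons: "ract (rep_sum (S # Ss)) \<sigma> = block_sum (ract S \<sigma>) (ract (rep_sum Ss) \<sigma>)"
  by (simp add: rep_sum_def diag_block_mat_Cons del: diag_block_mat.simps)

lemma is_rep_rep_sum:
  assumes "\<And>S. S \<in> set Ss \<Longrightarrow> is_rep d S"
  shows "is_rep d (rep_sum Ss :: 'k::field rep)"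
  using assms
proof (induction Ss)
  case Nil
  show ?case
    by (auto simp: is_rep_def rep_sum_def intro!: eq_matI)
next
  case (Cons S Ss)
  have S: "is_rep d S" and R: "is_rep d (rep_sum Ss)"
    using Cons by auto
  show ?case
    unfolding is_rep_def rdim_rep_sum_Cons ract_rep_sum_Cons
  proof (intro conjI allI impI)
    fix \<sigma> assume \<sigma>: "\<sigma> permutes {..<d}"
    show "block_sum (ract S \<sigma>) (ract (rep_sum Ss) \<sigma>)
        \<in> carrier_mat (rdim S + rdim (rep_sum Ss)) (rdim S + rdim (rep_sum Ss))"
      by (rule block_sum_carrier[OF ract_carrier[OF S \<sigma>] ract_carrier[OF R \<sigma>]])
    fix \<tau> assume \<tau>: "\<tau> permutes {..<d}"
    have "ract S (\<sigma> \<circ> \<tau>) = ract S \<sigma> * ract S \<tau>"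
      "ract (rep_sum Ss) (\<sigma> \<circ> \<tau>) = ract (rep_sum Ss) \<sigma> * ract (rep_sum Ss) \<tau>"
      using S R \<sigma> \<tau> unfolding is_rep_def by blast+
    then show "block_sum (ract S (\<sigma> \<circ> \<tau>)) (ract (rep_sum Ss) (\<sigma> \<circ> \<tau>))
        = block_sum (ract S \<sigma>) (ract (rep_sum Ss) \<sigma>) * block_sum (ract S \<tau>) (ract (rep_sum Ss) \<tau>)"
      using block_sum_mult[OF ract_carrier[OF S \<sigma>] ract_carrier[OF R \<sigma>] ract_carrier[OF S \<tau>] ract_carrier[OF R \<tau>]]
      by simp
  next
    have "ract S id = 1\<^sub>m (rdim S)" "ract (rep_sum Ss) id = 1\<^sub>m (rdim (rep_sum Ss))"
      using S R unfolding is_rep_def by blast+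
    then show "block_sum (ract S id) (ract (rep_sum Ss) id) = 1\<^sub>m (rdim S + rdim (rep_sum Ss))"
      by (simp add: block_sum_one)
  qed
qed

lemma
  fixes S :: "'k::field rep"
  assumes S: "is_rep d S" and R: "is_rep d (rep_sum Ss)"
  defines "n \<equiv> rdim S" and "m \<equiv> rdim (rep_sum Ss)"
  shows incl_left_hom: "incl (n + m) n 0 \<in> rep_hom d S (rep_sum (S # Ss))"
    and incl_right_hom: "incl (n + m) m n \<in> rep_hom d (rep_sum Ss) (rep_sum (S # Ss))"
    and proj_left_hom: "proj (n + m) n 0 \<in> rep_hom d (rep_sum (S # Ss)) S"
    and proj_right_hom: "proj (n + m) m n \<in> rep_hom d (rep_sum (S # Ss)) (rep_sum Ss)"
  unfolding rep_hom_def rdim_rep_sum_Cons ract_rep_sum_Cons n_def m_def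
  using incl_mult_left[OF ract_carrier[OF S] ract_carrier[OF R]]
    incl_mult_right[OF ract_carrier[OF S] ract_carrier[OF R]]
    proj_mult_left[OF ract_carrier[OF S] ract_carrier[OF R]]
    proj_mult_right[OF ract_carrier[OF S] ract_carrier[OF R]]
  by (simp_all add: incl_carrier proj_carrier)

section \<open>Isomorphisms and summands\<close>

text \<open>The component \<open>ract\<close> has arbitrary values off the permutations of
  \<open>{..<d}\<close>, so representations with the same action may be different records; the
  identity matrix connects them.\<close>

lemma one_hom_eq:
  fixes M N :: "'k::field rep"
  assumes M: "is_rep d M" and dim: "rdim M = rdim N"
    and act: "\<And>\<sigma>. \<sigma> permutes {..<d} \<Longrightarrow> ract M \<sigma> = ract N \<sigma>"
  shows "1\<^sub>m (rdim N) \<in> rep_hom d M N" "1\<^sub>m (rdim N) \<in> rep_hom d N M"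
proof -
  have "1\<^sub>m (rdim N) * ract M \<sigma> = ract M \<sigma> * 1\<^sub>m (rdim N)" if "\<sigma> permutes {..<d}" for \<sigma>
    using ract_carrier[OF M that] unfolding dim by (simp add: left_mult_one_mat right_mult_one_mat)
  then show "1\<^sub>m (rdim N) \<in> rep_hom d M N" "1\<^sub>m (rdim N) \<in> rep_hom d N M"
    by (simp_all add: rep_hom_def dim act)
qed

lemma rep_iso_eq:
  fixes M N :: "'k::field rep"
  assumes "is_rep d M" "rdim M = rdim N" "\<And>\<sigma>. \<sigma> permutes {..<d} \<Longrightarrow> ract M \<sigma> = ract N \<sigma>"
  shows "rep_iso d M N"
  unfolding rep_iso_def
proof
  show "1\<^sub>m (rdim N) \<in> rep_hom d M N"
    by (rule one_hom_eq(1)[OF assms])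
  show "invertible_mat (1\<^sub>m (rdim N) :: 'k mat)"
    by (rule invertible_matI[OF one_carrier_mat one_carrier_mat]) simp_all
qed

lemma block_sum_empty: "A \<in> carrier_mat m n \<Longrightarrow> block_sum A (0\<^sub>m 0 0) = A"
  by (rule eq_matI) (auto simp: block_sum_def)

text \<open>The inverse matrix is equivariant as well: insert \<open>f * g\<close> and move the
  group element through \<open>f\<close>.\<close>

lemma rep_isoE:
  fixes M N :: "'k::field rep"
  assumes M: "is_rep d M" and N: "is_rep d N" and iso: "rep_iso d M N"
  obtains f g where "f \<in> rep_hom d M N" "g \<in> rep_hom d N M" "f * g = 1\<^sub>m (rdim N)" "g * f = 1\<^sub>m (rdim M)"
proof -
  obtain f where f: "f \<in> rep_hom d M N" "invertible_mat f"
    using iso by (auto simp: rep_iso_def)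
  obtain g where dim: "rdim N = rdim M" and g: "g \<in> carrier_mat (rdim M) (rdim M)"
    and fg: "f * g = 1\<^sub>m (rdim M)" "g * f = 1\<^sub>m (rdim M)"
    using invertible_matE[OF rep_hom_carrier[OF f(1)] f(2)] by metis
  have fc: "f \<in> carrier_mat (rdim M) (rdim M)"
    using rep_hom_carrier[OF f(1)] dim by simp
  have "g * ract N \<sigma> = ract M \<sigma> * g" if \<sigma>: "\<sigma> permutes {..<d}" for \<sigma>
  proof -
    note Mc = ract_carrier[OF M \<sigma>] and Nc = ract_carrier[OF N \<sigma>, unfolded dim]
    have "g * ract N \<sigma> = g * ract N \<sigma> * (f * g)"
      unfolding fg by (rule right_mult_one_mat[OF mult_carrier_mat[OF g Nc], symmetric])
    also have "\<dots> = g * (ract N \<sigma> * f) * g"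
      by (rule assoc_mult_mat_middle[OF g Nc fc g])
    also have "ract N \<sigma> * f = f * ract M \<sigma>"
      using f(1) \<sigma> by (simp add: rep_hom_def)
    also have "g * (f * ract M \<sigma>) * g = g * f * (ract M \<sigma> * g)"
      by (rule assoc_mult_mat_middle[OF g fc Mc g, symmetric])
    also have "\<dots> = ract M \<sigma> * g"
      unfolding fg by (rule left_mult_one_mat[OF mult_carrier_mat[OF Mc g]])
    finally show ?thesis .
  qed
  then have "g \<in> rep_hom d N M"
    using g dim by (simp add: rep_hom_def)
  then show thesis
    using that[OF f(1)] fg dim by simp
qed

lemma rep_summand_retract:
  fixes S T :: "'k::field rep"
  assumes S: "rep_summand d S T" and T: "is_rep d T"
  shows "\<exists>\<alpha> \<in> rep_hom d T S. \<exists>\<beta> \<in> rep_hom d S T. \<alpha> * \<beta> = 1\<^sub>m (rdim S)"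
proof -
  obtain S' where S': "is_rep d S" "is_rep d S'" "rep_iso d (rep_sum [S, S']) T"
    using S by (auto simp: rep_summand_def)
  have R: "is_rep d (rep_sum [S'])" and sum: "is_rep d (rep_sum [S, S'])"
    using S' by (auto intro!: is_rep_rep_sum)
  let ?i = "incl (rdim S + rdim (rep_sum [S'])) (rdim S) 0 :: 'k mat"
  let ?p = "proj (rdim S + rdim (rep_sum [S'])) (rdim S) 0 :: 'k mat"
  note i = incl_left_hom[OF S'(1) R] and p = proj_left_hom[OF S'(1) R]
  obtain f g where fg: "f \<in> rep_hom d (rep_sum [S, S']) T" "g \<in> rep_hom d T (rep_sum [S, S'])"
    "g * f = 1\<^sub>m (rdim (rep_sum [S, S']))"
    using rep_isoE[OF sum T S'(3)] by metis
  have "?p * g * (f * ?i) = ?p * (g * f) * ?i"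
    by (rule assoc_mult_mat_middle[OF rep_hom_carrier[OF p] rep_hom_carrier[OF fg(2)]
          rep_hom_carrier[OF fg(1)] rep_hom_carrier[OF i]])
  also have "\<dots> = 1\<^sub>m (rdim S)"
    unfolding fg(3) one_hom_mult[OF p] by (rule proj_incl)
  finally show ?thesis
    using rep_hom_mult[OF T sum S'(1) fg(2) p] rep_hom_mult[OF S'(1) sum T i fg(1)] by blast
qed

lemma rep_summand_self:
  fixes T :: "'k::field rep"
  assumes S: "is_rep d S" and dim: "rdim S = rdim T" and act: "\<And>\<sigma>. \<sigma> permutes {..<d} \<Longrightarrow> ract S \<sigma> = ract T \<sigma>"
  shows "rep_summand d S T"
proof -
  \<comment> \<open>The complement is the zero representation.\<close>
  define Z :: "'k rep" where "Z = \<lparr>rdim = 0, ract = \<lambda>_. 0\<^sub>m 0 0\<rparr>"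
  have Z: "is_rep d Z"
    by (auto simp: is_rep_def Z_def intro!: eq_matI)
  have "is_rep d (rep_sum [S, Z])"
    using S Z by (auto intro!: is_rep_rep_sum)
  moreover have "rdim (rep_sum [S, Z]) = rdim T"
    by (simp add: rep_sum_def Z_def dim)
  moreover have "ract (rep_sum [S, Z]) \<sigma> = ract T \<sigma>" if \<sigma>: "\<sigma> permutes {..<d}" for \<sigma>
  proof -
    have "ract (rep_sum [Z]) \<sigma> = 0\<^sub>m 0 0"
      by (simp add: rep_sum_def Z_def)
    then show ?thesis
      unfolding ract_rep_sum_Cons[of S] using block_sum_empty[OF ract_carrier[OF S \<sigma>]] act[OF \<sigma>] by simp
  qed
  ultimately have "rep_iso d (rep_sum [S, Z]) T"
    by (rule rep_iso_eq)
  then show ?thesis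
    using S Z by (auto simp: rep_summand_def)
qed

lemma summand_tensor_Bobj:
  assumes "rep_summand d S (tensor_rep d X)"
  shows "S \<in> Bobj d"
proof -
  have S: "is_rep d S"
    using assms by (simp add: rep_summand_def)
  have "rep_iso d S (rep_sum [S])"
    by (rule rep_iso_eq[OF S]) (simp_all add: rep_sum_def del: diag_block_mat.simps)
  moreover have "\<exists>X. rep_summand d S' (tensor_rep d X)" if "S' \<in> set [S]" for S'
  proof -
    have "S' = S"
      using that by simp
    then show ?thesis
      using assms by blast
  qed
  ultimately show ?thesis
    using S unfolding Bobj_def by blast
qed

lemma tensor_rep_Bobj: "tensor_rep d X \<in> (Bobj d :: 'k::field rep set)"
  by (rule summand_tensor_Bobj[of _ _ X], rule rep_summand_self) (simp_all add: is_rep_tensor_rep)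

text \<open>Membership in \<open>Bobj d\<close> is established along the way because functors are
  controlled only there, and each step forms the binary sum of one summand with the remaining
  ones.\<close>

lemma splits_rep_sum:
  fixes \<L> :: "'k::field rep set"
  assumes \<L>: "\<L> \<subseteq> Bobj d" and tensor: "\<And>X. \<exists>xs. splits d \<L> (tensor_rep d X) xs"
    and Ss: "\<And>S. S \<in> set Ss \<Longrightarrow> \<exists>X. rep_summand d S (tensor_rep d X)"
  shows "rep_sum Ss \<in> Bobj d \<and> (\<exists>xs. splits d \<L> (rep_sum Ss) xs)"
  using Ss
proof (induction Ss)
  case Nil
  have rep: "is_rep d (rep_sum [] :: 'k rep)"
    by (rule is_rep_rep_sum) simp
  have "rep_iso d (rep_sum []) (rep_sum [] :: 'k rep)"
    by (rule rep_iso_eq[OF rep]) simp_all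
  then have obj: "rep_sum [] \<in> (Bobj d :: 'k rep set)"
    using rep unfolding Bobj_def by (auto intro!: exI[of _ "[]"])
  have "splits d \<L> (rep_sum []) []"
    unfolding splits_def
  proof (intro conjI allI impI)
    fix F :: "'k rep_functor" assume "additive_polynomial_functor d F"
    then have F: "polynomial_functor d F"
      by (rule additive_polynomial)
    \<comment> \<open>On the zero representation the identity is the zero map. Hence the identity of
      the value is zero too, which is the empty sum.\<close>
    have "rdim (rep_sum [] :: 'k rep) = 0"
      by (simp add: rep_sum_def)
    then have "1\<^sub>m (rdim (rep_sum [] :: 'k rep)) = (0\<^sub>m (rdim (rep_sum [] :: 'k rep)) (rdim (rep_sum [] :: 'k rep)) :: 'k mat)"
      by (intro eq_matI) auto
    then show "mat_list_sum (fobj F (rep_sum [])) (fobj F (rep_sum [])) (map (\<lambda>(L, a, b). fmor F L (rep_sum []) a * fmor F (rep_sum []) L b) [])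
        = 1\<^sub>m (fobj F (rep_sum []))"
      using functor_zero[OF F obj obj] functor_one[OF F obj obj] by simp
  qed simp
  then show ?case
    using obj by blast
next
  case (Cons S Ss)
  have "\<exists>X. rep_summand d S (tensor_rep d X)"
    by (rule Cons.prems) simp
  then obtain X where X: "rep_summand d S (tensor_rep d X)"
    by blast
  have R: "rep_sum Ss \<in> Bobj d" and "\<exists>ys. splits d \<L> (rep_sum Ss) ys"
    using Cons by auto
  then obtain ys where ys: "splits d \<L> (rep_sum Ss) ys"
    by blast
  have S: "S \<in> Bobj d"
    by (rule summand_tensor_Bobj[OF X])
  note rep = Bobj_is_rep[OF S] Bobj_is_rep[OF R]
  have all: "is_rep d S'" if "S' \<in> set (S # Ss)" for S'
    using Cons.prems[OF that] by (auto simp: rep_summand_def)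
  have sum: "is_rep d (rep_sum (S # Ss))"
    by (rule is_rep_rep_sum[OF all])
  have "rep_iso d (rep_sum (S # Ss)) (rep_sum (S # Ss))"
    by (rule rep_iso_eq[OF sum]) simp_all
  then have obj: "rep_sum (S # Ss) \<in> Bobj d"
    using sum Cons.prems unfolding Bobj_def by blast
  obtain \<alpha> \<beta> where \<alpha>\<beta>: "\<alpha> \<in> rep_hom d (tensor_rep d X) S" "\<beta> \<in> rep_hom d S (tensor_rep d X)" "\<alpha> * \<beta> = 1\<^sub>m (rdim S)"
    using rep_summand_retract[OF X is_rep_tensor_rep] by blast
  obtain zs where zs: "splits d \<L> (tensor_rep d X) zs"
    using tensor by blast
  have xs: "splits d \<L> S (through \<alpha> \<beta> zs)"
    by (rule splits_retract[OF \<L> tensor_rep_Bobj S zs \<alpha>\<beta>])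
  from splits_biproduct[OF \<L> obj S R xs ys incl_left_hom[OF rep] incl_right_hom[OF rep]
      proj_left_hom[OF rep] proj_right_hom[OF rep], unfolded rdim_rep_sum_Cons, OF incl_proj_sum]
  show ?case
    using obj by blast
qed

lemma splits_Bobj:
  fixes \<L> :: "'k::field rep set"
  assumes \<L>: "\<L> \<subseteq> Bobj d" and tensor: "\<And>X. \<exists>xs. splits d \<L> (tensor_rep d X) xs" and M: "M \<in> Bobj d"
  shows "\<exists>xs. splits d \<L> M xs"
proof -
  obtain Ss where Ss: "\<And>S. S \<in> set Ss \<Longrightarrow> \<exists>X. rep_summand d S (tensor_rep d X)" and iso: "rep_iso d M (rep_sum Ss)"
    using M by (auto simp: Bobj_def)
  obtain xs where R: "rep_sum Ss \<in> Bobj d" and xs: "splits d \<L> (rep_sum Ss) xs"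
    using splits_rep_sum[OF \<L> tensor Ss] by blast
  obtain f g where "f \<in> rep_hom d M (rep_sum Ss)" "g \<in> rep_hom d (rep_sum Ss) M" "g * f = 1\<^sub>m (rdim M)"
    using rep_isoE[OF Bobj_is_rep[OF M] Bobj_is_rep[OF R] iso] by metis
  then show ?thesis
    using splits_retract[OF \<L> R M xs] by blast
qed

section \<open>The trivial and the sign representation\<close>

text \<open>Over a one-letter alphabet the only code is 0, so a permutation acts by its Koszul sign,
  with no position odd or with all of them odd.\<close>

lemma ract_tensor_rep_lines:
  assumes \<sigma>: "\<sigma> permutes {..<d}"
  shows "ract (tensor_rep d (1, 0)) \<sigma> = ract (triv_rep :: 'k::field rep) \<sigma>"
    and "ract (tensor_rep d (0, 1)) \<sigma> = ract (sign_rep :: 'k rep) \<sigma>"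
proof -
  have q: "sdim (1, 0) = 1" "sdim (0, 1) = 1"
    by (simp_all add: sdim_def)
  have w: "word_perm (Suc 0) d \<sigma> 0 = 0"
    using word_perm_less[OF \<sigma>, of 0 "Suc 0"] by simp
  have odd: "odd_index (Suc 0, 0) 0 = False" "odd_index (0, Suc 0) 0 = True"
    by (simp_all add: odd_index_def)
  have even_sign: "koszul_sign d \<sigma> (\<lambda>_. False) = (1 :: 'k)"
    by (simp add: koszul_sign_def)
  show "ract (tensor_rep d (1, 0)) \<sigma> = ract (triv_rep :: 'k rep) \<sigma>"
    unfolding ract_tensor_rep[OF \<sigma>] q
    by (rule eq_matI) (simp_all add: triv_rep_def w letter_1 odd even_sign)
  show "ract (tensor_rep d (0, 1)) \<sigma> = ract (sign_rep :: 'k rep) \<sigma>"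
    unfolding ract_tensor_rep[OF \<sigma>] q
    by (rule eq_matI) (simp_all add: sign_rep_def w letter_1 odd koszul_sign_eq_sign[OF \<sigma>])
qed

lemma rdim_lines: "rdim (triv_rep :: 'k::field rep) = 1" "rdim (sign_rep :: 'k rep) = 1"
  by (simp_all add: triv_rep_def sign_rep_def)

lemma rdim_tensor_lines:
  "rdim (tensor_rep d (1, 0) :: 'k::field rep) = 1" "rdim (tensor_rep d (0, 1) :: 'k rep) = 1"
  by (simp_all add: sdim_def)

lemma is_rep_cong:
  assumes "is_rep d M" "rdim N = rdim M" "\<And>\<sigma>. \<sigma> permutes {..<d} \<Longrightarrow> ract N \<sigma> = ract M \<sigma>"
  shows "is_rep d N"
  using assms unfolding is_rep_def by (metis permutes_compose permutes_id)

lemma is_rep_lines: "is_rep d (triv_rep :: 'k::field rep)" "is_rep d (sign_rep :: 'k rep)"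
proof -
  show "is_rep d (triv_rep :: 'k rep)"
    by (rule is_rep_cong[OF is_rep_tensor_rep[of d "(1, 0)"]])
      (simp_all only: rdim_lines rdim_tensor_lines ract_tensor_rep_lines)
  show "is_rep d (sign_rep :: 'k rep)"
    by (rule is_rep_cong[OF is_rep_tensor_rep[of d "(0, 1)"]])
      (simp_all only: rdim_lines rdim_tensor_lines ract_tensor_rep_lines)
qed

lemma lines_Bobj: "triv_rep \<in> (Bobj d :: 'k::field rep set)" "sign_rep \<in> (Bobj d :: 'k rep set)"
proof -
  show "triv_rep \<in> (Bobj d :: 'k rep set)"
    by (rule summand_tensor_Bobj[of _ _ "(1, 0)"], rule rep_summand_self[OF is_rep_lines(1)])
      (simp_all only: rdim_lines rdim_tensor_lines ract_tensor_rep_lines)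
  show "sign_rep \<in> (Bobj d :: 'k rep set)"
    by (rule summand_tensor_Bobj[of _ _ "(0, 1)"], rule rep_summand_self[OF is_rep_lines(2)])
      (simp_all only: rdim_lines rdim_tensor_lines ract_tensor_rep_lines)
qed

text \<open>The transposition of 0 and 1, available because \<open>1 < d\<close>, acts by 1 on one
  line and by -1 on the other, so that \<open>f\<close> equals its negative.\<close>

lemma triv_sign_hom_zero:
  assumes d: "1 < d" and two: "(2 :: 'k::field) \<noteq> 0"
  shows "rep_hom d triv_rep (sign_rep :: 'k rep) \<subseteq> {0\<^sub>m 1 1}" "rep_hom d sign_rep (triv_rep :: 'k rep) \<subseteq> {0\<^sub>m 1 1}"
proof -
  let ?\<sigma> = "Transposition.transpose (0 :: nat) 1"
  have \<sigma>: "?\<sigma> permutes {..<d}"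
    using d by (intro permutes_swap_id) auto
  have act: "ract (triv_rep :: 'k rep) ?\<sigma> = 1\<^sub>m 1" "ract (sign_rep :: 'k rep) ?\<sigma> = (- 1) \<cdot>\<^sub>m 1\<^sub>m 1"
    by (simp_all add: triv_rep_def sign_rep_def sign_swap_id)
  have zero: "f = 0\<^sub>m 1 1" if f: "f \<in> carrier_mat 1 1" and eq: "f = (- 1) \<cdot>\<^sub>m f" for f :: "'k mat"
  proof (rule mat_1_1_eqI[OF f zero_carrier_mat])
    have "f $$ (0, 0) = ((- 1) \<cdot>\<^sub>m f) $$ (0, 0)"
      by (rule arg_cong[OF eq])
    also have "\<dots> = - f $$ (0, 0)"
      using f by simp
    finally have "2 * f $$ (0, 0) = 0"
      by (simp only: mult_2 eq_neg_iff_add_eq_0)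
    then show "f $$ (0, 0) = 0\<^sub>m 1 1 $$ (0, 0)"
      using two by simp
  qed
  show "rep_hom d triv_rep (sign_rep :: 'k rep) \<subseteq> {0\<^sub>m 1 1}"
  proof
    fix f assume f: "f \<in> rep_hom d triv_rep (sign_rep :: 'k rep)"
    then have fc: "f \<in> carrier_mat 1 1"
      using rep_hom_carrier[OF f] by (simp add: rdim_lines)
    have "f * ract triv_rep ?\<sigma> = ract sign_rep ?\<sigma> * f"
      using f \<sigma> by (simp add: rep_hom_def)
    then have "f = (- 1) \<cdot>\<^sub>m f"
      unfolding act mult_smult_assoc_mat[OF one_carrier_mat fc] left_mult_one_mat[OF fc] right_mult_one_mat[OF fc] .
    then show "f \<in> {0\<^sub>m 1 1}"
      using zero[OF fc] by blast
  qed
  show "rep_hom d sign_rep (triv_rep :: 'k rep) \<subseteq> {0\<^sub>m 1 1}"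
  proof
    fix f assume f: "f \<in> rep_hom d sign_rep (triv_rep :: 'k rep)"
    then have fc: "f \<in> carrier_mat 1 1"
      using rep_hom_carrier[OF f] by (simp add: rdim_lines)
    have "f * ract sign_rep ?\<sigma> = ract triv_rep ?\<sigma> * f"
      using f \<sigma> by (simp add: rep_hom_def)
    then have "f = (- 1) \<cdot>\<^sub>m f"
      unfolding act mult_smult_distrib[OF fc one_carrier_mat] left_mult_one_mat[OF fc] right_mult_one_mat[OF fc]
      by (rule sym)
    then show "f \<in> {0\<^sub>m 1 1}"
      using zero[OF fc] by blast
  qed
qed

text \<open>In degree 1 the two lines coincide, and only one of them may be used.\<close>

definition line_reps :: "nat \<Rightarrow> 'k::field rep set" where
  "line_reps d = (if d = 1 then {triv_rep} else {triv_rep, sign_rep})"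

lemma splits_line_reps:
  fixes M :: "'k::field rep"
  assumes "M \<in> Bobj d"
  shows "\<exists>xs. splits d (line_reps d) M xs"
proof -
  have lines: "(line_reps d :: 'k rep set) \<subseteq> Bobj d"
    by (simp add: line_reps_def lines_Bobj)
  have "\<exists>L \<in> (line_reps d :: 'k rep set). \<exists>f \<in> rep_hom d L (tensor_rep d X). \<exists>g \<in> rep_hom d (tensor_rep d X) L.
      f * g = 1\<^sub>m (rdim (tensor_rep d X :: 'k rep))"
    if X: "X = (1, 0) \<or> X = (0, 1)" for X
  proof -
    \<comment> \<open>In degree 1 the group is trivial, and the trivial representation also serves
      the odd line.\<close>
    define L :: "'k rep" where "L = (if X = (1, 0) \<or> d = 1 then triv_rep else sign_rep)"
    have L: "L \<in> line_reps d" "is_rep d L"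
      by (simp_all add: L_def line_reps_def is_rep_lines)
    have dim: "rdim L = rdim (tensor_rep d X :: 'k rep)"
      using X by (auto simp: L_def rdim_lines sdim_def)
    have act: "ract L \<sigma> = ract (tensor_rep d X) \<sigma>" if \<sigma>: "\<sigma> permutes {..<d}" for \<sigma>
    proof (cases "X = (1, 0)")
      case True
      then show ?thesis
        by (simp only: L_def ract_tensor_rep_lines[OF \<sigma>] simp_thms if_True)
    next
      case False
      then have X': "X = (0, 1)"
        using X by blast
      have "ract triv_rep \<sigma> = ract (sign_rep :: 'k rep) \<sigma>" if "d = 1"
      proof -
        have "\<sigma> = id"
          using \<sigma> that by (simp add: lessThan_Suc)
        then show ?thesis
          by (simp add: triv_rep_def sign_rep_def) (auto intro!: eq_matI)
      qed
      then show ?thesis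
        unfolding X' ract_tensor_rep_lines(2)[OF \<sigma>] L_def by auto
    qed
    let ?I = "1\<^sub>m (rdim (tensor_rep d X :: 'k rep)) :: 'k mat"
    have "?I * ?I = ?I"
      by simp
    then show ?thesis
      using one_hom_eq(1)[OF L(2) dim act] one_hom_eq(2)[OF L(2) dim act] L(1) by blast
  qed
  then have "\<exists>xs. splits d (line_reps d) (tensor_rep d X :: 'k rep) xs" for X
    by (rule splits_tensor_rep[OF tensor_rep_Bobj lines])
  then show ?thesis
    by (rule splits_Bobj[OF lines _ assms])
qed

text \<open>The action on End(L) is determined by the dimension of the value at \<open>L\<close>.
  Two functors with equal dimensions there agree as matrices, as the comparison through lines
  demands.\<close>

lemma functor_line_endo:
  assumes F: "polynomial_functor d F" and L: "L \<in> Bobj d" "rdim L = 1" and h: "h \<in> rep_hom d L L"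
  shows "fmor F L L h = h $$ (0, 0) \<cdot>\<^sub>m 1\<^sub>m (fobj F L)"
proof -
  have "fmor F L L h = fmor F L L (h $$ (0, 0) \<cdot>\<^sub>m 1\<^sub>m (rdim L))"
    using rep_hom_line_endo[OF L(2) L(2) h] by simp
  also have "\<dots> = h $$ (0, 0) \<cdot>\<^sub>m fmor F L L (1\<^sub>m (rdim L))"
    by (rule functor_smult[OF F L(1) L(1) rep_hom_one[OF Bobj_is_rep[OF L(1)]]])
  also have "fmor F L L (1\<^sub>m (rdim L)) = 1\<^sub>m (fobj F L)"
    by (rule functor_one[OF F L(1) L(1)])
  finally show ?thesis .
qed

lemma fobj_functor_sum_replicate:
  "fobj (functor_sum (replicate m F @ replicate n G)) M = m * fobj F M + n * fobj G M"
  by (simp add: functor_sum_def sum_list_replicate)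

theorem corollary3p15:
  fixes p j :: nat
  assumes "CHAR('k::alg_closed_field) = p" and "p > 2"
  shows "(\<forall>F :: 'k rep_functor. polynomial_functor (p ^ j) F \<longrightarrow>
            (additive_polynomial_functor (p ^ j) F \<longleftrightarrow>
             (\<exists>Fs. set Fs \<subseteq> {Fr_plus p j, Fr_minus p j} \<and>
                   functor_iso (p ^ j) F (functor_sum Fs)))) \<and>
         (\<forall>Fs :: 'k rep_functor list. set Fs \<subseteq> {Fr_plus p j, Fr_minus p j} \<longrightarrow>
            additive_polynomial_functor (p ^ j) (functor_sum Fs))"
proof -
  let ?d = "p ^ j"
  have p: "prime p"
    using assms prime_CHAR_semidom[where 'a = 'k] by simp
  have two: "(2 :: 'k) \<noteq> 0"
  proof
    assume "(2 :: 'k) = 0"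
    then have "of_nat 2 = (0 :: 'k)"
      by simp
    then have "p dvd 2"
      unfolding of_nat_eq_0_iff_char_dvd assms(1) .
    then show False
      using assms(2) by (auto dest: dvd_imp_le)
  qed
  have d: "1 < ?d" if "?d \<noteq> 1"
    using that assms(2) one_less_power[of p j] by (cases "j = 0") auto
  note triv = lines_Bobj(1)[where 'k = 'k, of ?d] rdim_lines(1)[where 'k = 'k]
    and sign = lines_Bobj(2)[where 'k = 'k, of ?d] rdim_lines(2)[where 'k = 'k]
  have Fr_additive: "additive_polynomial_functor ?d (Fr_plus p j :: 'k rep_functor)"
    "additive_polynomial_functor ?d (Fr_minus p j :: 'k rep_functor)"
    unfolding Fr_plus_def Fr_minus_def
    by (rule additive_simple_top[OF triv p assms(1) refl tensor_rep_Bobj],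
        rule additive_simple_top[OF sign p assms(1) refl tensor_rep_Bobj])
  have sum_additive: "additive_polynomial_functor ?d (functor_sum Fs)"
    if "set Fs \<subseteq> {Fr_plus p j, Fr_minus p j}" for Fs :: "'k rep_functor list"
    using that Fr_additive by (intro additive_functor_sum[OF tensor_rep_Bobj]) blast
  have "\<exists>Fs. set Fs \<subseteq> {Fr_plus p j, Fr_minus p j} \<and> functor_iso ?d F (functor_sum Fs)"
    if F: "additive_polynomial_functor ?d F" for F :: "'k rep_functor"
  proof -
    note F' = additive_polynomial[OF F]
    \<comment> \<open>Evaluation at the lines forces these multiplicities: each simple functor has
      dimension 1 at its own line and, if \<open>?d \<noteq> 1\<close>, dimension 0 at the other. In
      degree 1 copies of \<open>Fr_plus\<close> alone are taken.\<close>
    define Fs :: "'k rep_functor list" where "Fs = replicate (fobj F triv_rep) (Fr_plus p j)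
      @ replicate (if ?d = 1 then 0 else fobj F sign_rep) (Fr_minus p j)"
    have Fs: "set Fs \<subseteq> {Fr_plus p j, Fr_minus p j}"
      by (auto simp: Fs_def)
    have G: "additive_polynomial_functor ?d (functor_sum Fs)"
      by (rule sum_additive[OF Fs])
    note G' = additive_polynomial[OF G]
    have lines: "(line_reps ?d :: 'k rep set) \<subseteq> Bobj ?d"
      using triv sign by (simp add: line_reps_def)
    have one: "fobj (Fr_plus p j) (triv_rep :: 'k rep) = 1" "fobj (Fr_minus p j) (sign_rep :: 'k rep) = 1"
      unfolding Fr_plus_def Fr_minus_def
      by (rule fobj_simple_top_line[OF triv], rule fobj_simple_top_line[OF sign])
    have zero: "fobj (Fr_plus p j) (sign_rep :: 'k rep) = 0" "fobj (Fr_minus p j) (triv_rep :: 'k rep) = 0"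
      if "?d \<noteq> 1"
      unfolding Fr_plus_def Fr_minus_def
      using fobj_simple_top_zero[OF triv sign(1)] fobj_simple_top_zero[OF sign triv(1)]
        triv_sign_hom_zero[OF d[OF that] two] by (simp_all only: rdim_lines)
    have obj: "fobj F L = fobj (functor_sum Fs) L" if L: "L \<in> line_reps ?d" for L
    proof (cases "?d = 1")
      case True
      then have "L = triv_rep"
        using L by (simp add: line_reps_def)
      then show ?thesis
        unfolding Fs_def fobj_functor_sum_replicate using True one by simp
    next
      case False
      then have "L = triv_rep \<or> L = sign_rep"
        using L by (simp add: line_reps_def)
      then show ?thesis
        unfolding Fs_def fobj_functor_sum_replicate using False one zero[OF False] by auto
    qed
    have mor: "fmor F L L' h = fmor (functor_sum Fs) L L' h"
      if L: "L \<in> line_reps ?d" and L': "L' \<in> line_reps ?d" and h: "h \<in> rep_hom ?d L L'" for L L' h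
    proof (cases "L = L'")
      case True
      have "L \<in> Bobj ?d" "rdim L = 1"
        using L lines by (auto simp: line_reps_def rdim_lines split: if_splits)
      then show ?thesis
        using functor_line_endo[OF F', of L h] functor_line_endo[OF G', of L h] h obj[OF L] True by simp
    next
      case False
      then have "?d \<noteq> 1" and LL': "L = triv_rep \<and> L' = sign_rep \<or> L = sign_rep \<and> L' = triv_rep"
        using L L' by (auto simp: line_reps_def split: if_splits)
      then have h0: "h = 0\<^sub>m (rdim L') (rdim L)"
        using h triv_sign_hom_zero[OF d two] by (auto simp: rdim_lines)
      have LB: "L \<in> Bobj ?d" "L' \<in> Bobj ?d"
        using L L' lines by blast+
      show ?thesis
        unfolding h0 functor_zero[OF F' LB] functor_zero[OF G' LB] obj[OF L] obj[OF L'] ..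
    qed
    have "functor_iso ?d F (functor_sum Fs)"
      by (rule functor_iso_by_lines[OF F G lines splits_line_reps obj mor])
    then show ?thesis
      using Fs by blast
  qed
  moreover have "additive_polynomial_functor ?d F"
    if "polynomial_functor ?d F" "set Fs \<subseteq> {Fr_plus p j, Fr_minus p j}" "functor_iso ?d F (functor_sum Fs)"
    for F :: "'k rep_functor" and Fs
    by (rule additive_functor_iso[OF tensor_rep_Bobj that(1) sum_additive[OF that(2)] that(3)])
  ultimately show ?thesis
    using sum_additive by blast
qed

end
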